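(* Let $P\subset\mathbb{R}^n$ be a simplicial lattice polytope containing the origin as an interior point, with associated orbifold cohomology $H^{2*}_{\mathrm{orb}}(\mathcal{X})$. Assume that $H^{2*}_{\mathrm{orb}}(\mathcal{X})$ is equipped with a Poincaré–Lefschetz conjugation and let $H^{2*}_{\mathrm{orb},\mathbb{R}}(\mathcal{X})$ be the corresponding real form. Then the tuple $$\mathrm{MHS}_{\mathrm{orb}}:=(H^{2*}_{\mathrm{orb}}(\mathcal{X}),H^{2*}_{\mathrm{orb},\mathbb{R}}(\mathcal{X}),F^\bullet,W_\bullet)$$ is a mixed Hodge structure, where $F^\bullet$ and $W_\bullet$ are the Hodge and weight filtrations defined in the context.
   Context: **Orbifold cohomology.** $\mathcal{V}(P)$ is the set of vertices of $P$, $\Sigma_P$ the fan of cones over the faces of $P$, $\mathcal{X}$ the toric Deligne–Mumford stack (Borisov–Chen–Smith) of the stacky fan $(\mathbb{Z}^n,\Sigma_P,\mathcal{V}(P))$. For $\sigma\in\Sigma_P$, $\mathrm{Box}(\sigma)$ is the set of $v\in\mathbb{Z}^n$ of the form $v=\sum q_bb$, sum over the vertices $b$ of $P$ generating the rays of $\sigma$, with all $0<q_b<1$ (so $\mathrm{Box}(\{0\})=\{0\}$). The set of labels of the sectors is $F=\bigcup_\sigma\mathrm{Box}(\sigma)$. For $\ell=\sum q_bb\in F$: $\sigma(\ell)$ is the smallest cone containing $\ell$; $X_\ell$ (underlying space of the sector) is the simplicial toric variety of the quotient fan $\Sigma_P/\sigma(\ell)$; $n_\ell=\dim X_\ell=n-\dim\sigma(\ell)$;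 the age is $i_\ell=\sum q_b$; $\ell^{-1}=\sum(1-q_b)b\in F$. One has $n_\ell+i_\ell+i_{\ell^{-1}}=n$. $H^k(X_\ell)$ means $H^k(X_\ell;\mathbb{C})$ and $H^{2\alpha}_{\mathrm{orb}}(\mathcal{X})=\bigoplus_{\ell\in F}H^{2(\alpha-i_\ell)}(X_\ell)$, $\alpha\in\mathbb{Q}$ (summands are $0$ unless $\alpha-i_\ell\in\mathbb{Z}_{\ge0}$). $[x]$ is the integer part. **Filtrations.** For $p,m\in\mathbb{Z}$: if $i_\ell\in\mathbb{Z}$, $F^pH^{2*}(X_\ell)=\bigoplus_{i\ge p}H^{2(n-i-i_\ell)}(X_\ell)$ and $W_mH^{2*}(X_\ell)=\bigoplus_{n+n_\ell-m\le2j}H^{2j}(X_\ell)$; if $i_\ell\notin\mathbb{Z}$, $F^pH^{2*}(X_\ell)=\bigoplus_{i\ge p}H^{2(n-1-i-[i_\ell])}(X_\ell)$ and $W_mH^{2*}(X_\ell)=\bigoplus_{n-1+n_\ell-m\le2j}H^{2j}(X_\ell)$. Then $F^p$ and $W_m$ on $H^{2*}_{\mathrm{orb}}(\mathcal{X})$ are the direct sums over $\ell\in F$. **Conjugations.** A conjugation is a $\mathbb{C}$-antilinear involution; its real form is its fixed subspace. A Poincaré–Lefschetz conjugation on $H^{2*}_{\mathrm{orb}}(\mathcal{X})$ is a conjugation such that $\overline{H^{2i}(X_\ell)}\subset\bigoplus_{j\ge i}H^{2j}(X_{\ell^{-1}})$ for all $\ell\in F$ and all $i$. *)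

theory Defs
  imports "HOL-Analysis.Analysis" "HOL-Homology.Homology" "HOL-Algebra.Module" "HOL-Algebra.AbelCoset"
    "HOL-Algebra.Algebraic_Closure_Type"
begin

section \<open>Complex vector spaces\<close>

text \<open>Complex vector spaces are HOL-Algebra modules over \<open>complex_field\<close>. The record fields
  \<open>mult\<close> and \<open>one\<close>, which modules inherit from rings, play no role and are left undefined.\<close>

abbreviation complex_field :: "complex ring" where
  "complex_field \<equiv> ring_of_type_algebra"

definition quotient_module :: "(complex, 'v) module \<Rightarrow> 'v set \<Rightarrow> (complex, 'v set) module" where
  "quotient_module M N =
     \<lparr>carrier = a_rcosets\<^bsub>M\<^esub> N, monoid.mult = undefined, one = undefined,
      zero = N, add = (\<lambda>A B. A <+>\<^bsub>M\<^esub> B),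
      module.smult = (\<lambda>a A. N <+>\<^bsub>M\<^esub> ((\<lambda>x. a \<odot>\<^bsub>M\<^esub> x) ` A))\<rparr>"

definition direct_sum_module ::
  "'i set \<Rightarrow> ('i \<Rightarrow> (complex, 'v) module) \<Rightarrow> (complex, 'i \<Rightarrow> 'v) module" where
  "direct_sum_module I M =
     \<lparr>carrier = {x \<in> \<Pi>\<^sub>E i\<in>I. carrier (M i). finite {i \<in> I. x i \<noteq> \<zero>\<^bsub>M i\<^esub>}},
      monoid.mult = undefined, one = undefined,
      zero = (\<lambda>i\<in>I. \<zero>\<^bsub>M i\<^esub>), add = (\<lambda>x y. \<lambda>i\<in>I. x i \<oplus>\<^bsub>M i\<^esub> y i),
      module.smult = (\<lambda>a x. \<lambda>i\<in>I. a \<odot>\<^bsub>M i\<^esub> x i)\<rparr>"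

definition finite_dimensional :: "(complex, 'v) module \<Rightarrow> bool" where
  "finite_dimensional V \<longleftrightarrow>
     (\<exists>B. finite B \<and> B \<subseteq> carrier V \<and>
        (\<forall>v\<in>carrier V. \<exists>a. v = (\<Oplus>\<^bsub>V\<^esub>b\<in>B. a b \<odot>\<^bsub>V\<^esub> b)))"


section \<open>Mixed Hodge structures\<close>

text \<open>A real form of \<open>V\<close> is a real subspace \<open>R\<close> with \<open>V = R \<oplus> \<i> R\<close>.\<close>

definition is_real_form :: "(complex, 'v) module \<Rightarrow> 'v set \<Rightarrow> bool" where
  "is_real_form V R \<longleftrightarrow>
     R \<subseteq> carrier V \<and> \<zero>\<^bsub>V\<^esub> \<in> R \<and>
     (\<forall>x\<in>R. \<forall>y\<in>R. x \<oplus>\<^bsub>V\<^esub> y \<in> R) \<and>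
     (\<forall>t::real. \<forall>x\<in>R. complex_of_real t \<odot>\<^bsub>V\<^esub> x \<in> R) \<and>
     (\<forall>v\<in>carrier V. \<exists>!(x, y). x \<in> R \<and> y \<in> R \<and> v = x \<oplus>\<^bsub>V\<^esub> \<i> \<odot>\<^bsub>V\<^esub> y)"

definition conjugate_wrt :: "(complex, 'v) module \<Rightarrow> 'v set \<Rightarrow> 'v \<Rightarrow> 'v" where
  "conjugate_wrt V R v =
     (THE w. \<exists>x\<in>R. \<exists>y\<in>R. v = x \<oplus>\<^bsub>V\<^esub> \<i> \<odot>\<^bsub>V\<^esub> y \<and> w = x \<oplus>\<^bsub>V\<^esub> (- \<i>) \<odot>\<^bsub>V\<^esub> y)"

definition defined_over_real_form :: "(complex, 'v) module \<Rightarrow> 'v set \<Rightarrow> 'v set \<Rightarrow> bool" where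
  "defined_over_real_form V R U \<longleftrightarrow>
     U = {x \<oplus>\<^bsub>V\<^esub> \<i> \<odot>\<^bsub>V\<^esub> y | x y. x \<in> U \<inter> R \<and> y \<in> U \<inter> R}"

definition finite_decreasing_filtration :: "(complex, 'v) module \<Rightarrow> (int \<Rightarrow> 'v set) \<Rightarrow> bool" where
  "finite_decreasing_filtration V F \<longleftrightarrow>
     (\<forall>p. submodule (F p) complex_field V) \<and> (\<forall>p. F (p + 1) \<subseteq> F p) \<and>
     (\<exists>p. F p = carrier V) \<and> (\<exists>p. F p = {\<zero>\<^bsub>V\<^esub>})"

definition finite_increasing_filtration :: "(complex, 'v) module \<Rightarrow> (int \<Rightarrow> 'v set) \<Rightarrow> bool" where
  "finite_increasing_filtration V W \<longleftrightarrow> finite_decreasing_filtration V (\<lambda>m. W (- m))"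

definition pure_hodge_structure ::
  "int \<Rightarrow> (complex, 'v) module \<Rightarrow> 'v set \<Rightarrow> (int \<Rightarrow> 'v set) \<Rightarrow> bool" where
  "pure_hodge_structure m V R F \<longleftrightarrow>
     Module.module complex_field V \<and> finite_dimensional V \<and> is_real_form V R \<and>
     finite_decreasing_filtration V F \<and>
     (\<forall>p. let G = conjugate_wrt V R ` F (m + 1 - p)
           in F p \<inter> G = {\<zero>\<^bsub>V\<^esub>} \<and> F p <+>\<^bsub>V\<^esub> G = carrier V)"

definition weight_graded ::
  "(complex, 'v) module \<Rightarrow> (int \<Rightarrow> 'v set) \<Rightarrow> int \<Rightarrow> (complex, 'v set) module" where
  "weight_graded V W m = quotient_module (V\<lparr>carrier := W m\<rparr>) (W (m - 1))"

definition weight_graded_image ::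
  "(complex, 'v) module \<Rightarrow> (int \<Rightarrow> 'v set) \<Rightarrow> int \<Rightarrow> 'v set \<Rightarrow> 'v set set" where
  "weight_graded_image V W m U = (\<lambda>x. W (m - 1) +>\<^bsub>V\<^esub> x) ` (U \<inter> W m)"

definition mixed_hodge_structure ::
  "(complex, 'v) module \<Rightarrow> 'v set \<Rightarrow> (int \<Rightarrow> 'v set) \<Rightarrow> (int \<Rightarrow> 'v set) \<Rightarrow> bool" where
  "mixed_hodge_structure V R F W \<longleftrightarrow>
     Module.module complex_field V \<and> finite_dimensional V \<and> is_real_form V R \<and>
     finite_decreasing_filtration V F \<and> finite_increasing_filtration V W \<and>
     (\<forall>m. defined_over_real_form V R (W m)) \<and>
     (\<forall>m. pure_hodge_structure m (weight_graded V W m) (weight_graded_image V W m R)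
            (\<lambda>p. weight_graded_image V W m (F p)))"

definition conjugation :: "(complex, 'v) module \<Rightarrow> ('v \<Rightarrow> 'v) \<Rightarrow> bool" where
  "conjugation V c \<longleftrightarrow>
     (\<forall>x\<in>carrier V. c x \<in> carrier V \<and> c (c x) = x) \<and>
     (\<forall>x\<in>carrier V. \<forall>y\<in>carrier V. c (x \<oplus>\<^bsub>V\<^esub> y) = c x \<oplus>\<^bsub>V\<^esub> c y) \<and>
     (\<forall>a. \<forall>x\<in>carrier V. c (a \<odot>\<^bsub>V\<^esub> x) = cnj a \<odot>\<^bsub>V\<^esub> c x)"

definition real_form :: "(complex, 'v) module \<Rightarrow> ('v \<Rightarrow> 'v) \<Rightarrow> 'v set" where
  "real_form V c = {x \<in> carrier V. c x = x}"


section \<open>Singular cohomology with complex coefficients\<close>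

type_synonym 'a cochain = "((nat \<Rightarrow> real) \<Rightarrow> 'a) \<Rightarrow> complex"

text \<open>A cochain is a function on the singular simplices, extended by zero to all functions.\<close>

definition cochain_module :: "nat \<Rightarrow> 'a topology \<Rightarrow> (complex, 'a cochain) module" where
  "cochain_module k T =
     \<lparr>carrier = {\<phi>. \<forall>s. \<not> singular_simplex k T s \<longrightarrow> \<phi> s = 0}, monoid.mult = undefined, one = undefined,
      zero = (\<lambda>s. 0), add = (\<lambda>\<phi> \<psi> s. \<phi> s + \<psi> s), module.smult = (\<lambda>a \<phi> s. a * \<phi> s)\<rparr>"

definition coboundary :: "nat \<Rightarrow> 'a topology \<Rightarrow> 'a cochain \<Rightarrow> 'a cochain" where
  "coboundary k T \<phi> =
     (\<lambda>s. if singular_simplex (Suc k) T s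
          then \<Sum>i\<le>Suc k. (- 1) ^ i * \<phi> (singular_face (Suc k) i s) else 0)"

definition cocycles :: "nat \<Rightarrow> 'a topology \<Rightarrow> 'a cochain set" where
  "cocycles k T =
     {\<phi> \<in> carrier (cochain_module k T). coboundary k T \<phi> = \<zero>\<^bsub>cochain_module (Suc k) T\<^esub>}"

definition coboundaries :: "nat \<Rightarrow> 'a topology \<Rightarrow> 'a cochain set" where
  "coboundaries k T =
     (case k of 0 \<Rightarrow> {\<zero>\<^bsub>cochain_module 0 T\<^esub>}
      | Suc l \<Rightarrow> coboundary l T ` carrier (cochain_module l T))"

definition cohomology :: "nat \<Rightarrow> 'a topology \<Rightarrow> (complex, 'a cochain set) module" where
  "cohomology k T =
     quotient_module ((cochain_module k T)\<lparr>carrier := cocycles k T\<rparr>) (coboundaries k T)"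


section \<open>Toric varieties\<close>

definition quotient_topology :: "'a topology \<Rightarrow> ('a \<times> 'a) set \<Rightarrow> 'a set topology" where
  "quotient_topology T r =
     topology (\<lambda>U. U \<subseteq> topspace T // r \<and> openin T {x \<in> topspace T. r `` {x} \<in> U})"

lemma istopology_quotient:
  "istopology (\<lambda>U. U \<subseteq> topspace T // r \<and> openin T {x \<in> topspace T. r `` {x} \<in> U})"
proof -
  have 1: "{x \<in> topspace T. r `` {x} \<in> S \<inter> S'} =
      {x \<in> topspace T. r `` {x} \<in> S} \<inter> {x \<in> topspace T. r `` {x} \<in> S'}" for S S'
    by auto
  have 2: "{x \<in> topspace T. r `` {x} \<in> \<Union>\<K>} = (\<Union>K\<in>\<K>. {x \<in> topspace T. r `` {x} \<in> K})" for \<K>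
    by auto
  show ?thesis
    unfolding istopology_def 1 2 by blast
qed

lemma openin_quotient_topology:
  "openin (quotient_topology T r) U \<longleftrightarrow>
     U \<subseteq> topspace T // r \<and> openin T {x \<in> topspace T. r `` {x} \<in> U}"
  by (simp add: quotient_topology_def istopology_quotient)

text \<open>The lattice \<open>N\<close> and its dual lattice \<open>M\<close> are both the integral points of \<open>real ^ 'n\<close>,
  paired by the inner product.\<close>

definition integral_points :: "(real ^ 'n) set" where
  "integral_points = {v. \<forall>i. v $ i \<in> \<int>}"

definition dual_semigroup :: "(real ^ 'n) set \<Rightarrow> (real ^ 'n) set" where
  "dual_semigroup \<sigma> = {m \<in> integral_points. \<forall>v\<in>\<sigma>. 0 \<le> m \<bullet> v}"

type_synonym 'n character = "real ^ 'n \<Rightarrow> complex"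

text \<open>The complex points of \<open>Spec \<complex>[\<sigma>\<^sup>\<or> \<inter> M]\<close> are the monoid homomorphisms from \<open>\<sigma>\<^sup>\<or> \<inter> M\<close>
  to \<open>(\<complex>, *)\<close>, and the classical topology is that of pointwise convergence.\<close>

definition affine_toric_variety :: "(real ^ 'n) set \<Rightarrow> 'n character topology" where
  "affine_toric_variety \<sigma> =
     subtopology (product_topology (\<lambda>_. euclidean) (dual_semigroup \<sigma>))
       {\<gamma>. \<gamma> 0 = 1 \<and>
            (\<forall>m\<in>dual_semigroup \<sigma>. \<forall>m'\<in>dual_semigroup \<sigma>. \<gamma> (m + m') = \<gamma> m * \<gamma> m')}"

type_synonym 'n toric_point = "((real ^ 'n) set \<times> 'n character) set"

text \<open>Two charts \<open>\<sigma>\<close>, \<open>\<tau>\<close> are glued along the chart of \<open>\<sigma> \<inter> \<tau>\<close>, which maps to both of them by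
  restriction of characters.\<close>

definition toric_glueing ::
  "(real ^ 'n) set set \<Rightarrow> (((real ^ 'n) set \<times> 'n character) \<times> ((real ^ 'n) set \<times> 'n character)) set"
  where
  "toric_glueing \<Sigma> =
     {((\<sigma>, restrict \<gamma> (dual_semigroup \<sigma>)), (\<tau>, restrict \<gamma> (dual_semigroup \<tau>))) | \<sigma> \<tau> \<gamma>.
        \<sigma> \<in> \<Sigma> \<and> \<tau> \<in> \<Sigma> \<and> \<gamma> \<in> topspace (affine_toric_variety (\<sigma> \<inter> \<tau>))}"

definition toric_variety :: "(real ^ 'n) set set \<Rightarrow> 'n toric_point topology" where
  "toric_variety \<Sigma> = quotient_topology (sum_topology affine_toric_variety \<Sigma>) (toric_glueing \<Sigma>)"

text \<open>The cones of the quotient fan \<open>\<Sigma>/\<sigma>\<close> are the images in \<open>N\<^sub>\<real> / span \<sigma>\<close> of the cones \<open>\<tau> \<in> \<Sigma>\<close>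
  having \<open>\<sigma>\<close> as a face. They are represented by their preimages \<open>\<tau> + span \<sigma>\<close> in \<open>N\<^sub>\<real>\<close>. The lattice
  dual to \<open>N / (N \<inter> span \<sigma>)\<close> is \<open>M \<inter> \<sigma>\<^sup>\<bottom>\<close>, and every integral point that is nonnegative on
  \<open>\<tau> + span \<sigma>\<close> lies in it. So \<open>dual_semigroup (\<tau> + span \<sigma>)\<close> is the semigroup of the image cone with
  respect to the quotient lattice, and \<open>toric_variety\<close> of these preimages is the toric variety of
  the quotient fan, of dimension \<open>n - dim \<sigma>\<close>.\<close>

definition quotient_fan :: "(real ^ 'n) set set \<Rightarrow> (real ^ 'n) set \<Rightarrow> (real ^ 'n) set set" where
  "quotient_fan \<Sigma> \<sigma> = {{x + y | x y. x \<in> \<tau> \<and> y \<in> span \<sigma>} | \<tau>. \<tau> \<in> \<Sigma> \<and> \<sigma> face_of \<tau>}"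


section \<open>Simplicial lattice polytopes and sectors\<close>

definition vertices :: "(real ^ 'n) set \<Rightarrow> (real ^ 'n) set" where
  "vertices P = {b. b extreme_point_of P}"

definition simplicial_lattice_polytope :: "(real ^ 'n) set \<Rightarrow> bool" where
  "simplicial_lattice_polytope P \<longleftrightarrow>
     polytope P \<and> vertices P \<subseteq> integral_points \<and> (\<forall>S. S facet_of P \<longrightarrow> (\<exists>k. k simplex S))"

text \<open>The faces are the proper ones. The empty face gives the cone \<open>{0}\<close>.\<close>

definition face_fan :: "(real ^ 'n) set \<Rightarrow> (real ^ 'n) set set" where
  "face_fan P = {convex_cone hull S | S. S face_of P \<and> S \<noteq> P}"

definition ray_generators :: "(real ^ 'n) set \<Rightarrow> (real ^ 'n) set \<Rightarrow> (real ^ 'n) set" where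
  "ray_generators P \<sigma> = {b \<in> vertices P. (convex_cone hull {b}) face_of \<sigma>}"

definition is_box_coefficients ::
  "(real ^ 'n) set \<Rightarrow> (real ^ 'n) set \<Rightarrow> real ^ 'n \<Rightarrow> (real ^ 'n \<Rightarrow> real) \<Rightarrow> bool" where
  "is_box_coefficients P \<sigma> v q \<longleftrightarrow>
     (\<forall>b\<in>ray_generators P \<sigma>. 0 < q b \<and> q b < 1) \<and> (\<forall>b. b \<notin> ray_generators P \<sigma> \<longrightarrow> q b = 0) \<and>
     v = (\<Sum>b\<in>ray_generators P \<sigma>. q b *\<^sub>R b)"

definition Box :: "(real ^ 'n) set \<Rightarrow> (real ^ 'n) set \<Rightarrow> (real ^ 'n) set" where
  "Box P \<sigma> = {v \<in> integral_points. \<exists>q. is_box_coefficients P \<sigma> v q}"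

definition sectors :: "(real ^ 'n) set \<Rightarrow> (real ^ 'n) set" where
  "sectors P = (\<Union>\<sigma>\<in>face_fan P. Box P \<sigma>)"

definition sector_cone :: "(real ^ 'n) set \<Rightarrow> real ^ 'n \<Rightarrow> (real ^ 'n) set" where
  "sector_cone P l = (LEAST \<sigma>. \<sigma> \<in> face_fan P \<and> l \<in> \<sigma>)"

definition box_coefficients :: "(real ^ 'n) set \<Rightarrow> real ^ 'n \<Rightarrow> real ^ 'n \<Rightarrow> real" where
  "box_coefficients P l = (THE q. is_box_coefficients P (sector_cone P l) l q)"

definition age :: "(real ^ 'n) set \<Rightarrow> real ^ 'n \<Rightarrow> real" where
  "age P l = (\<Sum>b\<in>ray_generators P (sector_cone P l). box_coefficients P l b)"

definition inverse_sector :: "(real ^ 'n) set \<Rightarrow> real ^ 'n \<Rightarrow> real ^ 'n" where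
  "inverse_sector P l =
     (\<Sum>b\<in>ray_generators P (sector_cone P l). (1 - box_coefficients P l b) *\<^sub>R b)"

definition sector_space :: "(real ^ 'n) set \<Rightarrow> real ^ 'n \<Rightarrow> 'n toric_point topology" where
  "sector_space P l = toric_variety (quotient_fan (face_fan P) (sector_cone P l))"

definition sector_dim :: "(real ^ 'n) set \<Rightarrow> real ^ 'n \<Rightarrow> int" where
  "sector_dim P l = int CARD('n) - int (dim (sector_cone P l))"


section \<open>Orbifold cohomology\<close>

text \<open>The component of index \<open>(l, j)\<close> is \<open>H\<^sup>2\<^sup>j(X\<^sub>l; \<complex>)\<close>, which has orbifold degree
  \<open>2 * (j + age P l)\<close>.\<close>

type_synonym 'n orb_class = "(real ^ 'n) \<times> nat \<Rightarrow> 'n toric_point cochain set"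

definition orb_cohomology :: "(real ^ 'n) set \<Rightarrow> (complex, 'n orb_class) module" where
  "orb_cohomology P =
     direct_sum_module (sectors P \<times> UNIV) (\<lambda>(l, j). cohomology (2 * j) (sector_space P l))"

text \<open>The sum of the components with index in \<open>K\<close>; indices that do not occur contribute nothing.\<close>

definition orb_part :: "(real ^ 'n) set \<Rightarrow> ((real ^ 'n) \<times> nat) set \<Rightarrow> 'n orb_class set" where
  "orb_part P K =
     {x \<in> carrier (orb_cohomology P).
        \<forall>k \<in> sectors P \<times> UNIV - K. x k = \<zero>\<^bsub>orb_cohomology P\<^esub> k}"

definition hodge_filtration :: "(real ^ 'n) set \<Rightarrow> int \<Rightarrow> 'n orb_class set" where
  "hodge_filtration P p = orb_part P
     {(l, j). \<exists>i\<ge>p. real j =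
        (if age P l \<in> \<int> then real CARD('n) - of_int i - age P l
         else real CARD('n) - 1 - of_int i - of_int \<lfloor>age P l\<rfloor>)}"

definition weight_filtration :: "(real ^ 'n) set \<Rightarrow> int \<Rightarrow> 'n orb_class set" where
  "weight_filtration P m = orb_part P
     {(l, j). (if age P l \<in> \<int> then int CARD('n) + sector_dim P l - m
               else int CARD('n) - 1 + sector_dim P l - m) \<le> 2 * int j}"

definition poincare_lefschetz_conjugation ::
  "(real ^ 'n) set \<Rightarrow> ('n orb_class \<Rightarrow> 'n orb_class) \<Rightarrow> bool" where
  "poincare_lefschetz_conjugation P c \<longleftrightarrow>
     conjugation (orb_cohomology P) c \<and>
     (\<forall>l\<in>sectors P. \<forall>i. c ` orb_part P {(l, i)} \<subseteq> orb_part P ({inverse_sector P l} \<times> {i..}))"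

end

theory Submission
  imports Defs
begin

text \<open>
  The orbifold cohomology is the direct sum of the spaces \<open>H\<^sup>2\<^sup>j(X\<^sub>l)\<close>, and the theorem combines a
  symmetry of the index set with the finiteness of this sum.

  \<^item> The symmetry. The weight and the Hodge filtration are the filtrations by functions \<open>w\<close> and \<open>h\<close> of the
  index \<open>(l, j)\<close>: up to corrections for non-integral ages, \<open>w = n + n\<^sub>l - 2 j\<close> and \<open>h = n - j - i\<^sub>l\<close>. The
  ages of \<open>l\<close> and \<open>l\<^sup>-\<^sup>1\<close> add up to \<open>n - n\<^sub>l\<close>. Hence passing from \<open>(l, j)\<close> to \<open>(l\<^sup>-\<^sup>1, j)\<close> preserves \<open>w\<close>
  and replaces \<open>h\<close> by \<open>w - h\<close>. A Poincare-Lefschetz conjugation maps the summand of \<open>(l, j)\<close> to that of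
  \<open>(l\<^sup>-\<^sup>1, j)\<close> up to terms of larger degree \<open>j\<close>, that is, of smaller weight. So it preserves the weight
  filtration, and on the graded piece of weight \<open>m\<close> it exchanges Hodge degrees \<open>h\<close> and \<open>m - h\<close>, which is what
  a Hodge structure of weight \<open>m\<close> requires (\<open>hodge_bigraded\<close>).

  \<^item> The finiteness. A mixed Hodge structure is finite-dimensional and its filtrations are finite. There are finitely many
  sectors, and the cohomology of each has to be finite-dimensional and to vanish in large degrees. If two open sets and
  their intersection have finitely generated integral homology that vanishes in large degrees, then so does their
  union, by excision and the long exact sequence of a pair. A toric variety is the union of finitely many affine
  charts whose intersections are again charts (\<open>toric_fan.finite_homology_toric_variety\<close>). Each chart is contracted by a one-parameter subgroup onto a torus
  (\<open>finite_homology_affine_toric_variety\<close>), and a torus is an iterated product with a punctured plane, which is a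
  union of half planes. Finally, evaluation on finitely many cycles is injective on complex cohomology because
  \<open>\<complex>\<close> is divisible (\<open>cocycle_vanishing_on_cycles\<close>).

  Simpliciality of the polytope enters through the linear independence of the vertices of a proper face. It yields
  integral linear forms separating the faces of a cone, by which the charts are glued along open sets
  (\<open>simplicial_star.toric_fan_star\<close>), and it makes the box coefficients unique, so that ages and inverses of sectors are as
  expected.
\<close>

section \<open>Spaces with finitely generated homology\<close>

text \<open>Being finitely generated does not pass to subgroups and hence not to the middle term of an exact
  sequence. Asking it of all subgroups does. That \<open>B\<close> generates \<open>H\<close> is expressed by the
  minimality of \<open>H\<close> among the subgroups containing \<open>B\<close>.\<close>

definition noetherian_group :: "('a, 'b) monoid_scheme \<Rightarrow> bool" where
  "noetherian_group G \<longleftrightarrow> (\<forall>H. subgroup H G \<longrightarrow>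
     (\<exists>B. finite B \<and> B \<subseteq> H \<and> (\<forall>K. subgroup K G \<and> B \<subseteq> K \<longrightarrow> H \<subseteq> K)))"

lemma noetherian_groupD:
  assumes "noetherian_group G" "subgroup H G"
  shows "\<exists>B. finite B \<and> B \<subseteq> H \<and> (\<forall>K. subgroup K G \<and> B \<subseteq> K \<longrightarrow> H \<subseteq> K)"
  using assms(1)[unfolded noetherian_group_def, THEN spec, of H] assms(2) by (rule mp)

text \<open>Generators of a subgroup \<open>H\<close> of the middle group are lifts of generators of \<open>g H\<close>, together
  with images of generators of the preimage of \<open>H\<close> under \<open>f\<close>: the former determine an element of \<open>H\<close>
  up to the kernel of \<open>g\<close>, which the latter account for.\<close>

lemma noetherian_group_extension:
  assumes f: "group_hom A B f" and g: "group_hom B C g"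
    and ker: "kernel B C g = f ` carrier A"
    and A: "noetherian_group A" and C: "noetherian_group C"
  shows "noetherian_group B"
  unfolding noetherian_group_def
proof (intro allI impI)
  interpret f: group_hom A B f by (rule f)
  interpret g: group_hom B C g by (rule g)
  fix H assume H: "subgroup H B"
  have HB: "H \<subseteq> carrier B" using subgroup.subset[OF H] .
  have pre: "subgroup {a \<in> carrier A. f a \<in> K} A" if K: "subgroup K B" for K
  proof (rule group.subgroupI[OF f.G.is_group])
    show "{a \<in> carrier A. f a \<in> K} \<noteq> {}"
      using subgroup.one_closed[OF K] f.hom_one f.G.one_closed by force
  qed (use subgroup.m_closed[OF K] subgroup.m_inv_closed[OF K] in simp_all)
  obtain BA where "finite BA \<and> BA \<subseteq> {a \<in> carrier A. f a \<in> H} \<and>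
      (\<forall>K. subgroup K A \<and> BA \<subseteq> K \<longrightarrow> {a \<in> carrier A. f a \<in> H} \<subseteq> K)"
    using noetherian_groupD[OF A pre[OF H]] ..
  then have BA: "finite BA" "BA \<subseteq> {a \<in> carrier A. f a \<in> H}"
    "subgroup K A \<Longrightarrow> BA \<subseteq> K \<Longrightarrow> {a \<in> carrier A. f a \<in> H} \<subseteq> K" for K by simp_all
  have gH: "subgroup (g ` H) C"
    by (rule g.subgroup_img_is_subgroup[OF H])
  obtain BC where "finite BC \<and> BC \<subseteq> g ` H \<and> (\<forall>K. subgroup K C \<and> BC \<subseteq> K \<longrightarrow> g ` H \<subseteq> K)"
    using noetherian_groupD[OF C gH] ..
  then have BC: "finite BC" "BC \<subseteq> g ` H" "subgroup K C \<Longrightarrow> BC \<subseteq> K \<Longrightarrow> g ` H \<subseteq> K" for K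
    by simp_all
  obtain B' where B': "B' \<subseteq> H" "finite B'" "BC = g ` B'"
    using finite_subset_image[OF BC(1,2)] by blast
  show "\<exists>B0. finite B0 \<and> B0 \<subseteq> H \<and> (\<forall>K. subgroup K B \<and> B0 \<subseteq> K \<longrightarrow> H \<subseteq> K)"
  proof (intro exI conjI allI impI)
    show "finite (B' \<union> f ` BA)" "B' \<union> f ` BA \<subseteq> H"
      using B' BA by auto
    fix K assume "subgroup K B \<and> B' \<union> f ` BA \<subseteq> K"
    then have K: "subgroup K B" and BK: "B' \<subseteq> K" "f ` BA \<subseteq> K" by auto
    have KH: "subgroup (K \<inter> H) B"
      by (rule f.subgroups_Inter_pair[OF K H])
    have 1: "{a \<in> carrier A. f a \<in> H} \<subseteq> {a \<in> carrier A. f a \<in> K}"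
      using BA(2) BK by (intro BA(3) pre[OF K]) auto
    have 2: "g ` H \<subseteq> g ` (K \<inter> H)"
      using B' BK by (intro BC(3) g.subgroup_img_is_subgroup[OF KH]) auto
    show "H \<subseteq> K"
    proof
      fix h assume h: "h \<in> H"
      then obtain k where k: "k \<in> K" "k \<in> H" "g h = g k" using 2 by auto
      have hk: "h \<in> carrier B" "k \<in> carrier B" using h k HB by auto
      have "h \<otimes>\<^bsub>B\<^esub> inv\<^bsub>B\<^esub> k \<in> kernel B C g"
        using hk k(3) by (simp add: kernel_def)
      then obtain a where a: "a \<in> carrier A" "f a = h \<otimes>\<^bsub>B\<^esub> inv\<^bsub>B\<^esub> k"
        using ker by (metis imageE)
      have "f a \<in> H"
        unfolding a using h k(2) H by (simp add: subgroup.m_closed subgroup.m_inv_closed)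
      then have "f a \<in> K" using 1 a(1) by auto
      then have "f a \<otimes>\<^bsub>B\<^esub> k \<in> K" using k(1) K by (simp add: subgroup.m_closed)
      then show "h \<in> K" using hk by (simp add: a f.m_assoc)
    qed
  qed
qed

lemma trivial_group_extension:
  assumes f: "group_hom A B f" and g: "group_hom B C g"
    and ker: "kernel B C g = f ` carrier A"
    and A: "trivial_group A" and C: "trivial_group C"
  shows "trivial_group B"
proof -
  interpret f: group_hom A B f by (rule f)
  interpret g: group_hom B C g by (rule g)
  have "carrier B \<subseteq> kernel B C g"
    using C g.hom_closed by (auto simp: kernel_def trivial_group_def)
  moreover have "f ` carrier A = {\<one>\<^bsub>B\<^esub>}"
    using A by (auto simp: trivial_group_def)
  ultimately show ?thesis
    using ker by (auto simp: trivial_group_def f.is_group)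
qed

lemma trivial_imp_noetherian_group:
  assumes "trivial_group G" shows "noetherian_group G"
  unfolding noetherian_group_def
proof (intro allI impI)
  fix H assume "subgroup H G"
  then have "H \<subseteq> {\<one>\<^bsub>G\<^esub>}" "\<And>K. subgroup K G \<Longrightarrow> \<one>\<^bsub>G\<^esub> \<in> K"
    using assms subgroup.subset subgroup.one_closed by (force simp: trivial_group_def)+
  then show "\<exists>B. finite B \<and> B \<subseteq> H \<and> (\<forall>K. subgroup K G \<and> B \<subseteq> K \<longrightarrow> H \<subseteq> K)"
    by (intro exI[of _ "{}"]) auto
qed

lemma noetherian_group_iso:
  assumes "G \<cong> H" "noetherian_group G" "group G" "group H"
  shows "noetherian_group H"
proof -
  obtain h where h: "h \<in> iso G H" using assms by (auto simp: is_iso_def)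
  let ?T = "singleton_group ()"
  show ?thesis
  proof (rule noetherian_group_extension)
    show "group_hom G H h"
      using h assms by (auto simp: group_hom_def group_hom_axioms_def iso_def)
    show "group_hom H ?T (\<lambda>_. ())"
      using assms by (auto simp: group_hom_def group_hom_axioms_def hom_def)
    show "kernel H ?T (\<lambda>_. ()) = h ` carrier G"
      using h by (auto simp: kernel_def iso_def bij_betw_def singleton_group_def)
    show "noetherian_group ?T" by (simp add: trivial_imp_noetherian_group)
  qed (fact assms)
qed

text \<open>A nonzero subgroup of the integers is generated by its smallest positive element.\<close>

lemma noetherian_integer_group: "noetherian_group integer_group"
  unfolding noetherian_group_def
proof (intro allI impI)
  fix H assume H: "subgroup H integer_group"
  have mult: "k * b \<in> K" if K: "subgroup K integer_group" and "b \<in> K" for K and k b :: int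
  proof -
    interpret integer: group integer_group by simp
    have "b [^]\<^bsub>integer_group\<^esub> k \<in> K"
      using integer.subgroup_int_pow_closed K that by blast
    then show ?thesis by simp
  qed
  have diff: "a - b \<in> H" if "a \<in> H" "b \<in> H" for a b
    using subgroup.m_closed[OF H that(1) subgroup.m_inv_closed[OF H that(2)]] by simp
  show "\<exists>B. finite B \<and> B \<subseteq> H \<and> (\<forall>K. subgroup K integer_group \<and> B \<subseteq> K \<longrightarrow> H \<subseteq> K)"
  proof (cases "\<exists>x\<in>H. x > 0")
    case False
    have "H \<subseteq> {0}"
    proof
      fix x assume "x \<in> H"
      moreover from this have "- x \<in> H" using mult[OF H, of x "-1"] by simp
      ultimately show "x \<in> {0}" using False by (metis linorder_neqE_linordered_idom neg_0_less_iff_less singletonI)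
    qed
    then show ?thesis
      using subgroup.one_closed[of _ integer_group] by (intro exI[of _ "{}"]) auto
  next
    case True
    define P where "P n \<longleftrightarrow> n > 0 \<and> int n \<in> H" for n :: nat
    have "\<exists>n. P n" using True by (metis P_def zero_less_imp_eq_int)
    then have b: "P (LEAST n. P n)" and least: "\<And>n. P n \<Longrightarrow> (LEAST n. P n) \<le> n"
      by (auto intro: LeastI_ex Least_le)
    define b where "b = int (LEAST n. P n)"
    have b0: "b > 0" "b \<in> H" using b by (auto simp: b_def P_def)
    have "x mod b = 0" if "x \<in> H" for x
    proof (rule ccontr)
      assume "x mod b \<noteq> 0"
      then have pos: "x mod b > 0" using b0 by (simp add: order_le_neq_trans)
      have "x mod b \<in> H"
        using diff[OF that mult[OF H b0(2), of "x div b"]]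
        by (simp add: minus_div_mult_eq_mod)
      then have "P (nat (x mod b))" using pos by (simp add: P_def)
      then have "b \<le> x mod b" using least pos unfolding b_def by fastforce
      then show False using pos_mod_bound[OF b0(1), of x] by linarith
    qed
    then have "x = (x div b) * b" if "x \<in> H" for x
      using that by (metis add.right_neutral div_mult_mod_eq)
    then have "x \<in> K" if "subgroup K integer_group" "b \<in> K" "x \<in> H" for x K
      using mult[OF that(1,2)] that(3) by metis
    then show ?thesis
      using b0 by (intro exI[of _ "{b}"]) auto
  qed
qed

text \<open>The relative form covers spaces (\<open>S = {}\<close>) and the pairs that appear in the long exact sequence
  and in excision.\<close>

definition finite_homology :: "'a topology \<Rightarrow> 'a set \<Rightarrow> bool" where
  "finite_homology Z S \<longleftrightarrow>
     (\<forall>p. noetherian_group (relative_homology_group p Z S)) \<and>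
     (\<exists>N. \<forall>p>N. trivial_group (relative_homology_group p Z S))"

lemma finite_homologyD:
  assumes "finite_homology Z S"
  shows "noetherian_group (relative_homology_group p Z S)"
    and "\<exists>N. \<forall>p>N. trivial_group (relative_homology_group p Z S)"
  using assms[unfolded finite_homology_def, THEN conjunct1, THEN spec]
    assms[unfolded finite_homology_def, THEN conjunct2] .

lemma finite_homologyI:
  assumes "\<And>p. noetherian_group (relative_homology_group p Z S)"
    and "\<And>p. p > N \<Longrightarrow> trivial_group (relative_homology_group p Z S)"
  shows "finite_homology Z S"
  unfolding finite_homology_def using assms by (intro conjI allI exI[of _ N] impI)

lemma finite_homology_iso:
  assumes "\<And>p. relative_homology_group p Z S \<cong> relative_homology_group p Y T" "finite_homology Z S"
  shows "finite_homology Y T"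
proof -
  obtain N where N: "\<forall>p>N. trivial_group (relative_homology_group p Z S)"
    using finite_homologyD(2)[OF assms(2)] ..
  show ?thesis
  proof (rule finite_homologyI)
    show "noetherian_group (relative_homology_group p Y T)" for p
      by (rule noetherian_group_iso[OF assms(1)[of p] finite_homologyD(1)[OF assms(2)]]) simp_all
    show "trivial_group (relative_homology_group p Y T)" if "p > N" for p
      using isomorphic_group_triviality[OF assms(1)[of p]] N that by simp
  qed
qed

lemma exact_seq_group_homs:
  assumes "exact_seq ([C, B, A], [g, f])"
  shows "group_hom A B f" "group_hom B C g" "kernel B C g = f ` carrier A"
proof -
  note C = assms[unfolded exact_seq_cons_iff]
  show f: "group_hom A B f"
    by (rule C[THEN conjunct1, unfolded exact_seq_end_iff, THEN conjunct2])
  show "kernel B C g = f ` carrier A"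
    using C by simp
  show "group_hom B C g"
    using C group_hom.axioms(2)[OF f] by (simp add: group_hom_def group_hom_axioms_def)
qed

text \<open>In the long exact sequence of the pair, the relative group of degree \<open>p\<close> lies between the group of
  the space in degree \<open>p\<close> and the group of the subspace in degree \<open>p - 1\<close>; hence the shift by one
  in the bound below.\<close>

lemma finite_homology_pair:
  assumes S: "finite_homology (subtopology Z S) {}" and Z: "finite_homology Z {}"
  shows "finite_homology Z S"
proof -
  obtain M where M: "\<forall>p>M. trivial_group (homology_group p (subtopology Z S))"
    using finite_homologyD(2)[OF S] ..
  obtain N where N: "\<forall>p>N. trivial_group (homology_group p Z)"
    using finite_homologyD(2)[OF Z] ..
  show ?thesis
  proof (rule finite_homologyI)
    fix p
    note ext = exact_seq_group_homs[OF homology_exactness_axiom_1[of p Z S]]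
    show "noetherian_group (relative_homology_group p Z S)"
      by (rule noetherian_group_extension[OF ext finite_homologyD(1)[OF Z] finite_homologyD(1)[OF S]])
    show "trivial_group (relative_homology_group p Z S)" if "p > max (M + 1) N"
      by (rule trivial_group_extension[OF ext]) (use M N that in simp_all)
  qed
qed

lemma finite_homology_of_pair:
  assumes S: "finite_homology (subtopology Z S) {}" and ZS: "finite_homology Z S"
  shows "finite_homology Z {}"
proof -
  obtain M where M: "\<forall>p>M. trivial_group (homology_group p (subtopology Z S))"
    using finite_homologyD(2)[OF S] ..
  obtain N where N: "\<forall>p>N. trivial_group (relative_homology_group p Z S)"
    using finite_homologyD(2)[OF ZS] ..
  show ?thesis
  proof (rule finite_homologyI)
    fix p
    note ext = exact_seq_group_homs[OF homology_exactness_axiom_3[of p Z S]]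
    show "noetherian_group (homology_group p Z)"
      by (rule noetherian_group_extension[OF ext finite_homologyD(1)[OF S] finite_homologyD(1)[OF ZS]])
    show "trivial_group (homology_group p Z)" if "p > max M N"
      by (rule trivial_group_extension[OF ext]) (use M N that in simp_all)
  qed
qed

text \<open>A substitute for the Mayer-Vietoris sequence: excision of the complement of \<open>V\<close> turns the
  homology of the pair \<open>(V, U \<inter> V)\<close> into that of \<open>(Z, U)\<close>, so two applications of the long exact
  sequence of a pair suffice.\<close>

lemma finite_homology_Un_topspace:
  assumes U: "openin Z U" and V: "openin Z V" and UV: "U \<union> V = topspace Z"
    and fin: "finite_homology (subtopology Z U) {}" "finite_homology (subtopology Z V) {}"
      "finite_homology (subtopology Z (U \<inter> V)) {}"
  shows "finite_homology Z {}"
proof -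
  have "V \<inter> (U \<inter> V) = U \<inter> V" by auto
  then have "subtopology (subtopology Z V) (U \<inter> V) = subtopology Z (U \<inter> V)"
    by (simp only: subtopology_subtopology)
  then have 1: "finite_homology (subtopology Z V) (U \<inter> V)"
    using fin by (simp add: finite_homology_pair)
  have "relative_homology_group p (subtopology Z (topspace Z - (topspace Z - V))) (U - (topspace Z - V))
      \<cong> relative_homology_group p (subtopology Z (topspace Z)) U" for p
  proof (rule is_isoI[OF homology_excision_axiom])
    show "Z closure_of (topspace Z - V) \<subseteq> Z interior_of U"
    proof -
      have "Z closure_of (topspace Z - V) = topspace Z - V"
        using V by (simp add: closure_of_closedin closedin_def openin_subset Diff_Diff_Int inf_absorb2)
      then show ?thesis using U UV by (auto simp: interior_of_openin)
    qed
    show "U \<subseteq> topspace Z" using U openin_subset by blast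
  qed
  moreover have "topspace Z - (topspace Z - V) = V" "U - (topspace Z - V) = U \<inter> V"
    using openin_subset[OF V] openin_subset[OF U] by auto
  ultimately have "relative_homology_group p (subtopology Z V) (U \<inter> V) \<cong> relative_homology_group p Z U" for p
    by simp
  then have "finite_homology Z U"
    using 1 by (rule finite_homology_iso)
  with fin(1) show ?thesis by (rule finite_homology_of_pair)
qed

lemma finite_homology_Un:
  assumes U: "openin Z U" and V: "openin Z V"
    and fin: "finite_homology (subtopology Z U) {}" "finite_homology (subtopology Z V) {}"
      "finite_homology (subtopology Z (U \<inter> V)) {}"
  shows "finite_homology (subtopology Z (U \<union> V)) {}"
proof (rule finite_homology_Un_topspace)
  have "U \<subseteq> topspace Z" "V \<subseteq> topspace Z" using U V openin_subset by auto
  then show "U \<union> V = topspace (subtopology Z (U \<union> V))" by auto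
  show "openin (subtopology Z (U \<union> V)) U" "openin (subtopology Z (U \<union> V)) V"
    using U V by (auto simp: openin_open_subtopology openin_Un)
  have "(U \<union> V) \<inter> U = U" "(U \<union> V) \<inter> V = V" "(U \<union> V) \<inter> (U \<inter> V) = U \<inter> V" by auto
  then show "finite_homology (subtopology (subtopology Z (U \<union> V)) U) {}"
    "finite_homology (subtopology (subtopology Z (U \<union> V)) V) {}"
    "finite_homology (subtopology (subtopology Z (U \<union> V)) (U \<inter> V)) {}"
    using fin by (simp_all add: subtopology_subtopology)
qed

lemma finite_homology_empty:
  assumes "topspace Z = {}" shows "finite_homology Z {}"
  by (rule finite_homologyI)
    (simp_all add: trivial_imp_noetherian_group trivial_homology_group_empty[OF assms])

lemma finite_homology_singleton:
  assumes "topspace Z = {a}" shows "finite_homology Z {}"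
proof (rule finite_homologyI)
  show "noetherian_group (homology_group p Z)" for p
  proof (cases "p = 0")
    case True
    have "integer_group \<cong> homology_group 0 Z"
      by (rule group.iso_sym[OF group_relative_homology_group homology_coefficients[OF assms]])
    then show ?thesis
      unfolding True by (rule noetherian_group_iso[OF _ noetherian_integer_group]) simp_all
  qed (simp add: trivial_imp_noetherian_group homology_dimension_axiom[OF assms])
  show "trivial_group (homology_group p Z)" if "p > 0" for p
    using homology_dimension_axiom[OF assms] that by simp
qed

lemma finite_homology_homotopy_equivalent:
  assumes "Z homotopy_equivalent_space Y" "finite_homology Z {}"
  shows "finite_homology Y {}"
  by (rule finite_homology_iso[OF homotopy_equivalent_space_imp_isomorphic_homology_groups[OF assms(1)] assms(2)])

text \<open>Induction on the number of sets. The intersection of \<open>U\<close> with a union of sets of \<open>\<K>\<close> is again a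
  union of at most as many sets of \<open>\<K>\<close>, because \<open>\<K>\<close> is closed under intersections.\<close>

lemma finite_homology_Union:
  assumes op: "\<And>U. U \<in> \<K> \<Longrightarrow> openin Z U"
    and int: "\<And>U V. U \<in> \<K> \<Longrightarrow> V \<in> \<K> \<Longrightarrow> U \<inter> V \<in> \<K>"
    and fin: "\<And>U. U \<in> \<K> \<Longrightarrow> finite_homology (subtopology Z U) {}"
    and "finite \<U>" "\<U> \<subseteq> \<K>"
  shows "finite_homology (subtopology Z (\<Union>\<U>)) {}"
  using assms(4,5)
proof (induction "card \<U>" arbitrary: \<U> rule: less_induct)
  case less
  show ?case
  proof (cases "\<U> = {}")
    case True
    then show ?thesis by (auto intro!: finite_homology_empty)
  next
    case False
    then obtain U \<V> where UV: "\<U> = insert U \<V>" "U \<notin> \<V>" by (metis Set.set_insert ex_in_conv)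
    then have \<V>: "finite \<V>" "card \<V> < card \<U>" "\<V> \<subseteq> \<K>" "U \<in> \<K>"
      using less.prems by auto
  have "finite_homology (subtopology Z (U \<union> \<Union>\<V>)) {}"
  proof (rule finite_homology_Un)
    have "finite_homology (subtopology Z (\<Union>((\<inter>) U ` \<V>))) {}"
      using \<V> int le_less_trans[OF card_image_le[OF \<V>(1)] \<V>(2)] by (intro less.hyps) auto
    then show "finite_homology (subtopology Z (U \<inter> \<Union>\<V>)) {}" by simp
  qed (use \<V> op fin less.hyps[OF \<V>(2,1,3)] in auto)
  then show ?thesis by (simp add: UV)
  qed
qed

section \<open>Character spaces of lattices and affine toric varieties\<close>

no_notation fps_nth (infixl \<open>$\<close> 75)

lemma continuous_map_complex_intros:
  fixes f g :: "'a \<Rightarrow> complex"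
  assumes f: "continuous_map Z euclidean f"
  shows continuous_map_complex_mult:
      "continuous_map Z euclidean g \<Longrightarrow> continuous_map Z euclidean (\<lambda>x. f x * g x)"
    and continuous_map_complex_powi:
      "(\<And>x. x \<in> topspace Z \<Longrightarrow> f x \<noteq> 0) \<Longrightarrow> continuous_map Z euclidean (\<lambda>x. f x powi k)"
    and continuous_map_complex_inverse:
      "(\<And>x. x \<in> topspace Z \<Longrightarrow> f x \<noteq> 0) \<Longrightarrow> continuous_map Z euclidean (\<lambda>x. inverse (f x))"
  using f by (simp_all add: continuous_map_atin tendsto_mult tendsto_power_int tendsto_inverse)

lemma continuous_map_complex_of_real_pow:
  assumes "continuous_map Z euclideanreal r"
  shows "continuous_map Z euclidean (\<lambda>x. complex_of_real (r x) ^ k)"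
  using assms by (simp add: continuous_map_atin tendsto_of_real tendsto_power)

text \<open>The straight line homotopy to a point of \<open>K\<close> makes the projection to \<open>Z\<close> a homotopy equivalence.\<close>

lemma finite_homology_prod_convex:
  fixes K :: "complex set"
  assumes K: "convex K" and fin: "finite_homology Z {}"
  shows "finite_homology (prod_topology Z (top_of_set K)) {}"
proof (cases "K = {}")
  case True
  then show ?thesis by (intro finite_homology_empty) simp
next
  case False
  then obtain a where a: "a \<in> K" by auto
  let ?P = "prod_topology Z (top_of_set K)"
  let ?f = "fst :: 'a \<times> complex \<Rightarrow> 'a" and ?g = "\<lambda>z. (z, a)"
  let ?h = "\<lambda>u. (fst (snd u), complex_of_real (1 - fst u) * a + complex_of_real (fst u) * snd (snd u))"
  have f: "continuous_map ?P Z ?f"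
    by (rule continuous_map_fst)
  have g: "continuous_map Z ?P ?g"
    using a by (intro continuous_map_pairedI) (simp_all add: continuous_map_in_subtopology)
  have h: "continuous_map (prod_topology (top_of_set {0..1}) ?P) ?P ?h"
  proof (intro continuous_map_pairedI)
    let ?Q = "prod_topology (top_of_set {0..1::real}) ?P"
    show "continuous_map ?Q Z (\<lambda>u. fst (snd u))"
      using continuous_map_compose[OF continuous_map_snd continuous_map_fst, of "top_of_set {0..1::real}" Z "top_of_set K"]
      by (simp add: o_def)
    have t: "continuous_map ?Q euclideanreal fst"
      using continuous_map_fst continuous_map_into_fulltopology by blast
    have w: "continuous_map ?Q euclidean (\<lambda>u. snd (snd u))"
      using continuous_map_compose[OF continuous_map_snd continuous_map_snd, of "top_of_set {0..1::real}" Z "top_of_set K"]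
        continuous_map_into_fulltopology by (fastforce simp: o_def)
    have "continuous_map ?Q euclidean (\<lambda>u. complex_of_real (1 - fst u) ^ 1 * a + complex_of_real (fst u) ^ 1 * snd (snd u))"
      using t w by (intro continuous_map_add continuous_map_complex_mult continuous_map_complex_of_real_pow
          continuous_map_diff) auto
    then show "continuous_map ?Q (top_of_set K)
        (\<lambda>u. complex_of_real (1 - fst u) * a + complex_of_real (fst u) * snd (snd u))"
      using convexD_alt[OF K a]
      by (auto simp: continuous_map_in_subtopology scaleR_conv_of_real)
  qed
  have "homotopic_with (\<lambda>_. True) ?P ?P (?g \<circ> ?f) id"
    unfolding homotopic_with_def by (rule exI[of _ ?h]) (use h in simp)
  moreover have "homotopic_with (\<lambda>_. True) Z Z (?f \<circ> ?g) id"
    by (simp add: o_def id_def)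
  ultimately have "Z homotopy_equivalent_space ?P"
    using f g unfolding homotopy_equivalent_space_def by blast
  then show ?thesis using fin by (rule finite_homology_homotopy_equivalent)
qed

text \<open>The punctured plane is the union of four open half planes. Their intersections are convex, so
  the products of \<open>Z\<close> with convex open sets avoiding the origin form a family to which the criterion
  for unions applies.\<close>

lemma finite_homology_prod_punctured_plane:
  assumes fin: "finite_homology Z {}"
  shows "finite_homology (prod_topology Z (top_of_set (- {0 :: complex}))) {}"
proof -
  let ?P = "prod_topology Z (top_of_set (- {0 :: complex}))"
  define \<K> where "\<K> = {topspace Z \<times> K | K :: complex set. convex K \<and> open K \<and> 0 \<notin> K}"
  have mem: "topspace Z \<times> K \<in> \<K>" if "convex K" "open K" "0 \<notin> K" for K
    using that by (auto simp: \<K>_def)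
  define H where "H = {{z. Re z > 0}, {z. Re z < 0}, {z. Im z > 0}, {z. Im z < 0}}"
  have "finite_homology (subtopology ?P (\<Union>((\<times>) (topspace Z) ` H))) {}"
  proof (rule finite_homology_Union)
    fix U assume "U \<in> \<K>"
    then obtain K where K: "U = topspace Z \<times> K" "convex K" "open K" "0 \<notin> K" by (auto simp: \<K>_def)
    then have "openin (top_of_set (- {0})) K" by (intro open_subset) auto
    then show "openin ?P U" by (simp add: K openin_prod_Times_iff)
    have "- {0} \<inter> K = K" using K by auto
    then have "subtopology ?P U = prod_topology Z (top_of_set K)"
      by (simp add: K subtopology_Times subtopology_subtopology)
    then show "finite_homology (subtopology ?P U) {}"
      using finite_homology_prod_convex[OF K(2) fin] by simp
  next
    fix U V assume "U \<in> \<K>" "V \<in> \<K>"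
    then obtain K L where "U = topspace Z \<times> K" "convex K" "open K" "0 \<notin> K"
      "V = topspace Z \<times> L" "convex L" "open L" "0 \<notin> L" by (auto simp: \<K>_def)
    moreover from this have "U \<inter> V = topspace Z \<times> (K \<inter> L)" by auto
    ultimately show "U \<inter> V \<in> \<K>" using mem[of "K \<inter> L"] by (simp add: convex_Int open_Int)
  next
    show "finite ((\<times>) (topspace Z) ` H)" by (simp add: H_def)
    show "(\<times>) (topspace Z) ` H \<subseteq> \<K>"
      unfolding H_def
      by (auto intro!: mem simp: convex_halfspace_Re_gt convex_halfspace_Re_lt convex_halfspace_Im_gt
          convex_halfspace_Im_lt open_halfspace_Re_gt open_halfspace_Re_lt open_halfspace_Im_gt
          open_halfspace_Im_lt)
  qed
  moreover have "\<Union>((\<times>) (topspace Z) ` H) = topspace ?P"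
  proof -
    have "z \<in> \<Union>H \<longleftrightarrow> z \<noteq> 0" for z
      unfolding H_def by (auto simp: complex_eq_iff)
    then show ?thesis by auto
  qed
  ultimately have "finite_homology (subtopology ?P (topspace ?P)) {}" by (simp only:)
  then show ?thesis by (simp only: subtopology_topspace)
qed

text \<open>For the dual semigroup of a cone this is the affine toric variety of the cone, and for a subgroup
  \<open>L\<close> of the lattice it is the torus \<open>Hom(L, \<complex>\<^sup>*)\<close>. Both kinds of \<open>S\<close> are needed, since an affine
  toric variety retracts to a torus.\<close>

definition character_space :: "(real ^ 'n) set \<Rightarrow> 'n character topology" where
  "character_space S =
     subtopology (product_topology (\<lambda>_. euclidean) S)
       {\<gamma>. \<gamma> 0 = 1 \<and> (\<forall>m\<in>S. \<forall>m'\<in>S. \<gamma> (m + m') = \<gamma> m * \<gamma> m')}"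

lemma affine_toric_variety_eq: "affine_toric_variety \<sigma> = character_space (dual_semigroup \<sigma>)"
  by (simp add: affine_toric_variety_def character_space_def)

lemma in_character_space:
  "\<gamma> \<in> topspace (character_space S) \<longleftrightarrow>
     \<gamma> \<in> extensional S \<and> \<gamma> 0 = 1 \<and> (\<forall>m\<in>S. \<forall>m'\<in>S. \<gamma> (m + m') = \<gamma> m * \<gamma> m')"
  by (auto simp: character_space_def PiE_def)

lemma continuous_map_into_character_space:
  "continuous_map Z (character_space S) f \<longleftrightarrow>
     (\<forall>z\<in>topspace Z. f z \<in> topspace (character_space S)) \<and>
     (\<forall>m\<in>S. continuous_map Z euclidean (\<lambda>z. f z m))"
  unfolding in_character_space unfolding character_space_def
  by (simp add: continuous_map_in_subtopology continuous_map_componentwise Pi_iff image_subset_iff) blast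

lemma continuous_map_eval:
  assumes "m \<in> S" shows "continuous_map (character_space S) euclidean (\<lambda>\<gamma>. \<gamma> m)"
  using continuous_map_into_character_space[of "character_space S" S id] assms by auto

lemma restrict_in_character_space:
  assumes "\<gamma> \<in> topspace (character_space S)" "T \<subseteq> S" "0 \<in> T" "\<And>m m'. m \<in> T \<Longrightarrow> m' \<in> T \<Longrightarrow> m + m' \<in> T"
  shows "restrict \<gamma> T \<in> topspace (character_space T)"
  using assms by (simp add: in_character_space subset_iff)

lemma continuous_map_restrict_character:
  assumes "T \<subseteq> S" "0 \<in> T" "\<And>m m'. m \<in> T \<Longrightarrow> m' \<in> T \<Longrightarrow> m + m' \<in> T"
  shows "continuous_map (character_space S) (character_space T) (\<lambda>\<gamma>. restrict \<gamma> T)"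
  using assms restrict_in_character_space[OF _ assms] continuous_map_eval[of _ S]
  by (auto simp: continuous_map_into_character_space)

definition integral_lattice :: "(real ^ 'n) set \<Rightarrow> bool" where
  "integral_lattice L \<longleftrightarrow> L \<subseteq> integral_points \<and> 0 \<in> L \<and> (\<forall>x\<in>L. \<forall>y\<in>L. x - y \<in> L)"

lemma integral_latticeD:
  assumes "integral_lattice L"
  shows "0 \<in> L" "x \<in> L \<Longrightarrow> y \<in> L \<Longrightarrow> x - y \<in> L" "x \<in> L \<Longrightarrow> y \<in> L \<Longrightarrow> x + y \<in> L" "x \<in> L \<Longrightarrow> - x \<in> L"
    "x \<in> L \<Longrightarrow> of_int k *\<^sub>R x \<in> L"
proof -
  show 0: "0 \<in> L" and diff: "x \<in> L \<Longrightarrow> y \<in> L \<Longrightarrow> x - y \<in> L" for x y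
    using assms by (auto simp: integral_lattice_def)
  show neg: "x \<in> L \<Longrightarrow> - x \<in> L" for x using diff[OF 0] by fastforce
  show add: "x \<in> L \<Longrightarrow> y \<in> L \<Longrightarrow> x + y \<in> L" for x y using diff[OF _ neg] by fastforce
  show "of_int k *\<^sub>R x \<in> L" if "x \<in> L"
  proof (induction k rule: int_induct[where k = 0])
    case (step1 i)
    then show ?case using add[OF _ that] by (auto simp: scaleR_left_distrib)
  next
    case (step2 i)
    then show ?case using diff[OF _ that] by (auto simp: scaleR_left_diff_distrib)
  qed (simp add: 0)
qed

lemma character_nonzero:
  assumes "\<gamma> \<in> topspace (character_space S)" "m \<in> S" "- m \<in> S"
  shows "\<gamma> m \<noteq> 0"
proof -
  have "\<gamma> m * \<gamma> (- m) = \<gamma> (m + - m)" using assms unfolding in_character_space by metis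
  then show ?thesis using assms by (auto simp: in_character_space)
qed

lemma character_powi:
  assumes \<gamma>: "\<gamma> \<in> topspace (character_space L)" and L: "integral_lattice L" and g: "g \<in> L"
  shows "\<gamma> (of_int k *\<^sub>R g) = \<gamma> g powi k"
proof -
  note * = integral_latticeD[OF L]
  have mult: "\<gamma> (a + b) = \<gamma> a * \<gamma> b" if "a \<in> L" "b \<in> L" for a b
    using \<gamma> that by (simp add: in_character_space)
  have nz: "\<gamma> g \<noteq> 0" using character_nonzero[OF \<gamma> g] * g by blast
  show ?thesis
  proof (induction k rule: int_induct[where k = 0])
    case base
    then show ?case using \<gamma> by (simp add: in_character_space)
  next
    case (step1 i)
    have "\<gamma> (of_int (i + 1) *\<^sub>R g) = \<gamma> (of_int i *\<^sub>R g) * \<gamma> g"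
      using mult[OF *(5)[OF g] g] by (simp add: scaleR_left_distrib)
    then show ?case using step1 nz by (simp add: power_int_add)
  next
    case (step2 i)
    have "\<gamma> (of_int (i - 1) *\<^sub>R g) * \<gamma> g = \<gamma> (of_int i *\<^sub>R g)"
      using mult[OF *(5)[OF g, of "i - 1"] g] by (simp add: scaleR_left_diff_distrib)
    then show ?case using step2 nz by (simp add: power_int_diff field_simps)
  qed
qed

text \<open>An element whose \<open>j\<close>-th coordinate is positive and as small as possible divides the \<open>j\<close>-th
  coordinates of all other elements.\<close>

lemma integral_lattice_split:
  fixes L :: "(real ^ 'n) set" and x :: "real ^ 'n"
  assumes L: "integral_lattice L" and ne: "x \<in> L" "x $ j \<noteq> 0"
  obtains g :: "real ^ 'n" where "g \<in> L" "g $ j \<noteq> 0" "\<And>y. y \<in> L \<Longrightarrow> y $ j = of_int \<lfloor>y $ j / g $ j\<rfloor> * g $ j"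
proof -
  note * = integral_latticeD[OF L]
  have int: "y $ j \<in> \<int>" if "y \<in> L" for y
    using L that by (auto simp: integral_lattice_def integral_points_def)
  define Q where "Q n \<longleftrightarrow> n > 0 \<and> (\<exists>y\<in>L. y $ j = real n)" for n :: nat
  have "\<exists>n. Q n"
  proof -
    obtain i where i: "x $ j = of_int i" using int[OF ne(1)] by (auto elim: Ints_cases)
    show ?thesis
    proof (cases "i > 0")
      case True
      then show ?thesis using ne i by (intro exI[of _ "nat i"]) (auto simp: Q_def)
    next
      case False
      then show ?thesis using ne i *(4)[OF ne(1)]
        by (intro exI[of _ "nat (- i)"]) (auto simp: Q_def intro!: bexI[of _ "- x"])
    qed
  qed
  then have Q: "Q (LEAST n. Q n)" and least: "\<And>n. Q n \<Longrightarrow> (LEAST n. Q n) \<le> n"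
    by (auto intro: LeastI_ex Least_le)
  define n where "n = (LEAST n. Q n)"
  obtain g where g: "g \<in> L" "g $ j = real n" "n > 0" using Q by (auto simp: Q_def n_def)
  have "y $ j = of_int \<lfloor>y $ j / g $ j\<rfloor> * g $ j" if y: "y \<in> L" for y
  proof (rule ccontr)
    assume neq: "y $ j \<noteq> of_int \<lfloor>y $ j / g $ j\<rfloor> * g $ j"
    obtain i where i: "y $ j = of_int i" using int[OF y] by (auto elim: Ints_cases)
    have fl: "\<lfloor>y $ j / g $ j\<rfloor> = i div int n"
      unfolding i g by (metis floor_divide_of_int_eq of_int_of_nat_eq)
    define r where "r = y - of_int (i div int n) *\<^sub>R g"
    have "r \<in> L" using y *(2,5) g by (simp add: r_def)
    have rj: "r $ j = of_int (i mod int n)"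
      by (simp add: r_def i g minus_div_mult_eq_mod[symmetric])
    have "i mod int n \<noteq> 0"
    proof
      assume "i mod int n = 0"
      then have "i = (i div int n) * int n" by (metis add.right_neutral div_mult_mod_eq)
      then have "of_int i = of_int (i div int n) * real n" by (metis of_int_mult of_int_of_nat_eq)
      then show False using neq by (simp add: fl i g)
    qed
    then have pos: "i mod int n > 0" using g(3) by (simp add: order_le_neq_trans)
    have "Q (nat (i mod int n))" unfolding Q_def using pos \<open>r \<in> L\<close> rj by (auto intro!: bexI[of _ r])
    then have "n \<le> nat (i mod int n)" using least by (simp add: n_def)
    moreover have "i mod int n < int n" using g(3) by simp
    ultimately show False using pos by linarith
  qed
  then show ?thesis using g that[of g] by simp
qed

text \<open>Under the hypothesis on \<open>g\<close>, the lattice is the direct sum of its elements with vanishing \<open>j\<close>-th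
  coordinate and the multiples of \<open>g\<close>. A character is thus determined by its restriction to the
  first summand and by its value at \<open>g\<close>, which may be any nonzero number.\<close>

lemma homeomorphic_space_split_lattice:
  fixes L :: "(real ^ 'n) set" and g :: "real ^ 'n"
  assumes L: "integral_lattice L" and g: "g \<in> L" "g $ j \<noteq> 0"
    and \<kappa>: "\<And>y. y \<in> L \<Longrightarrow> y $ j = of_int \<lfloor>y $ j / g $ j\<rfloor> * g $ j"
  shows "character_space L homeomorphic_space
    prod_topology (character_space {y \<in> L. y $ j = 0}) (top_of_set (- {0 :: complex}))"
proof -
  note * = integral_latticeD[OF L]
  let ?L = "{y \<in> L. y $ j = 0}"
  define \<kappa> where "\<kappa> y = \<lfloor>y $ j / g $ j\<rfloor>" for y :: "real ^ 'n"
  define \<rho> where "\<rho> y = y - of_int (\<kappa> y) *\<^sub>R g" for y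
  have \<rho>: "\<rho> y \<in> ?L" if "y \<in> L" for y
    using \<kappa>[OF that] *(2,5) g that by (simp add: \<rho>_def \<kappa>_def)
  have \<kappa>_add: "\<kappa> (y + z) = \<kappa> y + \<kappa> z" if "y \<in> L" "z \<in> L" for y z
  proof -
    have "of_int (\<kappa> (y + z)) * g $ j = (of_int (\<kappa> y) + of_int (\<kappa> z)) * g $ j"
      using \<kappa>[OF that(1)] \<kappa>[OF that(2)] \<kappa>[OF *(3)[OF that]]
      by (simp add: \<kappa>_def distrib_right del: of_int_mult)
    then have "(of_int (\<kappa> (y + z)) :: real) = of_int (\<kappa> y + \<kappa> z)" using g by simp
    then show ?thesis by linarith
  qed
  have \<rho>_add: "\<rho> (y + z) = \<rho> y + \<rho> z" if "y \<in> L" "z \<in> L" for y z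
    by (simp add: \<rho>_def \<kappa>_add[OF that] algebra_simps)
  have \<kappa>0: "\<kappa> y = 0" "\<rho> y = y" if "y \<in> ?L" for y using that by (auto simp: \<kappa>_def \<rho>_def)
  have \<kappa>g: "\<kappa> g = 1" "\<rho> g = 0" using g by (auto simp: \<kappa>_def \<rho>_def)
  let ?f = "\<lambda>\<gamma>. (restrict \<gamma> ?L, \<gamma> g)" and ?h = "\<lambda>(\<delta>, z). \<lambda>m\<in>L. \<delta> (\<rho> m) * z powi \<kappa> m"
  have sub: "?L \<subseteq> L" "0 \<in> ?L" "\<And>m m'. m \<in> ?L \<Longrightarrow> m' \<in> ?L \<Longrightarrow> m + m' \<in> ?L" using * by auto
  have "homeomorphic_maps (character_space L)
      (prod_topology (character_space ?L) (top_of_set (- {0 :: complex}))) ?f ?h"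
    unfolding homeomorphic_maps_def
  proof (intro conjI ballI)
    show "continuous_map (character_space L)
        (prod_topology (character_space ?L) (top_of_set (- {0}))) ?f"
      using continuous_map_restrict_character[OF sub] continuous_map_eval[OF g(1)]
        character_nonzero[OF _ g(1) *(4)[OF g(1)]]
      by (intro continuous_map_pairedI) (auto simp: continuous_map_in_subtopology)
  next
    let ?P = "prod_topology (character_space ?L) (top_of_set (- {0 :: complex}))"
    have "?h u \<in> topspace (character_space L)" if "u \<in> topspace ?P" for u
    proof -
      have "u = (fst u, snd u)" "fst u \<in> topspace (character_space ?L)" "snd u \<noteq> 0"
        using that by auto
      then obtain \<delta> z where u: "u = (\<delta>, z)" "\<delta> \<in> topspace (character_space ?L)" "z \<noteq> 0" by blast
      have "\<delta> (\<rho> m + \<rho> m') = \<delta> (\<rho> m) * \<delta> (\<rho> m')" if "m \<in> L" "m' \<in> L" for m m'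
        using u(2) \<rho> that by (simp add: in_character_space)
      then show ?thesis
        using u * \<kappa>0[of 0] \<rho>_add \<kappa>_add by (simp add: in_character_space power_int_add)
    qed
    moreover have "continuous_map ?P euclidean (\<lambda>u. ?h u m)" if m: "m \<in> L" for m
    proof -
      have 1: "continuous_map ?P euclidean (\<lambda>u. fst u (\<rho> m))"
        using continuous_map_compose[OF continuous_map_fst continuous_map_eval[OF \<rho>[OF m]]]
        by (simp add: o_def)
      have 2: "continuous_map ?P euclidean snd"
        using continuous_map_snd continuous_map_into_fulltopology by blast
      have "continuous_map ?P euclidean (\<lambda>u. fst u (\<rho> m) * snd u powi \<kappa> m)"
        by (intro continuous_map_complex_mult continuous_map_complex_powi 1 2) auto
      then show ?thesis using m by (simp add: case_prod_unfold)
    qed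
    ultimately show "continuous_map ?P (character_space L) ?h"
      by (simp only: continuous_map_into_character_space) blast
  next
    fix \<gamma> assume \<gamma>: "\<gamma> \<in> topspace (character_space L)"
    have "\<gamma> m = \<gamma> (\<rho> m) * \<gamma> g powi \<kappa> m" if "m \<in> L" for m
    proof -
      have "\<gamma> m = \<gamma> (\<rho> m + of_int (\<kappa> m) *\<^sub>R g)" by (simp add: \<rho>_def)
      also have "\<dots> = \<gamma> (\<rho> m) * \<gamma> (of_int (\<kappa> m) *\<^sub>R g)"
        using \<gamma> \<rho>[OF that] *(5)[OF g(1)] by (simp add: in_character_space)
      finally show ?thesis by (simp add: character_powi[OF \<gamma> L g(1)])
    qed
    then show "?h (?f \<gamma>) = \<gamma>"
      using \<gamma> \<rho> by (auto simp: fun_eq_iff in_character_space extensional_def)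
  next
    fix u assume "u \<in> topspace (prod_topology (character_space ?L) (top_of_set (- {0 :: complex})))"
    then have "u = (fst u, snd u)" "fst u \<in> topspace (character_space ?L)" "snd u \<noteq> 0" by auto
    then obtain \<delta> z where u: "u = (\<delta>, z)" "\<delta> \<in> topspace (character_space ?L)" "z \<noteq> 0" by blast
    then show "?f (?h u) = u"
      using \<kappa>0 \<kappa>g g by (auto simp: in_character_space extensional_def fun_eq_iff)
  qed
  then show ?thesis unfolding homeomorphic_space_def by blast
qed

text \<open>Splitting off one coordinate at a time exhibits the torus as an iterated product with the
  punctured plane.\<close>

lemma finite_homology_character_lattice:
  fixes L :: "(real ^ 'n) set"
  assumes "integral_lattice L"
  shows "finite_homology (character_space L) {}"
proof -
  have "finite_homology (character_space L) {}"
    if "finite J" "integral_lattice L" "\<And>y j. y \<in> L \<Longrightarrow> j \<notin> J \<Longrightarrow> y $ j = 0"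
    for J and L :: "(real ^ 'n) set"
    using that
  proof (induction J arbitrary: L)
    case empty
    then have "L = {0}" using integral_latticeD(1)[OF empty(1)] by (auto simp: vec_eq_iff)
    then have "topspace (character_space L) = {\<lambda>m\<in>{0}. 1}"
      by (auto simp: in_character_space extensional_def fun_eq_iff)
    then show ?case by (rule finite_homology_singleton)
  next
    case (insert j J)
    let ?L = "{y \<in> L. y $ j = 0}"
    have "integral_lattice ?L"
      using insert.prems(1) by (auto simp: integral_lattice_def)
    then have fin: "finite_homology (character_space ?L) {}"
    proof (rule insert.IH)
      show "y $ i = 0" if "y \<in> ?L" "i \<notin> J" for y :: "real ^ 'n" and i
        using insert.prems(2)[of y i] that by (cases "i = j") auto
    qed
    show ?case
    proof (cases "?L = L")
      case False
      then obtain x where "x \<in> L" "x $ j \<noteq> 0" by auto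
      then obtain g where "g \<in> L" "g $ j \<noteq> 0"
        "\<And>y. y \<in> L \<Longrightarrow> y $ j = of_int \<lfloor>y $ j / g $ j\<rfloor> * g $ j"
        using integral_lattice_split[OF insert.prems(1)] by metis
      then have "character_space L homeomorphic_space
          prod_topology (character_space ?L) (top_of_set (- {0 :: complex}))"
        by (rule homeomorphic_space_split_lattice[OF insert.prems(1)])
      then have "prod_topology (character_space ?L) (top_of_set (- {0 :: complex}))
          homotopy_equivalent_space character_space L"
        by (rule homeomorphic_imp_homotopy_equivalent_space[OF homeomorphic_space_sym[THEN iffD1]])
      then show ?thesis
        using finite_homology_prod_punctured_plane[OF fin]
        by (rule finite_homology_homotopy_equivalent)
    qed (use fin in simp)
  qed
  from this[of UNIV L] assms show ?thesis by simp
qed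

text \<open>The one-parameter subgroup of \<open>v\<close> acts on a character by \<open>\<gamma> m \<mapsto> t ^ (m \<bullet> v) * \<gamma> m\<close>. The exponents
  are natural numbers, so that the action extends to \<open>t = 0\<close>, where it sets \<open>\<gamma> m\<close> to \<open>0\<close> unless
  \<open>m \<bullet> v = 0\<close>. This deforms the variety into the torus of the group \<open>L\<close> of units of the dual
  semigroup: by hypothesis, the \<open>m\<close> with \<open>m \<bullet> v = 0\<close> are exactly the units.\<close>

lemma finite_homology_affine_toric_variety:
  fixes v :: "real ^ 'n"
  assumes v: "v \<in> \<sigma>" "v \<in> integral_points"
    and units: "\<And>m. m \<in> dual_semigroup \<sigma> \<Longrightarrow> m \<bullet> v = 0 \<Longrightarrow> - m \<in> dual_semigroup \<sigma>"
  shows "finite_homology (affine_toric_variety \<sigma>) {}"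
proof -
  let ?S = "dual_semigroup \<sigma>"
  define L where "L = {m \<in> ?S. - m \<in> ?S}"
  have int: "m \<bullet> v \<in> \<int>" if "m \<in> ?S" for m
    using that v by (auto simp: inner_vec_def dual_semigroup_def integral_points_def intro!: Ints_sum Ints_mult)
  have nonneg: "m \<bullet> v \<ge> 0" if "m \<in> ?S" for m
    using that v by (simp add: dual_semigroup_def)
  have S: "0 \<in> ?S" "\<And>m m'. m \<in> ?S \<Longrightarrow> m' \<in> ?S \<Longrightarrow> m + m' \<in> ?S"
    by (auto simp: dual_semigroup_def integral_points_def inner_add_left)
  have lattice: "integral_lattice L"
    unfolding integral_lattice_def
  proof (intro conjI ballI)
    show "L \<subseteq> integral_points" by (auto simp: L_def dual_semigroup_def)
    show "0 \<in> L" using S by (simp add: L_def)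
    show "x - y \<in> L" if "x \<in> L" "y \<in> L" for x y
      using that S(2)[of x "- y"] S(2)[of y "- x"] by (simp add: L_def)
  qed
  have L: "L \<subseteq> ?S" "0 \<in> L" "\<And>m m'. m \<in> L \<Longrightarrow> m' \<in> L \<Longrightarrow> m + m' \<in> L"
    using integral_latticeD[OF lattice] by (auto simp: L_def)
  have L_iff: "m \<in> L \<longleftrightarrow> m \<bullet> v = 0" if "m \<in> ?S" for m
    using nonneg[of m] nonneg[of "- m"] units that by (auto simp: L_def)
  define k where "k m = nat \<lfloor>m \<bullet> v\<rfloor>" for m
  have k: "real (k m) = m \<bullet> v" if "m \<in> ?S" for m
    using int[OF that] nonneg[OF that] by (auto simp: k_def elim!: Ints_cases)
  have k_add: "k (m + m') = k m + k m'" if "m \<in> ?S" "m' \<in> ?S" for m m'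
    using k[OF that(1)] k[OF that(2)] k[OF S(2)[OF that]] by (simp add: inner_add_left flip: of_nat_add)
  have k0: "k m = 0 \<longleftrightarrow> m \<in> L" if "m \<in> ?S" for m
    using k[OF that] L_iff[OF that] by auto
  let ?X = "character_space ?S" and ?Y = "character_space L"
  let ?h = "\<lambda>u. \<lambda>m\<in>?S. complex_of_real (fst u) ^ k m * snd u m"
  \<comment> \<open>Extension by zero is multiplicative because the nonunits form an ideal.\<close>
  let ?g = "\<lambda>\<delta>. \<lambda>m\<in>?S. if m \<in> L then \<delta> m else 0"
  have f: "continuous_map ?X ?Y (\<lambda>\<gamma>. restrict \<gamma> L)"
    by (rule continuous_map_restrict_character[OF L])
  have g: "continuous_map ?Y ?X ?g"
    unfolding continuous_map_into_character_space
  proof (intro conjI ballI)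
    fix \<delta> assume \<delta>: "\<delta> \<in> topspace ?Y"
    have "m + m' \<in> L \<longleftrightarrow> m \<in> L \<and> m' \<in> L" if "m \<in> ?S" "m' \<in> ?S" for m m'
      using k0[OF S(2)[OF that]] k_add[OF that] k0[OF that(1)] k0[OF that(2)] by simp
    then show "?g \<delta> \<in> topspace ?X"
      using \<delta> S L(2) by (simp add: in_character_space)
  next
    fix m assume m: "m \<in> ?S"
    show "continuous_map ?Y euclidean (\<lambda>\<delta>. ?g \<delta> m)"
      using m continuous_map_eval[of m L] by (cases "m \<in> L") auto
  qed
  have h: "continuous_map (prod_topology (top_of_set {0..1}) ?X) ?X ?h"
    unfolding continuous_map_into_character_space
  proof (intro conjI ballI)
    fix u assume "u \<in> topspace (prod_topology (top_of_set {0..1::real}) ?X)"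
    then have "snd u \<in> topspace ?X" by auto
    then show "?h u \<in> topspace ?X"
      using S k_add k0[of 0] L by (auto simp: in_character_space power_add)
  next
    fix m assume m: "m \<in> ?S"
    let ?Q = "prod_topology (top_of_set {0..1::real}) ?X"
    have t: "continuous_map ?Q euclideanreal fst"
      using continuous_map_fst continuous_map_into_fulltopology by blast
    have w: "continuous_map ?Q euclidean (\<lambda>u. snd u m)"
      using continuous_map_compose[OF continuous_map_snd continuous_map_eval[OF m]] by (simp add: o_def)
    show "continuous_map ?Q euclidean (\<lambda>u. ?h u m)"
      using m continuous_map_complex_mult[OF continuous_map_complex_of_real_pow[OF t] w] by simp
  qed
  have h0: "?h (0, \<gamma>) = ?g (restrict \<gamma> L)" for \<gamma>
    using k0 by (auto simp: fun_eq_iff power_0_left)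
  have h1: "?h (1, \<gamma>) = \<gamma>" if "\<gamma> \<in> topspace ?X" for \<gamma>
    using that by (auto simp: fun_eq_iff in_character_space extensional_def)
  have "homotopic_with (\<lambda>_. True) ?X ?X (\<lambda>\<gamma>. ?h (0, \<gamma>)) (\<lambda>\<gamma>. ?h (1, \<gamma>))"
    unfolding homotopic_with_def using h by (intro exI[of _ ?h]) auto
  then have "homotopic_with (\<lambda>_. True) ?X ?X (?g \<circ> (\<lambda>\<gamma>. restrict \<gamma> L)) id"
    by (rule homotopic_with_eq) (use h0 h1 in \<open>simp_all add: fun_eq_iff\<close>)
  moreover have "homotopic_with (\<lambda>_. True) ?Y ?Y ((\<lambda>\<gamma>. restrict \<gamma> L) \<circ> ?g) id"
    by (rule homotopic_with_equal)
      (use continuous_map_compose[OF g f] L in \<open>auto simp: fun_eq_iff in_character_space extensional_def\<close>)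
  ultimately have "?Y homotopy_equivalent_space ?X"
    using f g unfolding homotopy_equivalent_space_def by blast
  then show ?thesis
    unfolding affine_toric_variety_eq
    using finite_homology_character_lattice[OF lattice] by (rule finite_homology_homotopy_equivalent)
qed

section \<open>Toric varieties glued from charts\<close>

definition additive_submonoid :: "(real ^ 'n) set \<Rightarrow> bool" where
  "additive_submonoid S \<longleftrightarrow> 0 \<in> S \<and> (\<forall>m\<in>S. \<forall>m'\<in>S. m + m' \<in> S)"

lemma additive_submonoid_multiple:
  assumes "additive_submonoid S" "m \<in> S"
  shows "real k *\<^sub>R m \<in> S"
  using assms by (induction k) (auto simp: additive_submonoid_def scaleR_left_distrib)

lemma character_multiple:
  assumes S: "additive_submonoid S" and m: "m \<in> S" and \<gamma>: "\<gamma> \<in> topspace (character_space S)"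
  shows "\<gamma> (real k *\<^sub>R m) = \<gamma> m ^ k"
proof (induction k)
  case 0
  then show ?case using \<gamma> by (simp add: in_character_space)
next
  case (Suc k)
  have "\<gamma> (real (Suc k) *\<^sub>R m) = \<gamma> (m + real k *\<^sub>R m)"
    by (simp add: scaleR_left_distrib)
  also have "\<dots> = \<gamma> m * \<gamma> (real k *\<^sub>R m)"
    using \<gamma> m additive_submonoid_multiple[OF S m] by (simp add: in_character_space)
  finally show ?case using Suc by simp
qed

text \<open>\<open>T\<close> arises from \<open>S\<close> by inverting \<open>m\<close>.\<close>

definition is_localization :: "(real ^ 'n) set \<Rightarrow> (real ^ 'n) set \<Rightarrow> real ^ 'n \<Rightarrow> bool" where
  "is_localization S T m \<longleftrightarrow> additive_submonoid S \<and> additive_submonoid T \<and> S \<subseteq> T \<and> m \<in> S \<and> - m \<in> T \<and>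
     (\<forall>s\<in>T. \<exists>k. s + real k *\<^sub>R m \<in> S)"

lemma localized_character_eq:
  assumes loc: "is_localization S T m" and \<delta>: "\<delta> \<in> topspace (character_space T)"
    and s: "s \<in> T" "s + real k *\<^sub>R m \<in> S"
  shows "\<delta> s = restrict \<delta> S (s + real k *\<^sub>R m) * inverse (restrict \<delta> S m) ^ k" and "\<delta> m \<noteq> 0"
proof -
  have T: "additive_submonoid T" "m \<in> T" "- m \<in> T" "m \<in> S"
    using loc by (auto simp: is_localization_def)
  show nz: "\<delta> m \<noteq> 0" using character_nonzero[OF \<delta>] T by blast
  have "\<delta> (s + real k *\<^sub>R m) = \<delta> s * \<delta> (real k *\<^sub>R m)"
    using \<delta> s(1) additive_submonoid_multiple[OF T(1,2)] by (simp add: in_character_space)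
  then show "\<delta> s = restrict \<delta> S (s + real k *\<^sub>R m) * inverse (restrict \<delta> S m) ^ k"
    using s T nz by (simp add: character_multiple[OF T(1,2) \<delta>] field_simps)
qed

text \<open>The characters of the localization are the characters of \<open>S\<close> that do not vanish at \<open>m\<close>: the
  inverse of restriction sends \<open>\<gamma>\<close> to \<open>s \<mapsto> \<gamma> (s + k m) / \<gamma> m ^ k\<close> for any \<open>k\<close> with \<open>s + k m \<in> S\<close>.\<close>

lemma homeomorphic_map_localization:
  assumes loc: "is_localization S T m"
  shows "homeomorphic_map (character_space T)
    (subtopology (character_space S) {\<gamma> \<in> topspace (character_space S). \<gamma> m \<noteq> 0}) (\<lambda>\<delta>. restrict \<delta> S)"
proof -
  have S: "additive_submonoid S" and T: "additive_submonoid T" and ST: "S \<subseteq> T" and m: "m \<in> S" "- m \<in> T"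
    and ex: "\<forall>s\<in>T. \<exists>k. s + real k *\<^sub>R m \<in> S"
    using loc by (auto simp: is_localization_def)
  obtain \<kappa> where \<kappa>: "s + real (\<kappa> s) *\<^sub>R m \<in> S" if "s \<in> T" for s
    using bchoice[OF ex] by blast
  let ?Y = "subtopology (character_space S) {\<gamma> \<in> topspace (character_space S). \<gamma> m \<noteq> 0}"
  let ?ext = "\<lambda>\<gamma>. \<lambda>s\<in>T. \<gamma> (s + real (\<kappa> s) *\<^sub>R m) * inverse (\<gamma> m) ^ \<kappa> s"
  have indep: "\<gamma> (s + real k *\<^sub>R m) * inverse (\<gamma> m) ^ k = \<gamma> (s + real l *\<^sub>R m) * inverse (\<gamma> m) ^ l"
    if \<gamma>: "\<gamma> \<in> topspace (character_space S)" "\<gamma> m \<noteq> 0" and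
      s: "s + real k *\<^sub>R m \<in> S" "s + real l *\<^sub>R m \<in> S" for \<gamma> s k l
  proof -
    have shift: "\<gamma> (s + real (a + b) *\<^sub>R m) = \<gamma> (s + real a *\<^sub>R m) * \<gamma> m ^ b"
      if "s + real a *\<^sub>R m \<in> S" for a b
    proof -
      have "\<gamma> (s + real (a + b) *\<^sub>R m) = \<gamma> ((s + real a *\<^sub>R m) + real b *\<^sub>R m)"
        by (simp add: scaleR_left_distrib add.assoc)
      also have "\<dots> = \<gamma> (s + real a *\<^sub>R m) * \<gamma> (real b *\<^sub>R m)"
        using \<gamma>(1) that additive_submonoid_multiple[OF S m(1)] by (simp add: in_character_space)
      finally show ?thesis by (simp add: character_multiple[OF S m(1) \<gamma>(1)])
    qed
    have "\<gamma> (s + real k *\<^sub>R m) * \<gamma> m ^ l = \<gamma> (s + real l *\<^sub>R m) * \<gamma> m ^ k"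
      using shift[OF s(1), of l] shift[OF s(2), of k] by (simp add: add.commute)
    then show ?thesis using \<gamma>(2) by (simp add: field_simps)
  qed
  have sub: "0 \<in> S" "\<And>m m'. m \<in> S \<Longrightarrow> m' \<in> S \<Longrightarrow> m + m' \<in> S"
    using S by (auto simp: additive_submonoid_def)
  have "homeomorphic_maps (character_space T) ?Y (\<lambda>\<delta>. restrict \<delta> S) ?ext"
    unfolding homeomorphic_maps_def
  proof (intro conjI ballI)
    show "continuous_map (character_space T) ?Y (\<lambda>\<delta>. restrict \<delta> S)"
      using continuous_map_restrict_character[OF ST sub] restrict_in_character_space[OF _ ST sub]
        character_nonzero[of _ T m] m ST
      by (auto simp: continuous_map_in_subtopology)
  next
    have "?ext \<gamma> \<in> topspace (character_space T)" if "\<gamma> \<in> topspace ?Y" for \<gamma>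
    proof -
      have \<gamma>: "\<gamma> \<in> topspace (character_space S)" "\<gamma> m \<noteq> 0" using that by auto
      have mult: "?ext \<gamma> (s + t) = ?ext \<gamma> s * ?ext \<gamma> t" if "s \<in> T" "t \<in> T" for s t
      proof -
        have st: "s + t \<in> T" using T that by (auto simp: additive_submonoid_def)
        have eq: "(s + t) + real (\<kappa> s + \<kappa> t) *\<^sub>R m = (s + real (\<kappa> s) *\<^sub>R m) + (t + real (\<kappa> t) *\<^sub>R m)"
          by (simp add: scaleR_left_distrib)
        have in_S: "(s + t) + real (\<kappa> s + \<kappa> t) *\<^sub>R m \<in> S"
          unfolding eq by (rule sub(2)[OF \<kappa> \<kappa>, OF that])
        have "?ext \<gamma> (s + t) = \<gamma> ((s + t) + real (\<kappa> (s + t)) *\<^sub>R m) * inverse (\<gamma> m) ^ \<kappa> (s + t)"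
          using st by simp
        also have "\<dots> = \<gamma> ((s + t) + real (\<kappa> s + \<kappa> t) *\<^sub>R m) * inverse (\<gamma> m) ^ (\<kappa> s + \<kappa> t)"
          by (rule indep[OF \<gamma> \<kappa>[OF st] in_S])
        also have "\<gamma> ((s + t) + real (\<kappa> s + \<kappa> t) *\<^sub>R m) =
            \<gamma> (s + real (\<kappa> s) *\<^sub>R m) * \<gamma> (t + real (\<kappa> t) *\<^sub>R m)"
          unfolding eq using \<gamma>(1) \<kappa>[OF that(1)] \<kappa>[OF that(2)] by (simp only: in_character_space)
        finally show ?thesis using that by (simp add: power_add)
      qed
      have "?ext \<gamma> 0 = 1"
        using indep[OF \<gamma>, of 0 "\<kappa> 0" 0] \<kappa>[of 0] sub(1) T \<gamma>(1)
        by (simp add: additive_submonoid_def in_character_space)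
      then show ?thesis using mult by (simp add: in_character_space)
    qed
    moreover have "continuous_map ?Y euclidean (\<lambda>\<gamma>. ?ext \<gamma> s)" if s: "s \<in> T" for s
    proof -
      have eval: "continuous_map ?Y euclidean (\<lambda>\<gamma>. \<gamma> t)" if "t \<in> S" for t
        by (rule continuous_map_from_subtopology[OF continuous_map_eval[OF that]])
      have inv: "continuous_map ?Y euclidean (\<lambda>\<gamma>. inverse (\<gamma> m) powi int (\<kappa> s))"
        by (intro continuous_map_complex_powi continuous_map_complex_inverse eval m) auto
      show ?thesis
        using s continuous_map_complex_mult[OF eval[OF \<kappa>[OF s]] inv] by simp
    qed
    ultimately show "continuous_map ?Y (character_space T) ?ext"
      unfolding continuous_map_into_character_space by blast
  next
    fix \<delta> assume \<delta>: "\<delta> \<in> topspace (character_space T)"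
    show "?ext (restrict \<delta> S) = \<delta>"
    proof
      fix s show "?ext (restrict \<delta> S) s = \<delta> s"
        using localized_character_eq(1)[OF loc \<delta>, of s "\<kappa> s"] \<kappa>[of s] \<delta>
        by (cases "s \<in> T") (auto simp: in_character_space extensional_def)
    qed
  next
    fix \<gamma> assume "\<gamma> \<in> topspace ?Y"
    then have \<gamma>: "\<gamma> \<in> topspace (character_space S)" "\<gamma> m \<noteq> 0" by auto
    show "restrict (?ext \<gamma>) S = \<gamma>"
    proof
      fix s show "restrict (?ext \<gamma>) S s = \<gamma> s"
      proof (cases "s \<in> S")
        case True
        then show ?thesis
          using indep[OF \<gamma>, of s "\<kappa> s" 0] \<kappa>[of s] ST by auto
      next
        case False
        then show ?thesis using \<gamma>(1) by (simp add: in_character_space extensional_def)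
      qed
    qed
  qed
  then show ?thesis by (rule homeomorphic_maps_imp_map)
qed

lemma localization_extend:
  assumes loc: "is_localization S T m" and \<gamma>: "\<gamma> \<in> topspace (character_space S)" "\<gamma> m \<noteq> 0"
  obtains \<delta> where "\<delta> \<in> topspace (character_space T)" "restrict \<delta> S = \<gamma>"
  using homeomorphic_imp_surjective_map[OF homeomorphic_map_localization[OF loc]] \<gamma>
  by (auto simp: set_eq_iff image_iff) metis

lemma localization_inj:
  assumes loc: "is_localization S T m" and "\<delta> \<in> topspace (character_space T)"
    "\<delta>' \<in> topspace (character_space T)" "restrict \<delta> S = restrict \<delta>' S"
  shows "\<delta> = \<delta>'"
  using homeomorphic_imp_injective_map[OF homeomorphic_map_localization[OF loc]] assms(2-)
  by (auto simp: inj_on_def)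

text \<open>The image of restriction is the open set where \<open>\<gamma> m \<noteq> 0\<close>. This makes the overlap of two charts open
  in each of them.\<close>

lemma open_map_localization:
  assumes loc: "is_localization S T m"
  shows "open_map (character_space T) (character_space S) (\<lambda>\<delta>. restrict \<delta> S)"
  unfolding open_map_def
proof (intro allI impI)
  fix V assume V: "openin (character_space T) V"
  let ?D = "{\<gamma> \<in> topspace (character_space S). \<gamma> m \<in> - {0}}"
  have m: "m \<in> S" using loc by (simp add: is_localization_def)
  have "openin (character_space S) ?D"
    by (rule openin_continuous_map_preimage[OF continuous_map_eval[OF m]]) auto
  moreover have "openin (subtopology (character_space S) ?D) ((\<lambda>\<delta>. restrict \<delta> S) ` V)"
    using homeomorphic_imp_open_map[OF homeomorphic_map_localization[OF loc]] V
    by (simp add: open_map_def)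
  ultimately show "openin (character_space S) ((\<lambda>\<delta>. restrict \<delta> S) ` V)"
    by (rule openin_trans_full[rotated])
qed

lemma additive_submonoid_dual: "additive_submonoid (dual_semigroup \<sigma>)"
  by (auto simp: additive_submonoid_def dual_semigroup_def integral_points_def inner_add_left)

lemma dual_semigroup_antimono: "\<sigma> \<subseteq> \<tau> \<Longrightarrow> dual_semigroup \<tau> \<subseteq> dual_semigroup \<sigma>"
  by (auto simp: dual_semigroup_def)

text \<open>What the argument needs of a fan, in terms of integral vectors. The point \<open>v\<close> of \<open>interior_point\<close>
  lies in the relative interior of \<open>\<sigma>\<close>. The vector \<open>m\<close> of \<open>separation\<close> cuts out \<open>\<tau> \<inter> \<rho>\<close> as a face of
  \<open>\<tau>\<close>. Inverting it passes from the semigroup of \<open>\<sigma> \<inter> \<tau>\<close> to that of \<open>\<sigma> \<inter> \<tau> \<inter> \<rho>\<close>; the third cone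
  \<open>\<sigma>\<close> is what transitivity of the glueing relation requires.\<close>

locale toric_fan =
  fixes \<Sigma> :: "(real ^ 'n) set set"
  assumes finite_fan: "finite \<Sigma>"
    and fan_Int: "\<sigma> \<in> \<Sigma> \<Longrightarrow> \<tau> \<in> \<Sigma> \<Longrightarrow> \<sigma> \<inter> \<tau> \<in> \<Sigma>"
    and interior_point: "\<sigma> \<in> \<Sigma> \<Longrightarrow> \<exists>v\<in>\<sigma>. v \<in> integral_points \<and>
      (\<forall>m\<in>dual_semigroup \<sigma>. m \<bullet> v = 0 \<longrightarrow> - m \<in> dual_semigroup \<sigma>)"
    and separation: "\<sigma> \<in> \<Sigma> \<Longrightarrow> \<tau> \<in> \<Sigma> \<Longrightarrow> \<rho> \<in> \<Sigma> \<Longrightarrow>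
      \<exists>m\<in>dual_semigroup \<tau>. - m \<in> dual_semigroup (\<tau> \<inter> \<rho>) \<and>
        (\<forall>s\<in>dual_semigroup (\<sigma> \<inter> \<tau> \<inter> \<rho>). \<exists>k. s + real k *\<^sub>R m \<in> dual_semigroup (\<sigma> \<inter> \<tau>))"
begin

abbreviation points :: "(real ^ 'n) set \<Rightarrow> 'n character set" where
  "points \<sigma> \<equiv> topspace (affine_toric_variety \<sigma>)"

lemma restrict_points:
  assumes "\<delta> \<in> points \<sigma>" "\<sigma> \<subseteq> \<tau>"
  shows "restrict \<delta> (dual_semigroup \<tau>) \<in> points \<tau>"
  using assms additive_submonoid_dual[of \<tau>] dual_semigroup_antimono[of \<sigma> \<tau>]
  unfolding affine_toric_variety_eq
  by (intro restrict_in_character_space[of _ "dual_semigroup \<sigma>"]) (auto simp: additive_submonoid_def)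

lemma localization_triple:
  assumes "\<sigma> \<in> \<Sigma>" "\<tau> \<in> \<Sigma>" "\<rho> \<in> \<Sigma>"
  obtains m where "m \<in> dual_semigroup \<tau>" "- m \<in> dual_semigroup (\<tau> \<inter> \<rho>)"
    "is_localization (dual_semigroup (\<sigma> \<inter> \<tau>)) (dual_semigroup (\<sigma> \<inter> \<tau> \<inter> \<rho>)) m"
proof -
  obtain m where m: "m \<in> dual_semigroup \<tau>" "- m \<in> dual_semigroup (\<tau> \<inter> \<rho>)"
    "\<forall>s\<in>dual_semigroup (\<sigma> \<inter> \<tau> \<inter> \<rho>). \<exists>k. s + real k *\<^sub>R m \<in> dual_semigroup (\<sigma> \<inter> \<tau>)"
    using separation[OF assms] by blast
  have "dual_semigroup \<tau> \<subseteq> dual_semigroup (\<sigma> \<inter> \<tau>)"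
    "dual_semigroup (\<tau> \<inter> \<rho>) \<subseteq> dual_semigroup (\<sigma> \<inter> \<tau> \<inter> \<rho>)"
    "dual_semigroup (\<sigma> \<inter> \<tau>) \<subseteq> dual_semigroup (\<sigma> \<inter> \<tau> \<inter> \<rho>)"
    by (auto intro!: dual_semigroup_antimono)
  then have "is_localization (dual_semigroup (\<sigma> \<inter> \<tau>)) (dual_semigroup (\<sigma> \<inter> \<tau> \<inter> \<rho>)) m"
    unfolding is_localization_def using m by (auto simp: additive_submonoid_dual)
  with m that show ?thesis by blast
qed

lemma localization_pair:
  assumes "\<sigma> \<in> \<Sigma>" "\<tau> \<in> \<Sigma>"
  obtains m where "is_localization (dual_semigroup \<sigma>) (dual_semigroup (\<sigma> \<inter> \<tau>)) m"
  using localization_triple[OF assms(1,1,2)] by auto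

lemma glueing_iff:
  "((\<sigma>, \<gamma>), (\<tau>, \<gamma>')) \<in> toric_glueing \<Sigma> \<longleftrightarrow> \<sigma> \<in> \<Sigma> \<and> \<tau> \<in> \<Sigma> \<and>
     (\<exists>\<delta>\<in>points (\<sigma> \<inter> \<tau>). \<gamma> = restrict \<delta> (dual_semigroup \<sigma>) \<and> \<gamma>' = restrict \<delta> (dual_semigroup \<tau>))"
  by (auto simp: toric_glueing_def)

lemma glueing_sym: "(x, y) \<in> toric_glueing \<Sigma> \<Longrightarrow> (y, x) \<in> toric_glueing \<Sigma>"
  by (cases x; cases y) (auto simp: glueing_iff Int_commute)

lemma glueing_refl:
  assumes "\<sigma> \<in> \<Sigma>" "\<gamma> \<in> points \<sigma>" shows "((\<sigma>, \<gamma>), (\<sigma>, \<gamma>)) \<in> toric_glueing \<Sigma>"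
proof -
  have "restrict \<gamma> (dual_semigroup \<sigma>) = \<gamma>"
    using assms(2) unfolding affine_toric_variety_eq by (auto simp: in_character_space extensional_restrict)
  then show ?thesis using assms unfolding glueing_iff by (intro conjI bexI[of _ \<gamma>]) simp_all
qed

text \<open>A point of \<open>\<tau>\<close> that lies in \<open>\<sigma>\<close> and in \<open>\<rho>\<close> comes from \<open>\<sigma> \<inter> \<tau>\<close>. The vector \<open>m\<close> separating
  \<open>\<tau> \<inter> \<rho>\<close> from \<open>\<tau>\<close> does not vanish at it, since it also comes from \<open>\<tau> \<inter> \<rho>\<close>, where \<open>m\<close> is invertible.
  So the point extends to \<open>\<sigma> \<inter> \<tau> \<inter> \<rho>\<close>.\<close>

lemma glueing_trans:
  assumes "(x, y) \<in> toric_glueing \<Sigma>" "(y, z) \<in> toric_glueing \<Sigma>"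
  shows "(x, z) \<in> toric_glueing \<Sigma>"
proof -
  obtain \<sigma> \<alpha> \<tau> \<gamma> \<rho> \<beta> where xyz: "x = (\<sigma>, \<alpha>)" "y = (\<tau>, \<gamma>)" "z = (\<rho>, \<beta>)" by (metis surj_pair)
  obtain \<delta>1 where 1: "\<sigma> \<in> \<Sigma>" "\<tau> \<in> \<Sigma>" "\<delta>1 \<in> points (\<sigma> \<inter> \<tau>)" "\<alpha> = restrict \<delta>1 (dual_semigroup \<sigma>)"
    "\<gamma> = restrict \<delta>1 (dual_semigroup \<tau>)"
    using assms(1) unfolding xyz glueing_iff by blast
  obtain \<delta>2 where 2: "\<rho> \<in> \<Sigma>" "\<delta>2 \<in> points (\<tau> \<inter> \<rho>)" "\<gamma> = restrict \<delta>2 (dual_semigroup \<tau>)"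
    "\<beta> = restrict \<delta>2 (dual_semigroup \<rho>)"
    using assms(2) unfolding xyz glueing_iff by blast
  obtain m where m: "m \<in> dual_semigroup \<tau>" "- m \<in> dual_semigroup (\<tau> \<inter> \<rho>)"
    and loc: "is_localization (dual_semigroup (\<sigma> \<inter> \<tau>)) (dual_semigroup (\<sigma> \<inter> \<tau> \<inter> \<rho>)) m"
    using localization_triple[OF 1(1,2) 2(1)] .
  have m': "m \<in> dual_semigroup (\<tau> \<inter> \<rho>)" using m(1) dual_semigroup_antimono[of "\<tau> \<inter> \<rho>" \<tau>] by blast
  have "\<delta>1 m = \<delta>2 m" using 1(5) 2(3) m(1) by (metis restrict_apply')
  also have "\<delta>2 m \<noteq> 0" using character_nonzero[OF _ m' m(2)] 2(2) by (simp add: affine_toric_variety_eq)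
  finally obtain \<delta> where \<delta>: "\<delta> \<in> points (\<sigma> \<inter> \<tau> \<inter> \<rho>)" "restrict \<delta> (dual_semigroup (\<sigma> \<inter> \<tau>)) = \<delta>1"
    using localization_extend[OF loc] 1(3) unfolding affine_toric_variety_eq by blast
  define \<delta>3 where "\<delta>3 = restrict \<delta> (dual_semigroup (\<tau> \<inter> \<rho>))"
  have \<delta>3: "\<delta>3 \<in> points (\<tau> \<inter> \<rho>)" unfolding \<delta>3_def by (rule restrict_points[OF \<delta>(1)]) auto
  have dual: "dual_semigroup \<tau> \<subseteq> dual_semigroup (\<sigma> \<inter> \<tau>)" "dual_semigroup \<tau> \<subseteq> dual_semigroup (\<tau> \<inter> \<rho>)"
    "dual_semigroup \<rho> \<subseteq> dual_semigroup (\<tau> \<inter> \<rho>)" "dual_semigroup \<rho> \<subseteq> dual_semigroup (\<sigma> \<inter> \<rho>)"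
    "dual_semigroup \<sigma> \<subseteq> dual_semigroup (\<sigma> \<inter> \<tau>)" "dual_semigroup \<sigma> \<subseteq> dual_semigroup (\<sigma> \<inter> \<rho>)"
    by (auto intro!: dual_semigroup_antimono)
  have "restrict \<delta>3 (dual_semigroup \<tau>) = restrict \<delta> (dual_semigroup \<tau>)"
    using dual by (auto simp: \<delta>3_def fun_eq_iff)
  also have "\<dots> = \<gamma>" using dual by (auto simp: 1(5) fun_eq_iff simp flip: \<delta>(2))
  finally have "restrict \<delta>3 (dual_semigroup \<tau>) = restrict \<delta>2 (dual_semigroup \<tau>)" using 2(3) by simp
  moreover obtain m'' where "is_localization (dual_semigroup \<tau>) (dual_semigroup (\<tau> \<inter> \<rho>)) m''"
    using localization_pair[OF 1(2) 2(1)] .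
  ultimately have "\<delta>3 = \<delta>2"
    using localization_inj \<delta>3 2(2) unfolding affine_toric_variety_eq by blast
  then have "\<delta>2 = restrict \<delta> (dual_semigroup (\<tau> \<inter> \<rho>))" by (simp add: \<delta>3_def)
  then have "\<beta> = restrict \<delta> (dual_semigroup \<rho>)"
    using dual(3) unfolding 2(4) by (auto simp: fun_eq_iff)
  moreover have "\<alpha> = restrict \<delta> (dual_semigroup \<sigma>)"
    using dual by (auto simp: 1(4) fun_eq_iff simp flip: \<delta>(2))
  moreover have "restrict \<delta> (dual_semigroup (\<sigma> \<inter> \<rho>)) \<in> points (\<sigma> \<inter> \<rho>)"
    by (rule restrict_points[OF \<delta>(1)]) auto
  ultimately show ?thesis
    unfolding xyz glueing_iff using 1(1) 2(1) dual
    by (intro conjI bexI[of _ "restrict \<delta> (dual_semigroup (\<sigma> \<inter> \<rho>))"]) (auto simp: fun_eq_iff)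
qed

definition chart :: "(real ^ 'n) set \<Rightarrow> 'n character \<Rightarrow> 'n toric_point" where
  "chart \<sigma> \<gamma> = toric_glueing \<Sigma> `` {(\<sigma>, \<gamma>)}"

lemma chart_eq_iff:
  assumes "\<sigma> \<in> \<Sigma>" "\<gamma> \<in> points \<sigma>" "\<tau> \<in> \<Sigma>" "\<gamma>' \<in> points \<tau>"
  shows "chart \<sigma> \<gamma> = chart \<tau> \<gamma>' \<longleftrightarrow> ((\<sigma>, \<gamma>), (\<tau>, \<gamma>')) \<in> toric_glueing \<Sigma>"
proof
  assume "chart \<sigma> \<gamma> = chart \<tau> \<gamma>'"
  then show "((\<sigma>, \<gamma>), (\<tau>, \<gamma>')) \<in> toric_glueing \<Sigma>"
    using glueing_refl[OF assms(3,4)] by (auto simp: chart_def)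
next
  assume *: "((\<sigma>, \<gamma>), (\<tau>, \<gamma>')) \<in> toric_glueing \<Sigma>"
  show "chart \<sigma> \<gamma> = chart \<tau> \<gamma>'"
    unfolding chart_def using glueing_trans[OF *] glueing_trans[OF glueing_sym[OF *]] by blast
qed

lemma quotient_sum_topology:
  "topspace (sum_topology Z I) // r = (\<Union>i\<in>I. (\<lambda>x. r `` {(i, x)}) ` topspace (Z i))"
  by (simp add: quotient_def UNION_singleton_eq_range Sigma_def image_UN image_image) blast

lemma topspace_toric_variety: "topspace (toric_variety \<Sigma>) = (\<Union>\<sigma>\<in>\<Sigma>. chart \<sigma> ` points \<sigma>)"
proof -
  let ?E = "sum_topology affine_toric_variety \<Sigma>"
  have "topspace (quotient_topology ?E r) = topspace ?E // r" for r :: "(((real ^ 'n) set \<times> 'n character) \<times> _) set"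
  proof -
    have "{x \<in> topspace ?E. r `` {x} \<in> topspace ?E // r} = topspace ?E"
      by (auto intro: quotientI)
    then have "openin (quotient_topology ?E r) (topspace ?E // r)"
      by (simp only: openin_quotient_topology openin_topspace simp_thms subset_refl)
    moreover have "topspace (quotient_topology ?E r) \<subseteq> topspace ?E // r"
      using openin_topspace[of "quotient_topology ?E r"] unfolding openin_quotient_topology by blast
    ultimately show ?thesis by (meson openin_subset subset_antisym)
  qed
  then show ?thesis
    unfolding toric_variety_def chart_def by (simp only: quotient_sum_topology)
qed

lemma openin_toric_variety:
  assumes "U \<subseteq> topspace (toric_variety \<Sigma>)"
  shows "openin (toric_variety \<Sigma>) U \<longleftrightarrow>
    (\<forall>\<tau>\<in>\<Sigma>. openin (affine_toric_variety \<tau>) {\<gamma> \<in> points \<tau>. chart \<tau> \<gamma> \<in> U})"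
proof -
  let ?E = "sum_topology affine_toric_variety \<Sigma>"
  have "U \<subseteq> topspace ?E // toric_glueing \<Sigma>"
    using assms unfolding topspace_toric_variety chart_def by (simp only: quotient_sum_topology)
  moreover have "{\<gamma>. (\<tau>, \<gamma>) \<in> {x \<in> topspace ?E. toric_glueing \<Sigma> `` {x} \<in> U}} = {\<gamma> \<in> points \<tau>. chart \<tau> \<gamma> \<in> U}"
    if "\<tau> \<in> \<Sigma>" for \<tau>
    using that by (auto simp: chart_def)
  ultimately show ?thesis
    unfolding toric_variety_def openin_quotient_topology openin_sum_topology by auto
qed

text \<open>In another chart \<open>\<tau>\<close>, the image of \<open>V\<close> is the image of a part of \<open>\<sigma> \<inter> \<tau>\<close> that is open by continuity of
  restriction to \<open>\<sigma>\<close>; restriction to \<open>\<tau>\<close> is an open map.\<close>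

lemma open_map_chart:
  assumes \<sigma>: "\<sigma> \<in> \<Sigma>"
  shows "open_map (affine_toric_variety \<sigma>) (toric_variety \<Sigma>) (chart \<sigma>)"
  unfolding open_map_def
proof (intro allI impI)
  fix V assume V: "openin (affine_toric_variety \<sigma>) V"
  have V_sub: "V \<subseteq> points \<sigma>" using openin_subset[OF V] .
  show "openin (toric_variety \<Sigma>) (chart \<sigma> ` V)"
  proof (subst openin_toric_variety)
    show "chart \<sigma> ` V \<subseteq> topspace (toric_variety \<Sigma>)"
      using V_sub \<sigma> unfolding topspace_toric_variety by blast
    show "\<forall>\<tau>\<in>\<Sigma>. openin (affine_toric_variety \<tau>) {\<gamma> \<in> points \<tau>. chart \<tau> \<gamma> \<in> chart \<sigma> ` V}"
    proof
      fix \<tau> assume \<tau>: "\<tau> \<in> \<Sigma>"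
      let ?V = "{\<delta> \<in> points (\<sigma> \<inter> \<tau>). restrict \<delta> (dual_semigroup \<sigma>) \<in> V}"
      have "{\<gamma> \<in> points \<tau>. chart \<tau> \<gamma> \<in> chart \<sigma> ` V} = (\<lambda>\<delta>. restrict \<delta> (dual_semigroup \<tau>)) ` ?V"
      proof (intro equalityI subsetI)
        fix \<gamma> assume "\<gamma> \<in> {\<gamma> \<in> points \<tau>. chart \<tau> \<gamma> \<in> chart \<sigma> ` V}"
        then obtain \<gamma>' where \<gamma>': "\<gamma> \<in> points \<tau>" "\<gamma>' \<in> V" "chart \<sigma> \<gamma>' = chart \<tau> \<gamma>" by auto
        then have "((\<sigma>, \<gamma>'), (\<tau>, \<gamma>)) \<in> toric_glueing \<Sigma>"
          using chart_eq_iff[OF \<sigma> _ \<tau>] V_sub by blast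
        then show "\<gamma> \<in> (\<lambda>\<delta>. restrict \<delta> (dual_semigroup \<tau>)) ` ?V"
          using \<gamma>' unfolding glueing_iff by auto
      next
        fix \<gamma> assume "\<gamma> \<in> (\<lambda>\<delta>. restrict \<delta> (dual_semigroup \<tau>)) ` ?V"
        then obtain \<delta> where \<delta>: "\<delta> \<in> points (\<sigma> \<inter> \<tau>)" "restrict \<delta> (dual_semigroup \<sigma>) \<in> V"
          "\<gamma> = restrict \<delta> (dual_semigroup \<tau>)" by auto
        have "\<gamma> \<in> points \<tau>" unfolding \<delta>(3) by (rule restrict_points[OF \<delta>(1)]) auto
        moreover have "((\<sigma>, restrict \<delta> (dual_semigroup \<sigma>)), (\<tau>, \<gamma>)) \<in> toric_glueing \<Sigma>"
          using \<delta> \<sigma> \<tau> by (auto simp: glueing_iff)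
        ultimately have "chart \<tau> \<gamma> = chart \<sigma> (restrict \<delta> (dual_semigroup \<sigma>))"
          using chart_eq_iff[OF \<sigma> _ \<tau>] \<delta> V_sub by blast
        then show "\<gamma> \<in> {\<gamma> \<in> points \<tau>. chart \<tau> \<gamma> \<in> chart \<sigma> ` V}"
          using \<open>\<gamma> \<in> points \<tau>\<close> \<delta> by auto
      qed
      moreover have "openin (affine_toric_variety (\<sigma> \<inter> \<tau>)) ?V"
      proof (rule openin_continuous_map_preimage[OF _ V])
        show "continuous_map (affine_toric_variety (\<sigma> \<inter> \<tau>)) (affine_toric_variety \<sigma>)
            (\<lambda>\<delta>. restrict \<delta> (dual_semigroup \<sigma>))"
          using additive_submonoid_dual[of \<sigma>] unfolding affine_toric_variety_eq
          by (intro continuous_map_restrict_character dual_semigroup_antimono)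
            (auto simp: additive_submonoid_def)
      qed
      moreover have "open_map (affine_toric_variety (\<sigma> \<inter> \<tau>)) (affine_toric_variety \<tau>)
          (\<lambda>\<delta>. restrict \<delta> (dual_semigroup \<tau>))"
      proof -
        obtain m where "is_localization (dual_semigroup \<tau>) (dual_semigroup (\<tau> \<inter> \<sigma>)) m"
          using localization_pair[OF \<tau> \<sigma>] .
        then show ?thesis
          using open_map_localization by (simp add: affine_toric_variety_eq Int_commute)
      qed
      ultimately show "openin (affine_toric_variety \<tau>) {\<gamma> \<in> points \<tau>. chart \<tau> \<gamma> \<in> chart \<sigma> ` V}"
        by (simp add: open_map_def)
    qed
  qed
qed

lemma continuous_map_chart:
  assumes \<sigma>: "\<sigma> \<in> \<Sigma>"
  shows "continuous_map (affine_toric_variety \<sigma>) (toric_variety \<Sigma>) (chart \<sigma>)"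
  unfolding continuous_map_def
proof (intro conjI allI impI)
  show "chart \<sigma> \<in> points \<sigma> \<rightarrow> topspace (toric_variety \<Sigma>)"
    using \<sigma> unfolding topspace_toric_variety by blast
  fix U assume U: "openin (toric_variety \<Sigma>) U"
  then show "openin (affine_toric_variety \<sigma>) {\<gamma> \<in> points \<sigma>. chart \<sigma> \<gamma> \<in> U}"
    using openin_toric_variety[OF openin_subset[OF U]] \<sigma> by blast
qed

lemma chart_homeomorphic:
  assumes \<sigma>: "\<sigma> \<in> \<Sigma>"
  shows "affine_toric_variety \<sigma> homeomorphic_space subtopology (toric_variety \<Sigma>) (chart \<sigma> ` points \<sigma>)"
proof -
  have "inj_on (chart \<sigma>) (points \<sigma>)"
    using chart_eq_iff[OF \<sigma> _ \<sigma>] by (auto simp: inj_on_def glueing_iff)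
  then show ?thesis
    using continuous_map_chart[OF \<sigma>] open_map_chart[OF \<sigma>]
    by (intro embedding_map_imp_homeomorphic_space injective_open_imp_embedding_map)
qed

lemma chart_Int:
  assumes \<sigma>: "\<sigma> \<in> \<Sigma>" and \<tau>: "\<tau> \<in> \<Sigma>"
  shows "chart \<sigma> ` points \<sigma> \<inter> chart \<tau> ` points \<tau> = chart (\<sigma> \<inter> \<tau>) ` points (\<sigma> \<inter> \<tau>)"
proof -
  note \<sigma>\<tau> = fan_Int[OF \<sigma> \<tau>]
  have eq: "chart (\<sigma> \<inter> \<tau>) \<delta> = chart \<rho> (restrict \<delta> (dual_semigroup \<rho>))"
    "restrict \<delta> (dual_semigroup \<rho>) \<in> points \<rho>"
    if "\<delta> \<in> points (\<sigma> \<inter> \<tau>)" "\<rho> \<in> \<Sigma>" "\<sigma> \<inter> \<tau> \<subseteq> \<rho>" for \<delta> \<rho>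
  proof -
    show pt: "restrict \<delta> (dual_semigroup \<rho>) \<in> points \<rho>" by (rule restrict_points[OF that(1,3)])
    have "restrict \<delta> (dual_semigroup (\<sigma> \<inter> \<tau>)) = \<delta>"
      using that(1) unfolding affine_toric_variety_eq by (auto simp: in_character_space extensional_restrict)
    moreover have "\<sigma> \<inter> \<tau> \<inter> \<rho> = \<sigma> \<inter> \<tau>" using that(3) by auto
    ultimately have "((\<sigma> \<inter> \<tau>, \<delta>), (\<rho>, restrict \<delta> (dual_semigroup \<rho>))) \<in> toric_glueing \<Sigma>"
      unfolding glueing_iff using that \<sigma>\<tau> by (intro conjI bexI[of _ \<delta>]) auto
    then show "chart (\<sigma> \<inter> \<tau>) \<delta> = chart \<rho> (restrict \<delta> (dual_semigroup \<rho>))"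
      using chart_eq_iff[OF \<sigma>\<tau> that(1) that(2) pt] by simp
  qed
  show ?thesis
  proof (intro equalityI subsetI)
    fix x assume "x \<in> chart \<sigma> ` points \<sigma> \<inter> chart \<tau> ` points \<tau>"
    then obtain \<gamma> \<gamma>' where *: "\<gamma> \<in> points \<sigma>" "\<gamma>' \<in> points \<tau>" "x = chart \<sigma> \<gamma>" "x = chart \<tau> \<gamma>'" by auto
    then have "((\<sigma>, \<gamma>), (\<tau>, \<gamma>')) \<in> toric_glueing \<Sigma>"
      using chart_eq_iff[OF \<sigma> _ \<tau>] by metis
    then obtain \<delta> where "\<delta> \<in> points (\<sigma> \<inter> \<tau>)" "\<gamma> = restrict \<delta> (dual_semigroup \<sigma>)"
      unfolding glueing_iff by auto
    then show "x \<in> chart (\<sigma> \<inter> \<tau>) ` points (\<sigma> \<inter> \<tau>)"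
      using eq(1)[of \<delta> \<sigma>] \<sigma> *(3) by auto
  next
    fix x assume "x \<in> chart (\<sigma> \<inter> \<tau>) ` points (\<sigma> \<inter> \<tau>)"
    then obtain \<delta> where "\<delta> \<in> points (\<sigma> \<inter> \<tau>)" "x = chart (\<sigma> \<inter> \<tau>) \<delta>" by auto
    then show "x \<in> chart \<sigma> ` points \<sigma> \<inter> chart \<tau> ` points \<tau>"
      using eq[of \<delta> \<sigma>] eq[of \<delta> \<tau>] \<sigma> \<tau> by auto
  qed
qed

text \<open>The charts cover the variety, are closed under intersection, and are homeomorphic to affine toric
  varieties.\<close>

theorem finite_homology_toric_variety: "finite_homology (toric_variety \<Sigma>) {}"
proof -
  let ?W = "\<lambda>\<sigma>. chart \<sigma> ` points \<sigma>"
  have "finite_homology (subtopology (toric_variety \<Sigma>) (\<Union>(?W ` \<Sigma>))) {}"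
  proof (rule finite_homology_Union)
    show "openin (toric_variety \<Sigma>) U" if "U \<in> ?W ` \<Sigma>" for U
      using that open_map_chart by (auto simp: open_map_def)
    show "U \<inter> V \<in> ?W ` \<Sigma>" if "U \<in> ?W ` \<Sigma>" "V \<in> ?W ` \<Sigma>" for U V
      using that chart_Int fan_Int by (smt (verit) image_iff)
    show "finite_homology (subtopology (toric_variety \<Sigma>) U) {}" if U: "U \<in> ?W ` \<Sigma>" for U
    proof -
      obtain \<sigma> where \<sigma>: "\<sigma> \<in> \<Sigma>" "U = ?W \<sigma>" using U by auto
      obtain v where "v \<in> \<sigma>" "v \<in> integral_points"
        "\<And>m. m \<in> dual_semigroup \<sigma> \<Longrightarrow> m \<bullet> v = 0 \<Longrightarrow> - m \<in> dual_semigroup \<sigma>"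
        using interior_point[OF \<sigma>(1)] by blast
      then have "finite_homology (affine_toric_variety \<sigma>) {}"
        by (rule finite_homology_affine_toric_variety)
      with homeomorphic_imp_homotopy_equivalent_space[OF chart_homeomorphic[OF \<sigma>(1)]]
      show ?thesis unfolding \<sigma>(2) by (rule finite_homology_homotopy_equivalent)
    qed
    show "finite (?W ` \<Sigma>)" using finite_fan by simp
    show "?W ` \<Sigma> \<subseteq> ?W ` \<Sigma>" ..
  qed
  then show ?thesis by (simp flip: topspace_toric_variety)
qed

end

section \<open>Stars of simplicial cones\<close>

definition nonneg_span :: "(real ^ 'n) set \<Rightarrow> (real ^ 'n) set" where
  "nonneg_span B = {\<Sum>b\<in>B. a b *\<^sub>R b | a. \<forall>b\<in>B. 0 \<le> a b}"

lemma nonneg_spanI: "(\<And>b. b \<in> B \<Longrightarrow> 0 \<le> a b) \<Longrightarrow> (\<Sum>b\<in>B. a b *\<^sub>R b) \<in> nonneg_span B"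
  by (auto simp: nonneg_span_def)

lemma nonneg_spanE:
  assumes "x \<in> nonneg_span B"
  obtains a where "\<forall>b\<in>B. 0 \<le> a b" "x = (\<Sum>b\<in>B. a b *\<^sub>R b)"
  using assms by (auto simp: nonneg_span_def)

lemma orthogonal_span:
  fixes x :: "real ^ 'n"
  assumes "\<forall>c\<in>B. x \<bullet> c = 0" "v \<in> span B" shows "x \<bullet> v = 0"
  using assms(2,1) by (induction rule: span_induct_alt) (auto simp: inner_add_right)

lemma nonneg_span_mono:
  assumes "finite B" "A \<subseteq> B" shows "nonneg_span A \<subseteq> nonneg_span B"
proof
  fix x assume "x \<in> nonneg_span A"
  then obtain a where a: "\<forall>b\<in>A. 0 \<le> a b" "x = (\<Sum>b\<in>A. a b *\<^sub>R b)" by (rule nonneg_spanE)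
  have "x = (\<Sum>b\<in>B. (if b \<in> A then a b else 0) *\<^sub>R b)"
    unfolding a(2) using assms by (intro sum.mono_neutral_cong_left) auto
  also have "\<dots> \<in> nonneg_span B" using a(1) by (intro nonneg_spanI) auto
  finally show "x \<in> nonneg_span B" .
qed

lemma generator_in_nonneg_span:
  assumes "finite B" "b \<in> B" shows "b \<in> nonneg_span B"
proof -
  have "b \<in> nonneg_span {b}" using nonneg_spanI[of "{b}" "\<lambda>_. 1"] by simp
  then show ?thesis using nonneg_span_mono[of B "{b}"] assms by auto
qed

lemma convex_cone_nonneg_span:
  assumes "finite B"
  shows "convex_cone (nonneg_span B)"
  unfolding convex_cone_iff
proof (intro conjI ballI allI impI)
  show "0 \<in> nonneg_span B" using nonneg_spanI[of B "\<lambda>_. 0"] by simp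
  fix x assume "x \<in> nonneg_span B"
  then obtain a where a: "\<forall>b\<in>B. 0 \<le> a b" "x = (\<Sum>b\<in>B. a b *\<^sub>R b)" by (rule nonneg_spanE)
  show "x + y \<in> nonneg_span B" if y: "y \<in> nonneg_span B" for y
  proof -
    obtain c where c: "\<forall>b\<in>B. 0 \<le> c b" "y = (\<Sum>b\<in>B. c b *\<^sub>R b)" using y by (rule nonneg_spanE)
    have "x + y = (\<Sum>b\<in>B. (a b + c b) *\<^sub>R b)" by (simp add: a c scaleR_left_distrib sum.distrib)
    then show ?thesis using nonneg_spanI[of B "\<lambda>b. a b + c b"] a c by simp
  qed
  show "t *\<^sub>R x \<in> nonneg_span B" if "t \<ge> 0" for t
  proof -
    have "t *\<^sub>R x = (\<Sum>b\<in>B. (t * a b) *\<^sub>R b)" by (simp add: a scaleR_sum_right)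
    then show ?thesis using nonneg_spanI[of B "\<lambda>b. t * a b"] a that by simp
  qed
qed

lemma convex_cone_hull_finite:
  assumes "finite B" shows "convex_cone hull B = nonneg_span B"
proof (rule hull_unique)
  show "B \<subseteq> nonneg_span B" using generator_in_nonneg_span[OF assms] by blast
  show "convex_cone (nonneg_span B)" by (rule convex_cone_nonneg_span[OF assms])
  fix C assume C: "B \<subseteq> C" "convex_cone C"
  show "nonneg_span B \<subseteq> C"
  proof
    fix x assume "x \<in> nonneg_span B"
    then obtain a where a: "\<forall>b\<in>B. 0 \<le> a b" "x = (\<Sum>b\<in>B. a b *\<^sub>R b)" by (rule nonneg_spanE)
    have "(\<Sum>b\<in>A. a b *\<^sub>R b) \<in> C" if "finite A" "A \<subseteq> B" for A
      using that
    proof induction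
      case empty
      then show ?case using C(2) by (simp add: convex_cone_iff)
    next
      case (insert b A)
      then have "a b *\<^sub>R b \<in> C" using a(1) C by (auto simp: convex_cone_iff)
      then show ?case using insert C(2) by (auto simp: convex_cone_iff)
    qed
    then show "x \<in> C" using a(2) assms by blast
  qed
qed

lemma span_nonneg_span:
  assumes "finite B" shows "span (nonneg_span B) = span B"
proof (rule subset_antisym)
  have "nonneg_span B \<subseteq> span B"
    by (auto simp: nonneg_span_def intro!: span_sum span_scale intro: span_base)
  then show "span (nonneg_span B) \<subseteq> span B" by (rule span_minimal) (rule subspace_span)
  show "span B \<subseteq> span (nonneg_span B)"
    using generator_in_nonneg_span[OF assms] by (intro span_mono) blast
qed

lemma independent_coefficients_unique:
  fixes B :: "(real ^ 'n) set"
  assumes "independent B" "(\<Sum>b\<in>B. a b *\<^sub>R b) = (\<Sum>b\<in>B. c b *\<^sub>R b)" "b \<in> B"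
  shows "a b = c b"
proof -
  have fin: "finite B" using assms(1) by (rule independent_imp_finite)
  have "(\<Sum>b\<in>B. (a b - c b) *\<^sub>R b) = 0"
    using assms(2) by (simp add: scaleR_left_diff_distrib sum_subtractf)
  then have "a b - c b = 0" using independentD[OF assms(1) fin order_refl _ assms(3), of "\<lambda>b. a b - c b"] by simp
  then show ?thesis by simp
qed

lemma integral_points_closed:
  "0 \<in> integral_points" "x \<in> integral_points \<Longrightarrow> y \<in> integral_points \<Longrightarrow> x + y \<in> integral_points"
  "x \<in> integral_points \<Longrightarrow> y \<in> integral_points \<Longrightarrow> x - y \<in> integral_points"
  "x \<in> integral_points \<Longrightarrow> k \<in> \<int> \<Longrightarrow> k *\<^sub>R x \<in> integral_points"
  "x \<in> integral_points \<Longrightarrow> y \<in> integral_points \<Longrightarrow> x \<bullet> y \<in> \<int>"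
  by (auto simp: integral_points_def inner_vec_def intro!: Ints_sum Ints_mult)

lemma integral_points_sum:
  "(\<And>i. i \<in> A \<Longrightarrow> f i \<in> integral_points) \<Longrightarrow> (\<Sum>i\<in>A. f i) \<in> integral_points"
  by (induction A rule: infinite_finite_induct) (auto simp: integral_points_closed)

text \<open>Gram-Schmidt orthogonalization with the denominators cleared, so that everything stays integral:
  \<open>w\<close> is \<open>N\<close> times the projection of \<open>u\<close> to the span of \<open>B\<close>.\<close>

lemma integral_orthogonalization:
  fixes B :: "(real ^ 'n) set"
  assumes "finite B" "B \<subseteq> integral_points" "u \<in> integral_points"
  shows "\<exists>N w. N \<in> \<int> \<and> N > 0 \<and> w \<in> span B \<and> N *\<^sub>R u - w \<in> integral_points \<and> (\<forall>b\<in>B. (N *\<^sub>R u - w) \<bullet> b = 0)"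
  using assms
proof (induction arbitrary: u)
  case empty
  then show ?case by (intro exI[of _ 1] exI[of _ 0]) auto
next
  case (insert b B)
  obtain N w where u: "N \<in> \<int>" "N > 0" "w \<in> span B" "N *\<^sub>R u - w \<in> integral_points"
    "\<forall>b\<in>B. (N *\<^sub>R u - w) \<bullet> b = 0"
    using insert.IH[of u] insert.prems by blast
  obtain M y where b: "M \<in> \<int>" "M > 0" "y \<in> span B" "M *\<^sub>R b - y \<in> integral_points"
    "\<forall>c\<in>B. (M *\<^sub>R b - y) \<bullet> c = 0"
    using insert.IH[of b] insert.prems by blast
  define u' where "u' = N *\<^sub>R u - w"
  define b' where "b' = M *\<^sub>R b - y"
  note sp = orthogonal_span[of B]
  have spB: "span B \<subseteq> span (insert b B)" by (rule span_mono) auto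
  have uy: "u' \<bullet> y = 0" using sp u b by (simp add: u'_def)
  show ?case
  proof (cases "b' = 0")
    case True
    then have "M *\<^sub>R b = y" by (simp add: b'_def)
    then have "u' \<bullet> (M *\<^sub>R b) = 0" using uy by simp
    then have "u' \<bullet> b = 0" using b(2) by simp
    then show ?thesis using u spB unfolding u'_def by blast
  next
    case False
    then have pos: "b' \<bullet> b' > 0" by simp
    define w' where "w' = (b' \<bullet> b') *\<^sub>R w + (u' \<bullet> b') *\<^sub>R b'"
    let ?N = "(b' \<bullet> b') * N"
    have eq: "?N *\<^sub>R u - w' = (b' \<bullet> b') *\<^sub>R u' - (u' \<bullet> b') *\<^sub>R b'"
      by (simp add: w'_def u'_def algebra_simps)
    have b'_sp: "b' \<in> span (insert b B)"
      using b(3) spB unfolding b'_def by (auto intro!: span_diff span_scale intro: span_base)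
    have int: "u' \<in> integral_points" "b' \<in> integral_points" using u b by (auto simp: u'_def b'_def)
    have "?N \<in> \<int>" using u int by (simp add: integral_points_closed Ints_mult)
    moreover have "?N > 0" using pos u by simp
    moreover have "w' \<in> span (insert b B)"
      unfolding w'_def using u(3) spB b'_sp by (auto intro!: span_add span_scale)
    moreover have "?N *\<^sub>R u - w' \<in> integral_points"
      unfolding eq using int by (simp add: integral_points_closed)
    moreover have "(?N *\<^sub>R u - w') \<bullet> c = 0" if "c \<in> insert b B" for c
    proof (cases "c \<in> B")
      case True
      then show ?thesis unfolding eq using u(5) b(5) by (simp add: u'_def b'_def inner_diff_left)
    next
      case False
      then have c: "c = b" using that by simp
      have "(?N *\<^sub>R u - w') \<bullet> b' = 0" unfolding eq by (simp add: inner_diff_left algebra_simps)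
      moreover have "(?N *\<^sub>R u - w') \<bullet> y = 0"
        unfolding eq using uy sp[OF b(5) b(3)] by (simp add: inner_diff_left b'_def)
      moreover have "M *\<^sub>R b = b' + y" by (simp add: b'_def)
      ultimately have "(?N *\<^sub>R u - w') \<bullet> (M *\<^sub>R b) = 0" by (simp add: inner_add_right)
      then show ?thesis using b(2) c by simp
    qed
    ultimately show ?thesis by blast
  qed
qed

text \<open>The component of \<open>b\<close> orthogonal to the other vectors, scaled to be integral.\<close>

lemma integral_dual_vector:
  fixes B :: "(real ^ 'n) set"
  assumes "independent B" "B \<subseteq> integral_points" "b \<in> B"
  obtains m where "m \<in> integral_points" "m \<bullet> b > 0" "\<And>c. c \<in> B - {b} \<Longrightarrow> m \<bullet> c = 0"
proof -
  have fin: "finite (B - {b})" using independent_imp_finite[OF assms(1)] by simp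
  obtain N w where m: "N \<in> \<int>" "N > 0" "w \<in> span (B - {b})" "N *\<^sub>R b - w \<in> integral_points"
    "\<forall>c\<in>B - {b}. (N *\<^sub>R b - w) \<bullet> c = 0"
    using integral_orthogonalization[OF fin, of b] assms by blast
  let ?m = "N *\<^sub>R b - w"
  have "?m \<noteq> 0"
  proof
    assume "?m = 0"
    then have "b = (1 / N) *\<^sub>R w" using m(2) by (simp add: eq_vector_fraction_iff)
    then have "b \<in> span (B - {b})" using m(3) by (simp add: span_scale)
    then show False using assms(1,3) by (auto simp: dependent_def)
  qed
  have "?m \<bullet> w = 0"
    using orthogonal_span[OF m(5,3)] .
  then have "?m \<bullet> ?m = N * (?m \<bullet> b)" by (simp add: inner_diff_right)
  moreover have "?m \<bullet> ?m > 0" using \<open>?m \<noteq> 0\<close> by simp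
  ultimately have "?m \<bullet> b > 0" using m(2) by (simp add: zero_less_mult_iff)
  then show ?thesis using m that[of ?m] by blast
qed

text \<open>Integral supporting vectors of the faces of a simplicial cone. Adding up the dual vectors of the
  elements of \<open>A\<close> gives one that vanishes on the face spanned by \<open>B - A\<close>.\<close>

lemma integral_separating_vector:
  fixes B :: "(real ^ 'n) set"
  assumes "independent B" "B \<subseteq> integral_points" "A \<subseteq> B"
  obtains m where "m \<in> integral_points" "\<And>b. b \<in> A \<Longrightarrow> m \<bullet> b > 0" "\<And>b. b \<in> B - A \<Longrightarrow> m \<bullet> b = 0"
proof -
  have "\<forall>b\<in>B. \<exists>m. m \<in> integral_points \<and> m \<bullet> b > 0 \<and> (\<forall>c\<in>B - {b}. m \<bullet> c = 0)"
    using integral_dual_vector[OF assms(1,2)] by metis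
  then obtain f where f: "\<And>b. b \<in> B \<Longrightarrow> f b \<in> integral_points \<and> f b \<bullet> b > 0 \<and> (\<forall>c\<in>B - {b}. f b \<bullet> c = 0)"
    by (metis bchoice)
  have fin: "finite A" using finite_subset[OF assms(3) independent_imp_finite[OF assms(1)]] .
  let ?m = "\<Sum>a\<in>A. f a"
  have "?m \<bullet> b = (if b \<in> A then f b \<bullet> b else 0)" if "b \<in> B" for b
  proof -
    have "?m \<bullet> b = (\<Sum>a\<in>A. if a = b then f b \<bullet> b else 0)"
      unfolding inner_sum_left using f assms(3) that by (intro sum.cong) auto
    then show ?thesis using fin by simp
  qed
  then show ?thesis using f assms(3) that[of ?m] integral_points_sum[of A f]
    by (metis (no_types, lifting) DiffD1 DiffD2 subsetD)
qed

text \<open>The sets in \<open>\<T>\<close> are the generators of the cones that have the cone of \<open>B0\<close> as a face. Quotients of a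
  simplicial fan are of this form.\<close>

locale simplicial_star =
  fixes \<T> :: "(real ^ 'n) set set" and B0 :: "(real ^ 'n) set"
  assumes finite_star: "finite \<T>"
    and star: "T \<in> \<T> \<Longrightarrow> B0 \<subseteq> T" and indep: "T \<in> \<T> \<Longrightarrow> independent T"
    and integral: "T \<in> \<T> \<Longrightarrow> T \<subseteq> integral_points"
    and star_Int: "T \<in> \<T> \<Longrightarrow> T' \<in> \<T> \<Longrightarrow> T \<inter> T' \<in> \<T>"
    and cone_Int: "T \<in> \<T> \<Longrightarrow> T' \<in> \<T> \<Longrightarrow> nonneg_span T \<inter> nonneg_span T' = nonneg_span (T \<inter> T')"
begin

text \<open>The preimage of a cone of the quotient fan.\<close>

definition star_cone :: "(real ^ 'n) set \<Rightarrow> (real ^ 'n) set" where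
  "star_cone T = {x + y | x y. x \<in> nonneg_span T \<and> y \<in> span B0}"

lemma finite_T: "T \<in> \<T> \<Longrightarrow> finite T"
  using indep independent_imp_finite by blast

lemma zero_nonneg_span: "T \<in> \<T> \<Longrightarrow> 0 \<in> nonneg_span T"
  using convex_cone_nonneg_span[OF finite_T] by (simp add: convex_cone_iff)

lemma dual_star_cone:
  assumes T: "T \<in> \<T>"
  shows "dual_semigroup (star_cone T) =
    {m \<in> integral_points. (\<forall>b\<in>T. m \<bullet> b \<ge> 0) \<and> (\<forall>b\<in>B0. m \<bullet> b = 0)}"
proof (intro equalityI subsetI)
  fix m assume m: "m \<in> dual_semigroup (star_cone T)"
  have "m \<bullet> b \<ge> 0" if "b \<in> T" for b
  proof -
    have "b \<in> star_cone T"
      unfolding star_cone_def using generator_in_nonneg_span[OF finite_T[OF T] that] span_zero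
      by (intro CollectI exI[of _ b] exI[of _ 0]) auto
    then show ?thesis using m by (auto simp: dual_semigroup_def)
  qed
  moreover have "m \<bullet> b = 0" if "b \<in> B0" for b
  proof -
    have "y \<in> star_cone T" if "y \<in> span B0" for y
      unfolding star_cone_def using zero_nonneg_span[OF T] that
      by (intro CollectI exI[of _ 0] exI[of _ y]) auto
    then have "b \<in> star_cone T" "- b \<in> star_cone T" using that span_base span_neg by blast+
    then have "m \<bullet> b \<ge> 0" "m \<bullet> (- b) \<ge> 0" using m unfolding dual_semigroup_def by blast+
    then show ?thesis by simp
  qed
  ultimately show "m \<in> {m \<in> integral_points. (\<forall>b\<in>T. m \<bullet> b \<ge> 0) \<and> (\<forall>b\<in>B0. m \<bullet> b = 0)}"
    using m by (auto simp: dual_semigroup_def)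
next
  fix m assume m: "m \<in> {m \<in> integral_points. (\<forall>b\<in>T. m \<bullet> b \<ge> 0) \<and> (\<forall>b\<in>B0. m \<bullet> b = 0)}"
  have "m \<bullet> (x + y) \<ge> 0" if x: "x \<in> nonneg_span T" and y: "y \<in> span B0" for x y
  proof -
    have "m \<bullet> y = 0" using m orthogonal_span[OF _ y] by blast
    moreover obtain a where "\<forall>b\<in>T. 0 \<le> a b" "x = (\<Sum>b\<in>T. a b *\<^sub>R b)"
      using x by (rule nonneg_spanE)
    moreover from this have "m \<bullet> x \<ge> 0" using m by (auto simp: inner_sum_right intro!: sum_nonneg)
    ultimately show ?thesis by (simp add: inner_add_right)
  qed
  then show "m \<in> dual_semigroup (star_cone T)"
    using m by (auto simp: dual_semigroup_def star_cone_def)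
qed

text \<open>A large multiple of the sum of \<open>B0\<close> moves a point of \<open>star_cone T\<close> into the cone of \<open>T\<close> itself, so
  the claim reduces to the intersection of the cones of \<open>T\<close> and \<open>T'\<close>.\<close>

lemma star_cone_Int:
  assumes T: "T \<in> \<T>" and T': "T' \<in> \<T>"
  shows "star_cone T \<inter> star_cone T' = star_cone (T \<inter> T')"
proof (intro equalityI subsetI)
  fix x assume "x \<in> star_cone (T \<inter> T')"
  then show "x \<in> star_cone T \<inter> star_cone T'"
    using nonneg_span_mono[OF finite_T[OF T], of "T \<inter> T'"] nonneg_span_mono[OF finite_T[OF T'], of "T \<inter> T'"]
    unfolding star_cone_def by blast
next
  fix x assume x: "x \<in> star_cone T \<inter> star_cone T'"
  have B0: "finite B0" using finite_subset[OF star[OF T] finite_T[OF T]] .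
  have shift: "\<exists>K. \<forall>k\<ge>K. x + k *\<^sub>R (\<Sum>b\<in>B0. b) \<in> nonneg_span S" if S: "S \<in> \<T>" and "x \<in> star_cone S" for S
  proof -
    obtain p s where ps: "x = p + s" "p \<in> nonneg_span S" "s \<in> span B0"
      using \<open>x \<in> star_cone S\<close> by (auto simp: star_cone_def)
    obtain a where a: "s = (\<Sum>b\<in>B0. a b *\<^sub>R b)"
      using ps(3) span_finite[OF B0] by auto
    define K where "K = (\<Sum>b\<in>B0. \<bar>a b\<bar>)"
    have "x + k *\<^sub>R (\<Sum>b\<in>B0. b) \<in> nonneg_span S" if "k \<ge> K" for k
    proof -
      have "0 \<le> a b + k" if "b \<in> B0" for b
      proof -
        have "\<bar>a b\<bar> \<le> K" unfolding K_def using B0 that by (intro member_le_sum) auto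
        then show ?thesis using \<open>k \<ge> K\<close> by linarith
      qed
      then have "(\<Sum>b\<in>B0. (a b + k) *\<^sub>R b) \<in> nonneg_span B0" by (rule nonneg_spanI)
      then have "(\<Sum>b\<in>B0. (a b + k) *\<^sub>R b) \<in> nonneg_span S"
        using nonneg_span_mono[OF finite_T[OF S] star[OF S]] by blast
      moreover have "x + k *\<^sub>R (\<Sum>b\<in>B0. b) = p + (\<Sum>b\<in>B0. (a b + k) *\<^sub>R b)"
        by (simp add: ps(1) a scaleR_left_distrib sum.distrib scaleR_sum_right)
      ultimately show ?thesis
        using ps(2) convex_cone_nonneg_span[OF finite_T[OF S]] by (simp add: convex_cone_iff)
    qed
    then show ?thesis by blast
  qed
  obtain K where K: "\<forall>k\<ge>K. x + k *\<^sub>R (\<Sum>b\<in>B0. b) \<in> nonneg_span T" using shift[OF T] x by blast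
  obtain K' where K': "\<forall>k\<ge>K'. x + k *\<^sub>R (\<Sum>b\<in>B0. b) \<in> nonneg_span T'" using shift[OF T'] x by blast
  define k where "k = max K K'"
  have "x + k *\<^sub>R (\<Sum>b\<in>B0. b) \<in> nonneg_span (T \<inter> T')"
    using K K' cone_Int[OF T T'] by (auto simp: k_def)
  moreover have "- (k *\<^sub>R (\<Sum>b\<in>B0. b)) \<in> span B0"
    by (intro span_neg span_scale span_sum span_base)
  ultimately show "x \<in> star_cone (T \<inter> T')"
    unfolding star_cone_def
    by (intro CollectI exI[of _ "x + k *\<^sub>R (\<Sum>b\<in>B0. b)"] exI[of _ "- (k *\<^sub>R (\<Sum>b\<in>B0. b))"]) auto
qed

text \<open>The sum of the generators is the interior point. A vector that vanishes on \<open>T2 \<inter> T3\<close> and is positive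
  on \<open>T2 - T3\<close> separates: a large multiple of it outweighs any \<open>s\<close> on the generators outside \<open>T3\<close>.\<close>

lemma toric_fan_star: "toric_fan (star_cone ` \<T>)"
proof
  show "finite (star_cone ` \<T>)" using finite_star by simp
  show "\<sigma> \<inter> \<tau> \<in> star_cone ` \<T>" if "\<sigma> \<in> star_cone ` \<T>" "\<tau> \<in> star_cone ` \<T>" for \<sigma> \<tau>
    using that star_cone_Int star_Int by auto
next
  fix \<sigma> assume "\<sigma> \<in> star_cone ` \<T>"
  then obtain T where T: "T \<in> \<T>" "\<sigma> = star_cone T" by auto
  let ?v = "\<Sum>b\<in>T. b"
  have "?v \<in> nonneg_span T" using nonneg_spanI[of T "\<lambda>_. 1"] by simp
  then have "?v \<in> \<sigma>"
    unfolding T(2) star_cone_def using span_zero by (intro CollectI exI[of _ ?v] exI[of _ 0]) auto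
  moreover have "?v \<in> integral_points" using integral[OF T(1)] by (intro integral_points_sum) auto
  moreover have "- m \<in> dual_semigroup \<sigma>" if m: "m \<in> dual_semigroup \<sigma>" "m \<bullet> ?v = 0" for m
  proof -
    have "\<forall>b\<in>T. m \<bullet> b = 0"
      using m sum_nonneg_eq_0_iff[OF finite_T[OF T(1)], of "\<lambda>b. m \<bullet> b"]
      by (simp add: T(2) dual_star_cone[OF T(1)] inner_sum_right)
    then show ?thesis
      using m(1) by (auto simp: T(2) dual_star_cone[OF T(1)] integral_points_def)
  qed
  ultimately show "\<exists>v\<in>\<sigma>. v \<in> integral_points \<and> (\<forall>m\<in>dual_semigroup \<sigma>. m \<bullet> v = 0 \<longrightarrow> - m \<in> dual_semigroup \<sigma>)"
    by blast
next
  fix \<sigma> \<tau> \<rho> assume "\<sigma> \<in> star_cone ` \<T>" "\<tau> \<in> star_cone ` \<T>" "\<rho> \<in> star_cone ` \<T>"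
  then obtain T1 T2 T3 where T: "T1 \<in> \<T>" "T2 \<in> \<T>" "T3 \<in> \<T>"
    "\<sigma> = star_cone T1" "\<tau> = star_cone T2" "\<rho> = star_cone T3" by auto
  have T': "T1 \<inter> T2 \<in> \<T>" "T2 \<inter> T3 \<in> \<T>" "T1 \<inter> T2 \<inter> T3 \<in> \<T>" using T star_Int by auto
  have Int: "\<sigma> \<inter> \<tau> = star_cone (T1 \<inter> T2)" "\<tau> \<inter> \<rho> = star_cone (T2 \<inter> T3)" "\<sigma> \<inter> \<tau> \<inter> \<rho> = star_cone (T1 \<inter> T2 \<inter> T3)"
    using T T' by (simp_all add: star_cone_Int)
  obtain m where m: "m \<in> integral_points" "\<And>b. b \<in> T2 - T3 \<Longrightarrow> m \<bullet> b > 0" "\<And>b. b \<in> T2 \<inter> T3 \<Longrightarrow> m \<bullet> b = 0"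
    using integral_separating_vector[OF indep[OF T(2)] integral[OF T(2)], of "T2 - T3"]
    by (metis (no_types, lifting) Diff_Diff_Int Diff_subset)
  have mB0: "\<forall>b\<in>B0. m \<bullet> b = 0" using m(3) star T by blast
  have "m \<bullet> b \<ge> 0" if "b \<in> T2" for b using m(2,3)[of b] that by (cases "b \<in> T3") auto
  then have "m \<in> dual_semigroup \<tau>"
    unfolding T(5) dual_star_cone[OF T(2)] using m(1) mB0 by auto
  moreover have "- m \<in> dual_semigroup (\<tau> \<inter> \<rho>)"
    unfolding Int(2) dual_star_cone[OF T'(2)] using m mB0 by (auto simp: integral_points_def)
  moreover have "\<exists>k. s + real k *\<^sub>R m \<in> dual_semigroup (\<sigma> \<inter> \<tau>)" if s: "s \<in> dual_semigroup (\<sigma> \<inter> \<tau> \<inter> \<rho>)" for s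
  proof -
    have s': "s \<in> integral_points" "\<forall>b\<in>T1 \<inter> T2 \<inter> T3. s \<bullet> b \<ge> 0" "\<forall>b\<in>B0. s \<bullet> b = 0"
      using s unfolding Int(3) dual_star_cone[OF T'(3)] by auto
    define R where "R = (\<Sum>b\<in>T1 \<inter> T2 - T3. \<bar>s \<bullet> b / (m \<bullet> b)\<bar>)"
    obtain k :: nat where k: "real k \<ge> R" using real_arch_simple by blast
    have "(s + real k *\<^sub>R m) \<bullet> b \<ge> 0" if b: "b \<in> T1 \<inter> T2" for b
    proof (cases "b \<in> T3")
      case True
      then show ?thesis using s'(2) m(3)[of b] b by (simp add: inner_add_left)
    next
      case False
      then have pos: "m \<bullet> b > 0" using m(2) b by simp
      have "\<bar>s \<bullet> b / (m \<bullet> b)\<bar> \<le> R"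
        unfolding R_def using False b finite_T[OF T(1)] by (intro member_le_sum) auto
      then have "- (s \<bullet> b / (m \<bullet> b)) \<le> real k" using k by linarith
      then show ?thesis using pos by (simp add: inner_add_left field_simps)
    qed
    moreover have "s + real k *\<^sub>R m \<in> integral_points"
      using s'(1) m(1) by (simp add: integral_points_closed)
    ultimately have "s + real k *\<^sub>R m \<in> dual_semigroup (\<sigma> \<inter> \<tau>)"
      unfolding Int(1) dual_star_cone[OF T'(1)] using s'(3) mB0 by (auto simp: inner_add_left)
    then show ?thesis ..
  qed
  ultimately show "\<exists>m\<in>dual_semigroup \<tau>. - m \<in> dual_semigroup (\<tau> \<inter> \<rho>) \<and>
      (\<forall>s\<in>dual_semigroup (\<sigma> \<inter> \<tau> \<inter> \<rho>). \<exists>k. s + real k *\<^sub>R m \<in> dual_semigroup (\<sigma> \<inter> \<tau>))"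
    by blast
qed

end

section \<open>Complex vector spaces, quotients and direct sums\<close>

lemma complex_field_simps [simp]:
  "carrier complex_field = UNIV" "monoid.mult complex_field = (*)" "add complex_field = (+)"
  "one complex_field = 1" "zero complex_field = 0"
  by (simp_all add: ring_of_type_algebra_def)

locale complex_vector_space = module complex_field V for V :: "(complex, 'v) module" (structure)
begin

lemma scale_closed [simp, intro]: "x \<in> carrier V \<Longrightarrow> a \<odot> x \<in> carrier V"
  using smult_closed[of a x] by simp

lemma scale_add_left: "x \<in> carrier V \<Longrightarrow> (a + b) \<odot> x = a \<odot> x \<oplus> b \<odot> x"
  using smult_l_distr[of a b x] by simp

lemma scale_add_right: "x \<in> carrier V \<Longrightarrow> y \<in> carrier V \<Longrightarrow> a \<odot> (x \<oplus> y) = a \<odot> x \<oplus> a \<odot> y"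
  using smult_r_distr[of a x y] by simp

lemma scale_scale: "x \<in> carrier V \<Longrightarrow> a \<odot> (b \<odot> x) = (a * b) \<odot> x"
  using smult_assoc1[of a b x] by simp

lemma scale_1 [simp]: "x \<in> carrier V \<Longrightarrow> 1 \<odot> x = x"
  using smult_one[of x] by simp

lemma scale_0 [simp]: "x \<in> carrier V \<Longrightarrow> 0 \<odot> x = \<zero>" "a \<odot> \<zero> = \<zero>"
  using smult_l_null[of x] smult_r_null[of a] by simp_all

lemma scale_minus_1: "x \<in> carrier V \<Longrightarrow> (- 1) \<odot> x = \<ominus> x"
proof -
  assume x: "x \<in> carrier V"
  have "(- 1) \<odot> x \<oplus> x = ((- 1) + 1) \<odot> x" using x by (simp only: scale_add_left scale_1)
  then have "(- 1) \<odot> x \<oplus> x = \<zero>" using x by simp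
  then show ?thesis using x by (simp add: minus_equality)
qed

lemma add_scale_minus_1 [simp]: "x \<in> carrier V \<Longrightarrow> x \<oplus> (- 1) \<odot> x = \<zero>"
  by (simp add: scale_minus_1 M.r_neg)

lemma submodule_iff:
  "submodule N complex_field V \<longleftrightarrow> N \<subseteq> carrier V \<and> \<zero> \<in> N \<and> (\<forall>x\<in>N. \<forall>y\<in>N. x \<oplus> y \<in> N) \<and> (\<forall>a. \<forall>x\<in>N. a \<odot> x \<in> N)"
proof
  assume N: "submodule N complex_field V"
  have "\<zero> \<in> N"
    using submodule.axioms(1)[OF N] subgroup.one_closed[of N "add_monoid V"] by simp
  then show "N \<subseteq> carrier V \<and> \<zero> \<in> N \<and> (\<forall>x\<in>N. \<forall>y\<in>N. x \<oplus> y \<in> N) \<and> (\<forall>a. \<forall>x\<in>N. a \<odot> x \<in> N)"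
    using submoduleE[OF N] by auto
next
  assume N: "N \<subseteq> carrier V \<and> \<zero> \<in> N \<and> (\<forall>x\<in>N. \<forall>y\<in>N. x \<oplus> y \<in> N) \<and> (\<forall>a. \<forall>x\<in>N. a \<odot> x \<in> N)"
  show "submodule N complex_field V"
  proof (rule submoduleI)
    show "\<ominus> x \<in> N" if "x \<in> N" for x
      using N that scale_minus_1[of x] by (metis subsetD)
  qed (use N in auto)
qed

lemmas space_laws = scale_closed scale_add_left scale_add_right scale_scale scale_1 scale_0
  M.add.m_closed M.zero_closed M.a_assoc M.a_comm M.l_zero M.r_zero

end

lemma complex_vector_spaceI:
  fixes V :: "(complex, 'v) module" (structure)
  assumes "\<And>x y. x \<in> carrier V \<Longrightarrow> y \<in> carrier V \<Longrightarrow> x \<oplus> y \<in> carrier V" "\<zero> \<in> carrier V"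
    and "\<And>x y z. x \<in> carrier V \<Longrightarrow> y \<in> carrier V \<Longrightarrow> z \<in> carrier V \<Longrightarrow> (x \<oplus> y) \<oplus> z = x \<oplus> (y \<oplus> z)"
    and "\<And>x y. x \<in> carrier V \<Longrightarrow> y \<in> carrier V \<Longrightarrow> x \<oplus> y = y \<oplus> x"
    and "\<And>x. x \<in> carrier V \<Longrightarrow> \<zero> \<oplus> x = x"
    and "\<And>a x. x \<in> carrier V \<Longrightarrow> a \<odot> x \<in> carrier V"
    and l: "\<And>a b x. x \<in> carrier V \<Longrightarrow> (a + b) \<odot> x = a \<odot> x \<oplus> b \<odot> x"
    and "\<And>a x y. x \<in> carrier V \<Longrightarrow> y \<in> carrier V \<Longrightarrow> a \<odot> (x \<oplus> y) = a \<odot> x \<oplus> a \<odot> y"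
    and "\<And>a b x. x \<in> carrier V \<Longrightarrow> (a * b) \<odot> x = a \<odot> (b \<odot> x)"
    and one: "\<And>x. x \<in> carrier V \<Longrightarrow> 1 \<odot> x = x"
    and zero: "\<And>x. x \<in> carrier V \<Longrightarrow> 0 \<odot> x = \<zero>"
  shows "complex_vector_space V"
  unfolding complex_vector_space_def
proof (rule moduleI)
  show "cring complex_field" by (rule cring_from_type_algebra)
  show "abelian_group V"
  proof (rule abelian_groupI)
    show "\<exists>y\<in>carrier V. y \<oplus> x = \<zero>" if x: "x \<in> carrier V" for x
    proof
      show "(- 1) \<odot> x \<oplus> x = \<zero>"
        using l[OF x, of "- 1" 1] one[OF x] zero[OF x] by simp
    qed (use assms x in auto)
  qed (use assms in auto)
qed (use assms in auto)

context complex_vector_space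
begin

lemma submodule_space:
  assumes "submodule N complex_field V"
  shows "complex_vector_space (V\<lparr>carrier := N\<rparr>)"
  unfolding complex_vector_space_def
  by (rule submodule.submodule_is_module[OF assms module_axioms])

lemma coset_eq_iff:
  assumes N: "submodule N complex_field V" and "x \<in> carrier V" "y \<in> carrier V"
  shows "N +> x = N +> y \<longleftrightarrow> x \<oplus> (- 1) \<odot> y \<in> N"
proof -
  have sub: "subgroup N (add_monoid V)" "N \<subseteq> carrier V"
    using submodule.axioms(1)[OF N] N by (simp_all add: submodule_iff)
  have car: "x \<oplus> \<ominus> y \<in> carrier V" using assms by simp
  have "N +> x = N +> y \<longleftrightarrow> N +> (x \<oplus> \<ominus> y) = N"
    using a_coset_add_inv1[OF _ assms(2,3) sub(2)] a_coset_add_inv2[OF _ assms(2,3) sub(2)] by (rule iffI[rotated])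
  also have "\<dots> \<longleftrightarrow> x \<oplus> \<ominus> y \<in> N"
    using a_coset_join1[OF _ car sub(1)] a_coset_join2[OF car sub(1)] by (rule iffI)
  finally show ?thesis using assms by (simp add: scale_minus_1)
qed

lemma coset_add:
  assumes N: "submodule N complex_field V" and "x \<in> carrier V" "y \<in> carrier V"
  shows "(N +> x) <+>\<^bsub>V\<^esub> (N +> y) = N +> (x \<oplus> y)"
proof -
  interpret abelian_subgroup N V
    using N by (intro abelian_subgroupI3 additive_subgroupI submodule.axioms(1) M.abelian_group_axioms)
  show ?thesis by (rule a_rcos_sum[OF assms(2,3)])
qed

lemma coset_scale:
  assumes N: "submodule N complex_field V" and x: "x \<in> carrier V"
  shows "N <+>\<^bsub>V\<^esub> ((\<lambda>y. a \<odot> y) ` (N +> x)) = N +> (a \<odot> x)"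
proof -
  have Ns: "N \<subseteq> carrier V" "\<zero> \<in> N" "\<forall>y\<in>N. \<forall>z\<in>N. y \<oplus> z \<in> N" "\<forall>b. \<forall>y\<in>N. b \<odot> y \<in> N"
    using N unfolding submodule_iff by auto
  show ?thesis
  proof (intro equalityI subsetI)
    fix z assume "z \<in> N <+>\<^bsub>V\<^esub> ((\<lambda>y. a \<odot> y) ` (N +> x))"
    then obtain h k where hk: "h \<in> N" "k \<in> N" "z = h \<oplus> a \<odot> (k \<oplus> x)"
      by (auto simp: set_add_def' a_r_coset_def')
    then have "z = (h \<oplus> a \<odot> k) \<oplus> a \<odot> x"
      using Ns x by (simp add: scale_add_right M.a_assoc subset_iff)
    then show "z \<in> N +> (a \<odot> x)" using hk Ns by (auto simp: a_r_coset_def')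
  next
    fix z assume "z \<in> N +> (a \<odot> x)"
    then obtain h where h: "h \<in> N" "z = h \<oplus> a \<odot> x" by (auto simp: a_r_coset_def')
    moreover have "x \<in> N +> x" using Ns x by (force simp: a_r_coset_def')
    ultimately show "z \<in> N <+>\<^bsub>V\<^esub> ((\<lambda>y. a \<odot> y) ` (N +> x))" by (auto simp: set_add_def')
  qed
qed

lemma quotient_module_simps:
  assumes N: "submodule N complex_field V"
  shows "carrier (quotient_module V N) = (\<lambda>x. N +> x) ` carrier V"
    and "zero (quotient_module V N) = N +> \<zero>"
    and "x \<in> carrier V \<Longrightarrow> y \<in> carrier V \<Longrightarrow> add (quotient_module V N) (N +> x) (N +> y) = N +> (x \<oplus> y)"
    and "x \<in> carrier V \<Longrightarrow> module.smult (quotient_module V N) a (N +> x) = N +> (a \<odot> x)"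
proof -
  show "carrier (quotient_module V N) = (\<lambda>x. N +> x) ` carrier V"
    by (auto simp: quotient_module_def A_RCOSETS_def')
  have "N \<subseteq> carrier V" using N by (simp add: submodule_iff)
  then show "zero (quotient_module V N) = N +> \<zero>"
    by (simp add: quotient_module_def)
qed (simp_all add: quotient_module_def coset_add[OF N] coset_scale[OF N])

lemma quotient_space:
  assumes N: "submodule N complex_field V"
  shows "complex_vector_space (quotient_module V N)"
  by (rule complex_vector_spaceI)
    (auto simp: quotient_module_simps[OF N] M.a_assoc scale_add_left scale_add_right scale_scale,
      simp_all add: M.a_comm)

text \<open>Spanning is expressed through the submodules that contain the spanning set, which behaves better under
  images and induction than linear combinations do.\<close>

definition finitely_spanned :: "'v set \<Rightarrow> bool" where
  "finitely_spanned U \<longleftrightarrow> (\<exists>B. finite B \<and> B \<subseteq> U \<and> (\<forall>N. submodule N complex_field V \<and> B \<subseteq> N \<longrightarrow> U \<subseteq> N))"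

lemma finite_dimensional_iff: "finite_dimensional V \<longleftrightarrow> finitely_spanned (carrier V)"
proof
  assume "finite_dimensional V"
  then obtain B where B: "finite B" "B \<subseteq> carrier V"
    and span: "\<forall>v\<in>carrier V. \<exists>a. v = (\<Oplus>b\<in>B. a b \<odot> b)"
    unfolding finite_dimensional_def by blast
  have "carrier V \<subseteq> N" if N: "submodule N complex_field V" and "B \<subseteq> N" for N
  proof
    fix v assume "v \<in> carrier V"
    then obtain a where v: "v = (\<Oplus>b\<in>B. a b \<odot> b)" using span by blast
    have "C \<subseteq> B \<Longrightarrow> (\<Oplus>b\<in>C. a b \<odot> b) \<in> N" if "finite C" for C
      using that
    proof induction
      case empty
      then show ?case using N by (simp add: submodule_iff)
    next
      case (insert c C)
      have "(\<Oplus>b\<in>insert c C. a b \<odot> b) = a c \<odot> c \<oplus> (\<Oplus>b\<in>C. a b \<odot> b)"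
        using insert B by (intro M.finsum_insert) auto
      then show ?case using insert N \<open>B \<subseteq> N\<close> by (auto simp: submodule_iff)
    qed
    then show "v \<in> N" using B v by blast
  qed
  then show "finitely_spanned (carrier V)" unfolding finitely_spanned_def using B by blast
next
  assume "finitely_spanned (carrier V)"
  then obtain B where B: "finite B" "B \<subseteq> carrier V"
    and span: "\<forall>N. submodule N complex_field V \<and> B \<subseteq> N \<longrightarrow> carrier V \<subseteq> N"
    unfolding finitely_spanned_def by (elim exE conjE)
  define N where "N = range (\<lambda>a. \<Oplus>b\<in>B. a b \<odot> b)"
  have terms: "(\<lambda>b. a b \<odot> b) \<in> B \<rightarrow> carrier V" for a using B by auto
  have "submodule N complex_field V"
    unfolding submodule_iff
  proof (intro conjI ballI allI)
    show "N \<subseteq> carrier V" using terms by (auto simp: N_def intro!: M.finsum_closed)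
    have "(\<Oplus>b\<in>B. 0 \<odot> b) = \<zero>"
    proof -
      have "(\<Oplus>b\<in>B. 0 \<odot> b) = (\<Oplus>b\<in>B. \<zero>)" using B by (intro M.finsum_cong') auto
      then show ?thesis by (simp add: M.finsum_zero)
    qed
    then show "\<zero> \<in> N" unfolding N_def by (intro range_eqI[of _ _ "\<lambda>_. 0"]) simp
    show "x \<oplus> y \<in> N" if xy: "x \<in> N" "y \<in> N" for x y
    proof -
      obtain a b where ab: "x = (\<Oplus>v\<in>B. a v \<odot> v)" "y = (\<Oplus>v\<in>B. b v \<odot> v)"
        using xy by (auto simp: N_def)
      have "x \<oplus> y = (\<Oplus>v\<in>B. a v \<odot> v \<oplus> b v \<odot> v)"
        unfolding ab by (rule M.finsum_addf[symmetric]) (use terms in auto)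
      also have "\<dots> = (\<Oplus>v\<in>B. (a v + b v) \<odot> v)"
        using B by (intro M.finsum_cong') (auto simp: scale_add_left)
      finally show ?thesis unfolding N_def by (intro range_eqI[of _ _ "\<lambda>v. a v + b v"])
    qed
    show "c \<odot> x \<in> N" if x: "x \<in> N" for c x
    proof -
      obtain a where a: "x = (\<Oplus>v\<in>B. a v \<odot> v)" using x by (auto simp: N_def)
      have "c \<odot> x = (\<Oplus>v\<in>B. c \<odot> (a v \<odot> v))"
        unfolding a using finsum_smult_ldistr[OF B(1) _ terms[of a]] by simp
      also have "\<dots> = (\<Oplus>v\<in>B. (c * a v) \<odot> v)"
        using B by (intro M.finsum_cong') (auto simp: scale_scale)
      finally show ?thesis unfolding N_def by (intro range_eqI[of _ _ "\<lambda>v. c * a v"])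
    qed
  qed
  moreover have "B \<subseteq> N"
  proof
    fix b assume b: "b \<in> B"
    have "(\<Oplus>v\<in>B. (if v = b then 1 else 0) \<odot> v) = (\<Oplus>v\<in>B. if b = v then v else \<zero>)"
      using B by (intro M.finsum_cong') auto
    also have "\<dots> = b"
      using M.finsum_singleton[OF b B(1), of "\<lambda>v. v"] B by auto
    finally show "b \<in> N" unfolding N_def by (intro range_eqI[of _ _ "\<lambda>v. if v = b then 1 else 0"]) simp
  qed
  ultimately have "carrier V \<subseteq> N" using span by simp
  then show "finite_dimensional V"
    unfolding finite_dimensional_def using B by (intro exI[of _ B]) (auto simp: N_def)
qed

lemma finite_dimensional_quotient:
  assumes N: "submodule N complex_field V" and fin: "finite_dimensional V"
  shows "finite_dimensional (quotient_module V N)"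
proof -
  interpret Q: complex_vector_space "quotient_module V N" by (rule quotient_space[OF N])
  obtain B where B: "finite B" "B \<subseteq> carrier V"
    and span: "\<forall>K. submodule K complex_field V \<and> B \<subseteq> K \<longrightarrow> carrier V \<subseteq> K"
    using fin unfolding finite_dimensional_iff finitely_spanned_def by (elim exE conjE)
  have "carrier (quotient_module V N) \<subseteq> K"
    if K: "submodule K complex_field (quotient_module V N)" and BK: "(\<lambda>x. N +> x) ` B \<subseteq> K" for K
  proof -
    let ?K = "{x \<in> carrier V. N +> x \<in> K}"
    have K0: "N +> \<zero> \<in> K" and Kadd: "\<forall>A\<in>K. \<forall>A'\<in>K. add (quotient_module V N) A A' \<in> K"
      and Ksmult: "\<forall>a. \<forall>A\<in>K. module.smult (quotient_module V N) a A \<in> K"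
      using K unfolding Q.submodule_iff quotient_module_simps(2)[OF N] by auto
    have "submodule ?K complex_field V"
      unfolding submodule_iff
    proof (intro conjI ballI allI)
      show "x \<oplus> y \<in> ?K" if "x \<in> ?K" "y \<in> ?K" for x y
        using that Kadd quotient_module_simps(3)[OF N, of x y] by (metis (no_types, lifting) M.add.m_closed mem_Collect_eq)
      show "a \<odot> x \<in> ?K" if "x \<in> ?K" for a x
        using that Ksmult quotient_module_simps(4)[OF N, of x a] by (metis (no_types, lifting) scale_closed mem_Collect_eq)
    qed (use K0 in auto)
    moreover have "B \<subseteq> ?K" using B BK by auto
    ultimately have "carrier V \<subseteq> ?K" using span by simp
    then show ?thesis by (auto simp: quotient_module_simps[OF N])
  qed
  then show ?thesis
    unfolding Q.finite_dimensional_iff Q.finitely_spanned_def using B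
    by (intro exI[of _ "(\<lambda>x. N +> x) ` B"]) (auto simp: quotient_module_simps[OF N])
qed

end

definition linear_functional :: "(complex, 'v) module \<Rightarrow> ('v \<Rightarrow> complex) \<Rightarrow> bool" where
  "linear_functional V e \<longleftrightarrow>
     (\<forall>x\<in>carrier V. \<forall>y\<in>carrier V. e (x \<oplus>\<^bsub>V\<^esub> y) = e x + e y) \<and>
     (\<forall>a. \<forall>x\<in>carrier V. e (a \<odot>\<^bsub>V\<^esub> x) = a * e x)"

text \<open>A finiteness condition dual to having a finite spanning set. Unlike the latter it passes to
  subspaces without any argument, and it can be checked componentwise on direct sums.\<close>

definition finitely_separated :: "(complex, 'v) module \<Rightarrow> bool" where
  "finitely_separated V \<longleftrightarrow> (\<exists>E. finite E \<and> (\<forall>e\<in>E. linear_functional V e) \<and>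
     (\<forall>x\<in>carrier V. (\<forall>e\<in>E. e x = 0) \<longrightarrow> x = \<zero>\<^bsub>V\<^esub>))"

lemma finitely_separated_submodule:
  assumes "finitely_separated V" "N \<subseteq> carrier V"
  shows "finitely_separated (V\<lparr>carrier := N\<rparr>)"
proof -
  obtain E where "finite E" "\<forall>e\<in>E. linear_functional V e" "\<forall>x\<in>carrier V. (\<forall>e\<in>E. e x = 0) \<longrightarrow> x = \<zero>\<^bsub>V\<^esub>"
    using assms(1) unfolding finitely_separated_def by blast
  then show ?thesis
    unfolding finitely_separated_def using assms(2)
    by (intro exI[of _ E]) (auto simp: linear_functional_def subset_iff)
qed

text \<open>Induction on the number of functionals: the kernel of one of them is separated by the others, and a
  single vector outside the kernel spans the rest.\<close>

lemma (in complex_vector_space) finitely_separated_imp_finite_dimensional: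
  assumes "finitely_separated V"
  shows "finite_dimensional V"
proof -
  obtain E where E: "finite E" "\<forall>e\<in>E. linear_functional V e" "\<forall>x\<in>carrier V. (\<forall>e\<in>E. e x = 0) \<longrightarrow> x = \<zero>"
    using assms unfolding finitely_separated_def by blast
  have "finitely_spanned U"
    if "finite E" "\<forall>e\<in>E. linear_functional V e" "\<forall>x\<in>U. (\<forall>e\<in>E. e x = 0) \<longrightarrow> x = \<zero>"
      "submodule U complex_field V" for U
    using that
  proof (induction arbitrary: U)
    case empty
    then have "U \<subseteq> {\<zero>}" by auto
    then show ?case
      unfolding finitely_spanned_def by (intro exI[of _ "{}"]) (auto simp: submodule_iff)
  next
    case (insert e E)
    let ?U = "{x \<in> U. e x = 0}"
    have e: "e (x \<oplus> y) = e x + e y" "e (a \<odot> x) = a * e x" if "x \<in> carrier V" "y \<in> carrier V" for x y a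
      using insert.prems(1) that by (auto simp: linear_functional_def)
    have e0: "e \<zero> = 0" using e(2)[of \<zero> \<zero> 0] by simp
    have U: "U \<subseteq> carrier V" "\<zero> \<in> U" "\<And>x y. x \<in> U \<Longrightarrow> y \<in> U \<Longrightarrow> x \<oplus> y \<in> U" "\<And>a x. x \<in> U \<Longrightarrow> a \<odot> x \<in> U"
      using insert.prems(3) by (auto simp: submodule_iff)
    have "submodule ?U complex_field V"
      unfolding submodule_iff using U e e0 by (auto simp: subset_iff)
    then have "finitely_spanned ?U" using insert.prems by (intro insert.IH) auto
    then obtain B where B: "finite B" "B \<subseteq> ?U" and span: "\<forall>N. submodule N complex_field V \<and> B \<subseteq> N \<longrightarrow> ?U \<subseteq> N"
      unfolding finitely_spanned_def by (elim exE conjE)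
    show ?case
    proof (cases "?U = U")
      case True
      then show ?thesis using \<open>finitely_spanned ?U\<close> by simp
    next
      case False
      then obtain v where v: "v \<in> U" "e v \<noteq> 0" by auto
      have "U \<subseteq> N" if N: "submodule N complex_field V" "insert v B \<subseteq> N" for N
      proof
        fix x assume x: "x \<in> U"
        define a where "a = e x / e v"
        have xv: "x \<in> carrier V" "v \<in> carrier V" using x v U by auto
        have "x \<oplus> (- a) \<odot> v \<in> ?U"
          using U x v xv by (auto simp: e a_def)
        then have "x \<oplus> (- a) \<odot> v \<in> N" using span N by auto
        then have "(x \<oplus> (- a) \<odot> v) \<oplus> a \<odot> v \<in> N" using N by (auto simp: submodule_iff)
        moreover have "(x \<oplus> (- a) \<odot> v) \<oplus> a \<odot> v = x"
          using xv scale_add_left[of v "- a" a] by (simp add: M.a_assoc)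
        ultimately show "x \<in> N" by simp
      qed
      then show ?thesis
        unfolding finitely_spanned_def using B v by (intro exI[of _ "insert v B"]) auto
    qed
  qed
  from this[OF E carrier_is_submodule] show ?thesis by (simp add: finite_dimensional_iff)
qed

lemma direct_sum_space:
  assumes "\<And>i. i \<in> I \<Longrightarrow> complex_vector_space (M i)"
  shows "complex_vector_space (direct_sum_module I M)"
proof -
  let ?D = "direct_sum_module I M"
  note laws = complex_vector_space.space_laws[OF assms]
  have mem: "x \<in> carrier ?D \<longleftrightarrow> x \<in> (\<Pi>\<^sub>E i\<in>I. carrier (M i)) \<and> finite {i \<in> I. x i \<noteq> \<zero>\<^bsub>M i\<^esub>}" for x
    by (simp add: direct_sum_module_def)
  have ops: "\<zero>\<^bsub>?D\<^esub> = (\<lambda>i\<in>I. \<zero>\<^bsub>M i\<^esub>)" "x \<oplus>\<^bsub>?D\<^esub> y = (\<lambda>i\<in>I. x i \<oplus>\<^bsub>M i\<^esub> y i)"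
    "a \<odot>\<^bsub>?D\<^esub> x = (\<lambda>i\<in>I. a \<odot>\<^bsub>M i\<^esub> x i)" for x y a
    by (simp_all add: direct_sum_module_def)
  have eqI: "x = y" if "x \<in> extensional I" "y \<in> extensional I" "\<And>i. i \<in> I \<Longrightarrow> x i = y i" for x y
    using that by (rule extensionalityI)
  have car: "x i \<in> carrier (M i)" "x \<in> extensional I" if "x \<in> carrier ?D" "i \<in> I" for x i
    using that by (auto simp: mem PiE_def)
  show ?thesis
  proof (rule complex_vector_spaceI)
    show add: "x \<oplus>\<^bsub>?D\<^esub> y \<in> carrier ?D" if xy: "x \<in> carrier ?D" "y \<in> carrier ?D" for x y
    proof -
      have "{i \<in> I. x i \<oplus>\<^bsub>M i\<^esub> y i \<noteq> \<zero>\<^bsub>M i\<^esub>} \<subseteq> {i \<in> I. x i \<noteq> \<zero>\<^bsub>M i\<^esub>} \<union> {i \<in> I. y i \<noteq> \<zero>\<^bsub>M i\<^esub>}"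
        by (auto simp: laws)
      moreover have "finite ({i \<in> I. x i \<noteq> \<zero>\<^bsub>M i\<^esub>} \<union> {i \<in> I. y i \<noteq> \<zero>\<^bsub>M i\<^esub>})" using xy by (simp add: mem)
      ultimately have "finite {i \<in> I. x i \<oplus>\<^bsub>M i\<^esub> y i \<noteq> \<zero>\<^bsub>M i\<^esub>}" by (rule finite_subset)
      then show ?thesis
        using car[OF xy(1)] car[OF xy(2)] by (auto simp: mem ops laws cong: conj_cong)
    qed
    show "a \<odot>\<^bsub>?D\<^esub> x \<in> carrier ?D" if x: "x \<in> carrier ?D" for a x
    proof -
      have "{i \<in> I. a \<odot>\<^bsub>M i\<^esub> x i \<noteq> \<zero>\<^bsub>M i\<^esub>} \<subseteq> {i \<in> I. x i \<noteq> \<zero>\<^bsub>M i\<^esub>}"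
        by (auto simp: laws)
      moreover have "finite {i \<in> I. x i \<noteq> \<zero>\<^bsub>M i\<^esub>}" using x by (simp add: mem)
      ultimately have "finite {i \<in> I. a \<odot>\<^bsub>M i\<^esub> x i \<noteq> \<zero>\<^bsub>M i\<^esub>}" by (rule finite_subset)
      then show ?thesis
        using car[OF x] by (auto simp: mem ops laws cong: conj_cong)
    qed
    show "\<zero>\<^bsub>?D\<^esub> \<in> carrier ?D" by (auto simp: mem ops laws cong: conj_cong)
    show "\<zero>\<^bsub>?D\<^esub> \<oplus>\<^bsub>?D\<^esub> x = x" "1 \<odot>\<^bsub>?D\<^esub> x = x" "0 \<odot>\<^bsub>?D\<^esub> x = \<zero>\<^bsub>?D\<^esub>" if x: "x \<in> carrier ?D" for x
    proof -
      have "x \<in> extensional I" using x by (auto simp: mem PiE_def)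
      then show "\<zero>\<^bsub>?D\<^esub> \<oplus>\<^bsub>?D\<^esub> x = x" "1 \<odot>\<^bsub>?D\<^esub> x = x"
        by (auto intro!: eqI simp: ops laws car[OF x])
      show "0 \<odot>\<^bsub>?D\<^esub> x = \<zero>\<^bsub>?D\<^esub>" by (rule eqI) (auto simp: ops laws car[OF x])
    qed
    fix x y z assume x: "x \<in> carrier ?D" and y: "y \<in> carrier ?D"
    show "x \<oplus>\<^bsub>?D\<^esub> y = y \<oplus>\<^bsub>?D\<^esub> x"
      by (rule eqI) (use car[OF x] car[OF y] laws(11) in \<open>auto simp: ops\<close>)
    show "a \<odot>\<^bsub>?D\<^esub> (x \<oplus>\<^bsub>?D\<^esub> y) = a \<odot>\<^bsub>?D\<^esub> x \<oplus>\<^bsub>?D\<^esub> a \<odot>\<^bsub>?D\<^esub> y" for a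
      by (rule eqI) (use car[OF x] car[OF y] laws in \<open>auto simp: ops\<close>)
    show "(x \<oplus>\<^bsub>?D\<^esub> y) \<oplus>\<^bsub>?D\<^esub> z = x \<oplus>\<^bsub>?D\<^esub> (y \<oplus>\<^bsub>?D\<^esub> z)" if z: "z \<in> carrier ?D"
      by (rule eqI) (use car[OF x] car[OF y] car[OF z] laws(10) in \<open>auto simp: ops\<close>)
  next
    fix x a b assume x: "x \<in> carrier ?D"
    show "(a + b) \<odot>\<^bsub>?D\<^esub> x = a \<odot>\<^bsub>?D\<^esub> x \<oplus>\<^bsub>?D\<^esub> b \<odot>\<^bsub>?D\<^esub> x"
      by (rule eqI) (use car[OF x] laws in \<open>auto simp: ops\<close>)
    show "(a * b) \<odot>\<^bsub>?D\<^esub> x = a \<odot>\<^bsub>?D\<^esub> (b \<odot>\<^bsub>?D\<^esub> x)"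
      by (rule eqI) (use car[OF x] laws in \<open>auto simp: ops\<close>)
  qed
qed

text \<open>Functionals on the finitely many nonzero summands, composed with the projections, separate the sum.\<close>

lemma finitely_separated_direct_sum:
  assumes sp: "\<And>i. i \<in> I \<Longrightarrow> complex_vector_space (M i)"
    and fin: "\<And>i. i \<in> I \<Longrightarrow> finitely_separated (M i)"
    and K: "finite K" "\<And>i. i \<in> I - K \<Longrightarrow> carrier (M i) = {\<zero>\<^bsub>M i\<^esub>}"
  shows "finitely_separated (direct_sum_module I M)"
proof -
  let ?D = "direct_sum_module I M"
  have "\<forall>i\<in>I. \<exists>E. finite E \<and> (\<forall>e\<in>E. linear_functional (M i) e) \<and>
      (\<forall>x\<in>carrier (M i). (\<forall>e\<in>E. e x = 0) \<longrightarrow> x = \<zero>\<^bsub>M i\<^esub>)"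
    using fin unfolding finitely_separated_def by blast
  then obtain E where E: "\<And>i. i \<in> I \<Longrightarrow> finite (E i)" "\<And>i e. i \<in> I \<Longrightarrow> e \<in> E i \<Longrightarrow> linear_functional (M i) e"
    "\<And>i x. i \<in> I \<Longrightarrow> x \<in> carrier (M i) \<Longrightarrow> (\<forall>e\<in>E i. e x = 0) \<Longrightarrow> x = \<zero>\<^bsub>M i\<^esub>"
    by (metis bchoice)
  let ?E = "\<Union>i\<in>I \<inter> K. (\<lambda>e x. e (x i)) ` E i"
  have car: "x i \<in> carrier (M i)" if "x \<in> carrier ?D" "i \<in> I" for x i
    using that by (auto simp: direct_sum_module_def)
  have "linear_functional ?D (\<lambda>x. e (x i))" if "i \<in> I" "e \<in> E i" for i e
    using E(2)[OF that] that(1) car unfolding linear_functional_def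
    by (auto simp: direct_sum_module_def)
  moreover have "x = \<zero>\<^bsub>?D\<^esub>" if x: "x \<in> carrier ?D" and zero: "\<forall>e\<in>?E. e x = 0" for x
  proof -
    have "x i = \<zero>\<^bsub>M i\<^esub>" if i: "i \<in> I" for i
    proof (cases "i \<in> K")
      case True
      then show ?thesis using zero i by (intro E(3)[OF i car[OF x i]]) auto
    next
      case False
      then show ?thesis using K(2) car[OF x i] i by blast
    qed
    then show ?thesis using x by (auto simp: direct_sum_module_def PiE_def extensional_def fun_eq_iff)
  qed
  moreover have "finite ?E" using K E(1) by auto
  ultimately show ?thesis unfolding finitely_separated_def by (intro exI[of _ ?E]) auto
qed

section \<open>Singular cohomology with complex coefficients\<close>

text \<open>Partial homomorphisms from the group of chains to the complex numbers, encoded as graphs so that the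
  order by extension is inclusion.\<close>

definition hom_graph :: "(('b \<Rightarrow>\<^sub>0 int) \<times> complex) set \<Rightarrow> bool" where
  "hom_graph G \<longleftrightarrow> (0, 0) \<in> G \<and>
     (\<forall>a x b y. (a, x) \<in> G \<longrightarrow> (b, y) \<in> G \<longrightarrow> (a - b, x - y) \<in> G) \<and> (\<forall>x. (0, x) \<in> G \<longrightarrow> x = 0)"

lemma hom_graphD:
  assumes "hom_graph G"
  shows "(0, 0) \<in> G" "(a, x) \<in> G \<Longrightarrow> (b, y) \<in> G \<Longrightarrow> (a - b, x - y) \<in> G" "(0, x) \<in> G \<Longrightarrow> x = 0"
    "(a, x) \<in> G \<Longrightarrow> (b, y) \<in> G \<Longrightarrow> (a + b, x + y) \<in> G"
    "(a, x) \<in> G \<Longrightarrow> (a, y) \<in> G \<Longrightarrow> x = y"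
    "(a, x) \<in> G \<Longrightarrow> (frag_cmul n a, of_int n * x) \<in> G"
proof -
  show 0: "(0, 0) \<in> G" and z: "(0, x) \<in> G \<Longrightarrow> x = 0" for x using assms by (auto simp: hom_graph_def)
  show diff: "(a, x) \<in> G \<Longrightarrow> (b, y) \<in> G \<Longrightarrow> (a - b, x - y) \<in> G" for a b x y
    using assms by (auto simp: hom_graph_def)
  have neg: "(b, y) \<in> G \<Longrightarrow> (- b, - y) \<in> G" for b y using diff[OF 0] by fastforce
  show add: "(a, x) \<in> G \<Longrightarrow> (b, y) \<in> G \<Longrightarrow> (a + b, x + y) \<in> G" for a b x y
    using diff[OF _ neg] by fastforce
  show "(a, x) \<in> G \<Longrightarrow> (a, y) \<in> G \<Longrightarrow> x = y" using diff[of a x a y] z[of "x - y"] by simp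
  show "(frag_cmul n a, of_int n * x) \<in> G" if "(a, x) \<in> G"
  proof (induction n rule: int_induct[where k = 0])
    case (step1 i)
    then show ?case using add[OF _ that] by (fastforce simp: frag_cmul_distrib algebra_simps)
  next
    case (step2 i)
    have "frag_cmul (i - 1) a = frag_cmul i a - a" "of_int (i - 1) * x = of_int i * x - x"
      by (simp_all add: frag_cmul_diff_distrib algebra_simps)
    then show ?case using diff[OF step2(2) that] by (simp only:)
  qed (simp add: 0)
qed

text \<open>The additive group of complex numbers is divisible, hence injective. A maximal partial homomorphism
  given by Zorn's lemma is total, since it can be extended to one further chain \<open>a\<close>: if some nonzero
  multiple \<open>n a\<close> has the value \<open>y\<close>, then \<open>a\<close> has to be given the value \<open>y / n\<close>, and otherwise any value
  will do.\<close>

lemma hom_extension_complex: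
  fixes G :: "(('b \<Rightarrow>\<^sub>0 int) \<times> complex) set"
  assumes G: "hom_graph G"
  obtains \<Psi> where "\<And>a b. \<Psi> (a - b) = \<Psi> a - \<Psi> b" "\<And>a x. (a, x) \<in> G \<Longrightarrow> \<Psi> a = x"
proof -
  let ?A = "{H. hom_graph H \<and> G \<subseteq> H}"
  have "\<exists>M\<in>?A. \<forall>H\<in>?A. M \<subseteq> H \<longrightarrow> H = M"
  proof (rule subset_Zorn_nonempty)
    show "?A \<noteq> {}" using G by auto
    fix \<C> assume ne: "\<C> \<noteq> {}" and ch: "subset.chain ?A \<C>"
    then have mem: "\<And>H. H \<in> \<C> \<Longrightarrow> hom_graph H \<and> G \<subseteq> H" by (auto simp: subset.chain_def)
    have "(a - b, x - y) \<in> \<Union>\<C>" if ax: "(a, x) \<in> \<Union>\<C>" and bY: "(b, y) \<in> \<Union>\<C>" for a b x y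
    proof -
      obtain H H' where H: "H \<in> \<C>" "(a, x) \<in> H" "H' \<in> \<C>" "(b, y) \<in> H'" using ax bY by blast
      then have "H \<subseteq> H' \<or> H' \<subseteq> H" using ch by (auto simp: subset_chain_def)
      then obtain K where K: "K \<in> \<C>" "(a, x) \<in> K" "(b, y) \<in> K" using H by blast
      have "(a - b, x - y) \<in> K" using mem[OF K(1)] hom_graphD(2) K(2,3) by blast
      then show ?thesis using K(1) by blast
    qed
    moreover have "(0, 0) \<in> \<Union>\<C>" using ne mem hom_graphD(1) by blast
    moreover have "x = 0" if "(0, x) \<in> \<Union>\<C>" for x using that mem hom_graphD(3) by blast
    ultimately have "hom_graph (\<Union>\<C>)" unfolding hom_graph_def by blast
    then show "\<Union>\<C> \<in> ?A" using ne mem by blast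
  qed
  then obtain M where M: "hom_graph M" "G \<subseteq> M" and max: "\<And>H. hom_graph H \<Longrightarrow> M \<subseteq> H \<Longrightarrow> H = M"
    by (smt (verit) mem_Collect_eq order_trans)
  note MD = hom_graphD[OF M(1)]
  have total: "\<exists>x. (a, x) \<in> M" for a
  proof -
    have "\<exists>z. \<forall>n y. (frag_cmul n a, y) \<in> M \<longrightarrow> y = of_int n * z"
    proof (cases "\<exists>n y. n \<noteq> 0 \<and> (frag_cmul n a, y) \<in> M")
      case True
      then obtain n y where ny: "n \<noteq> 0" "(frag_cmul n a, y) \<in> M" by blast
      have "y' = of_int n' * (y / of_int n)" if "(frag_cmul n' a, y') \<in> M" for n' y'
      proof -
        have "(frag_cmul (n * n') a, of_int n * y') \<in> M" "(frag_cmul (n * n') a, of_int n' * y) \<in> M"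
          using MD(6)[OF that, of n] MD(6)[OF ny(2), of n'] by (simp_all add: frag_cmul_cmul mult.commute)
        then have "of_int n * y' = of_int n' * y" by (rule MD(5))
        then show ?thesis using ny(1) by (simp add: field_simps)
      qed
      then show ?thesis by blast
    next
      case False
      then have "n = 0" if "(frag_cmul n a, y) \<in> M" for n y using that by blast
      then have "y = of_int n * 0" if "(frag_cmul n a, y) \<in> M" for n y using that MD(3) by fastforce
      then show ?thesis by blast
    qed
    then obtain z where z: "\<And>n y. (frag_cmul n a, y) \<in> M \<Longrightarrow> y = of_int n * z" by blast
    define M' where "M' = {(b + frag_cmul n a, y + of_int n * z) | b y n. (b, y) \<in> M}"
    have memI: "(b + frag_cmul n a, y + of_int n * z) \<in> M'" if "(b, y) \<in> M" for b y n
      using that by (auto simp: M'_def)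
    have MM': "M \<subseteq> M'"
    proof
      fix u assume "u \<in> M"
      then show "u \<in> M'" using memI[of "fst u" "snd u" 0] by simp
    qed
    have "hom_graph M'"
      unfolding hom_graph_def
    proof (intro conjI allI impI)
      show "(0, 0) \<in> M'" using MM' MD(1) by blast
      show "x = 0" if "(0, x) \<in> M'" for x
      proof -
        obtain b y n where b: "0 = b + frag_cmul n a" "x = y + of_int n * z" "(b, y) \<in> M"
          using \<open>(0, x) \<in> M'\<close> by (auto simp: M'_def)
        have "frag_cmul (- n) a + frag_cmul n a = 0" by (simp flip: frag_cmul_distrib)
        then have "b = frag_cmul (- n) a" using b(1) by (metis add_right_cancel)
        then show ?thesis using z[of "- n" y] b by simp
      qed
      fix p x q y assume "(p, x) \<in> M'" "(q, y) \<in> M'"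
      then obtain b u n b' u' n' where *: "p = b + frag_cmul n a" "x = u + of_int n * z" "(b, u) \<in> M"
        "q = b' + frag_cmul n' a" "y = u' + of_int n' * z" "(b', u') \<in> M" by (auto simp: M'_def)
      have "p - q = (b - b') + frag_cmul (n - n') a" "x - y = (u - u') + of_int (n - n') * z"
        by (simp_all add: * frag_cmul_diff_distrib algebra_simps)
      then show "(p - q, x - y) \<in> M'" using memI[OF MD(2)[OF *(3,6)], of "n - n'"] by (simp only:)
    qed
    then have "M' = M" using max MM' by blast
    then show ?thesis using memI[OF MD(1), of 1] by auto
  qed
  define \<Psi> where "\<Psi> a = (THE x. (a, x) \<in> M)" for a
  have \<Psi>: "(a, x) \<in> M \<Longrightarrow> \<Psi> a = x" for a x
    unfolding \<Psi>_def using MD(5) by blast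
  have \<Psi>M: "(a, \<Psi> a) \<in> M" for a using total \<Psi> by metis
  show ?thesis
  proof
    show "\<Psi> (a - b) = \<Psi> a - \<Psi> b" for a b using \<Psi>[OF MD(2)[OF \<Psi>M \<Psi>M]] .
    show "\<Psi> a = x" if "(a, x) \<in> G" for a x using \<Psi> M(2) that by blast
  qed
qed

text \<open>The pairing of cochains with integral chains.\<close>

definition chain_eval :: "'a cochain \<Rightarrow> 'a chain \<Rightarrow> complex" where
  "chain_eval \<phi> z = (\<Sum>s\<in>Poly_Mapping.keys z. of_int (Poly_Mapping.lookup z s) * \<phi> s)"

lemma chain_eval_superset:
  assumes "finite S" "Poly_Mapping.keys z \<subseteq> S"
  shows "chain_eval \<phi> z = (\<Sum>s\<in>S. of_int (Poly_Mapping.lookup z s) * \<phi> s)"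
  unfolding chain_eval_def using assms by (intro sum.mono_neutral_left) (auto simp: in_keys_iff)

lemma chain_eval_add: "chain_eval \<phi> (a + b) = chain_eval \<phi> a + chain_eval \<phi> b"
proof -
  let ?S = "Poly_Mapping.keys a \<union> Poly_Mapping.keys b"
  have "chain_eval \<phi> (a + b) = (\<Sum>s\<in>?S. of_int (Poly_Mapping.lookup (a + b) s) * \<phi> s)"
    by (rule chain_eval_superset) (auto simp: Poly_Mapping.keys_add)
  also have "\<dots> = (\<Sum>s\<in>?S. of_int (Poly_Mapping.lookup a s) * \<phi> s) + (\<Sum>s\<in>?S. of_int (Poly_Mapping.lookup b s) * \<phi> s)"
    by (simp add: lookup_add distrib_right sum.distrib)
  also have "\<dots> = chain_eval \<phi> a + chain_eval \<phi> b"
    using chain_eval_superset[of ?S a \<phi>] chain_eval_superset[of ?S b \<phi>] by simp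
  finally show ?thesis .
qed

lemma chain_eval_0 [simp]: "chain_eval \<phi> 0 = 0"
  by (simp add: chain_eval_def)

lemma chain_eval_cmul: "chain_eval \<phi> (frag_cmul n a) = of_int n * chain_eval \<phi> a"
proof -
  have "chain_eval \<phi> (frag_cmul n a) =
      (\<Sum>s\<in>Poly_Mapping.keys a. of_int (Poly_Mapping.lookup (frag_cmul n a) s) * \<phi> s)"
    by (rule chain_eval_superset) (auto simp: in_keys_iff)
  then show ?thesis by (simp add: chain_eval_def sum_distrib_left mult.assoc)
qed

lemma chain_eval_diff: "chain_eval \<phi> (a - b) = chain_eval \<phi> a - chain_eval \<phi> b"
  using chain_eval_add[of \<phi> "a - b" b] by simp

lemma chain_eval_sum: "chain_eval \<phi> (\<Sum>i\<in>S. f i) = (\<Sum>i\<in>S. chain_eval \<phi> (f i))"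
  by (induction S rule: infinite_finite_induct) (auto simp: chain_eval_add)

lemma chain_eval_of [simp]: "chain_eval \<phi> (frag_of s) = \<phi> s"
  by (simp add: chain_eval_def)

lemma chain_eval_linear:
  "chain_eval (\<lambda>s. \<phi> s + \<psi> s) z = chain_eval \<phi> z + chain_eval \<psi> z"
  "chain_eval (\<lambda>s. a * \<phi> s) z = a * chain_eval \<phi> z"
  by (simp_all add: chain_eval_def distrib_left sum.distrib sum_distrib_left mult_ac)

lemma chain_eval_boundary:
  assumes "singular_chain (Suc k) T z"
  shows "chain_eval \<phi> (chain_boundary (Suc k) z) = chain_eval (coboundary k T \<phi>) z"
proof -
  have "chain_eval \<phi> (chain_boundary (Suc k) z) =
      (\<Sum>s\<in>Poly_Mapping.keys z. of_int (Poly_Mapping.lookup z s) *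
        (\<Sum>i\<le>Suc k. (- 1) ^ i * \<phi> (singular_face (Suc k) i s)))"
    by (simp add: chain_boundary_def frag_extend_def chain_eval_sum chain_eval_cmul del: sum.atMost_Suc)
  also have "\<dots> = chain_eval (coboundary k T \<phi>) z"
    unfolding chain_eval_def using assms
    by (intro sum.cong) (auto simp: coboundary_def singular_chain_def simp del: sum.atMost_Suc)
  finally show ?thesis .
qed

lemma cochain_simps [simp]:
  "carrier (cochain_module k T) = {\<phi>. \<forall>s. \<not> singular_simplex k T s \<longrightarrow> \<phi> s = 0}"
  "zero (cochain_module k T) = (\<lambda>s. 0)" "add (cochain_module k T) = (\<lambda>\<phi> \<psi> s. \<phi> s + \<psi> s)"
  "module.smult (cochain_module k T) = (\<lambda>a \<phi> s. a * \<phi> s)"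
  by (simp_all add: cochain_module_def)

lemma cochain_space: "complex_vector_space (cochain_module k T)"
  by (rule complex_vector_spaceI) (auto simp: algebra_simps)

lemma coboundary_linear:
  "coboundary k T (\<lambda>s. \<phi> s + \<psi> s) = (\<lambda>s. coboundary k T \<phi> s + coboundary k T \<psi> s)"
  "coboundary k T (\<lambda>s. a * \<phi> s) = (\<lambda>s. a * coboundary k T \<phi> s)"
  "coboundary k T (\<lambda>s. 0) = (\<lambda>s. 0)"
  by (auto simp: coboundary_def fun_eq_iff distrib_left sum.distrib sum_distrib_left mult_ac
      simp del: sum.atMost_Suc intro!: sum.cong)

lemma submodule_cocycles: "submodule (cocycles k T) complex_field (cochain_module k T)"
proof -
  interpret complex_vector_space "cochain_module k T" by (rule cochain_space)
  show ?thesis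
    unfolding submodule_iff cocycles_def by (auto simp: coboundary_linear fun_eq_iff)
qed

lemma cocycle_boundary:
  assumes "\<phi> \<in> cocycles k T" "singular_chain (Suc k) T z"
  shows "chain_eval \<phi> (chain_boundary (Suc k) z) = 0"
  using assms by (simp add: chain_eval_boundary cocycles_def) (simp add: chain_eval_def)

lemma coboundary_cycle:
  assumes "\<phi> \<in> coboundaries k T" "singular_relcycle k T {} z"
  shows "chain_eval \<phi> z = 0"
proof (cases k)
  case 0
  then show ?thesis using assms by (simp add: coboundaries_def chain_eval_def)
next
  case (Suc l)
  then obtain \<psi> where "\<phi> = coboundary l T \<psi>" using assms by (auto simp: coboundaries_def)
  then show ?thesis using assms(2) chain_eval_boundary[of l T z \<psi>] by (simp add: Suc singular_cycle)
qed

lemma coboundaries_subset: "coboundaries k T \<subseteq> cocycles k T"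
proof
  fix \<phi> assume \<phi>: "\<phi> \<in> coboundaries k T"
  have "\<phi> s = 0" if "\<not> singular_simplex k T s" for s
    using \<phi> that by (cases k) (auto simp: coboundaries_def coboundary_def)
  moreover have "coboundary k T \<phi> s = 0" for s
  proof (cases "singular_simplex (Suc k) T s")
    case True
    then have ch: "singular_chain (Suc k) T (frag_of s)" by (simp add: singular_chain_of)
    have "singular_relcycle k T {} (chain_boundary (Suc k) (frag_of s))"
      using singular_chain_boundary[OF ch] chain_boundary_boundary_alt[OF ch] by (simp add: singular_cycle)
    then have "chain_eval \<phi> (chain_boundary (Suc k) (frag_of s)) = 0" by (rule coboundary_cycle[OF \<phi>])
    then show ?thesis using chain_eval_boundary[OF ch, of \<phi>] by simp
  qed (simp add: coboundary_def)
  ultimately show "\<phi> \<in> cocycles k T" by (auto simp: cocycles_def fun_eq_iff)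
qed

abbreviation cocycle_module :: "nat \<Rightarrow> 'a topology \<Rightarrow> (complex, 'a cochain) module" where
  "cocycle_module k T \<equiv> (cochain_module k T)\<lparr>carrier := cocycles k T\<rparr>"

lemma cocycle_space: "complex_vector_space (cocycle_module k T)"
  by (rule complex_vector_space.submodule_space[OF cochain_space submodule_cocycles])

lemma submodule_coboundaries: "submodule (coboundaries k T) complex_field (cocycle_module k T)"
proof -
  interpret complex_vector_space "cocycle_module k T" by (rule cocycle_space)
  show ?thesis
    unfolding submodule_iff
  proof (intro conjI ballI allI)
    show "coboundaries k T \<subseteq> carrier (cocycle_module k T)" using coboundaries_subset by simp
    show "zero (cocycle_module k T) \<in> coboundaries k T"
      by (cases k) (auto simp: coboundaries_def coboundary_linear intro!: image_eqI[of _ _ "\<lambda>s. 0"])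
    fix \<phi> assume \<phi>: "\<phi> \<in> coboundaries k T"
    show "module.smult (cocycle_module k T) a \<phi> \<in> coboundaries k T" for a
      using \<phi> by (cases k) (auto simp: coboundaries_def simp flip: coboundary_linear)
    show "add (cocycle_module k T) \<phi> \<psi> \<in> coboundaries k T" if "\<psi> \<in> coboundaries k T" for \<psi>
      using \<phi> that by (cases k) (auto simp: coboundaries_def simp flip: coboundary_linear)
  qed
qed

lemma cohomology_space: "complex_vector_space (cohomology k T)"
  unfolding cohomology_def
  by (rule complex_vector_space.quotient_space[OF cocycle_space submodule_coboundaries])

text \<open>The injectivity in the universal coefficient theorem. As \<open>\<phi>\<close> vanishes on cycles, its value at \<open>z\<close>
  depends on the boundary of \<open>z\<close> only, and so defines a homomorphism on the boundaries. Extended to all chains of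
  one degree less, it is a cochain with coboundary \<open>\<phi>\<close>.\<close>

lemma cocycle_vanishing_on_cycles:
  assumes \<phi>: "\<phi> \<in> cocycles k T" and zero: "\<And>z. singular_relcycle k T {} z \<Longrightarrow> chain_eval \<phi> z = 0"
  shows "\<phi> \<in> coboundaries k T"
proof (cases k)
  \<comment> \<open>In degree 0 all chains are cycles.\<close>
  case 0
  have "\<phi> s = 0" for s
  proof (cases "singular_simplex 0 T s")
    case True
    then show ?thesis using zero[of "frag_of s"] by (simp add: 0 singular_cycle singular_chain_of chain_boundary_of)
  next
    case False
    then show ?thesis using \<phi> by (simp add: 0 cocycles_def)
  qed
  then show ?thesis by (auto simp: 0 coboundaries_def)
next
  case (Suc l)
  define G where "G = {(chain_boundary k z, chain_eval \<phi> z) | z. singular_chain k T z}"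
  have "hom_graph G"
    unfolding hom_graph_def
  proof (intro conjI allI impI)
    show "(0, 0) \<in> G" unfolding G_def by (auto intro!: exI[of _ 0])
    show "x = 0" if "(0, x) \<in> G" for x
      using that zero unfolding G_def by (auto simp: singular_cycle)
    show "(a - b, x - y) \<in> G" if ab: "(a, x) \<in> G" "(b, y) \<in> G" for a b x y
    proof -
      obtain z z' where "singular_chain k T z" "singular_chain k T z'"
        "a = chain_boundary k z" "x = chain_eval \<phi> z" "b = chain_boundary k z'" "y = chain_eval \<phi> z'"
        using ab by (auto simp: G_def)
      then show ?thesis unfolding G_def
        by (auto intro!: exI[of _ "z - z'"] simp: chain_boundary_diff chain_eval_diff singular_chain_diff)
    qed
  qed
  then obtain \<Psi> where \<Psi>: "\<And>a b. \<Psi> (a - b) = \<Psi> a - \<Psi> b" "\<And>a x. (a, x) \<in> G \<Longrightarrow> \<Psi> a = x"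
    using hom_extension_complex by metis
  define \<psi> where "\<psi> s = (if singular_simplex l T s then \<Psi> (frag_of s) else 0)" for s
  have eval: "chain_eval \<psi> z = \<Psi> z" if "singular_chain l T z" for z
  proof -
    have "Poly_Mapping.keys z \<subseteq> singular_simplex_set l T" using that by (simp add: singular_chain_def)
    then show ?thesis
    proof (induction rule: frag_induction)
      case zero
      then show ?case using \<Psi>(1)[of 0 0] by simp
    next
      case (one s)
      then show ?case by (simp add: \<psi>_def)
    next
      case (diff a b)
      then show ?case by (simp add: \<Psi>(1) chain_eval_diff)
    qed
  qed
  have "\<phi> s = coboundary l T \<psi> s" for s
  proof (cases "singular_simplex k T s")
    case True
    then have ch: "singular_chain (Suc l) T (frag_of s)" by (simp add: Suc singular_chain_of)
    have "coboundary l T \<psi> s = \<Psi> (chain_boundary k (frag_of s))"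
      using chain_eval_boundary[OF ch, of \<psi>] eval singular_chain_boundary[OF ch] by (simp add: Suc)
    also have "\<dots> = \<phi> s"
      using ch by (intro \<Psi>(2)) (auto simp: G_def Suc intro!: exI[of _ "frag_of s"])
    finally show ?thesis by simp
  next
    case False
    then show ?thesis using \<phi> by (simp add: Suc cocycles_def coboundary_def)
  qed
  then have "\<phi> = coboundary l T \<psi>" by auto
  then show ?thesis by (auto simp: Suc coboundaries_def \<psi>_def)
qed

text \<open>The homology classes on which a given cocycle vanishes form a subgroup, so finitely many generators of the homology
  decide whether it is everything.\<close>

lemma cocycle_vanishing_on_generators:
  assumes "noetherian_group (homology_group (int k) T)"
  obtains B where "finite B" "\<And>z. z \<in> B \<Longrightarrow> singular_relcycle k T {} z"
    "\<And>\<phi> z. \<phi> \<in> cocycles k T \<Longrightarrow> \<forall>b\<in>B. chain_eval \<phi> b = 0 \<Longrightarrow> singular_relcycle k T {} z \<Longrightarrow> chain_eval \<phi> z = 0"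
proof -
  let ?H = "homology_group (int k) T" and ?C = "relcycle_group k T {}"
  let ?cl = "homologous_rel_set k T {}"
  have H: "group ?H" by simp
  obtain A where A: "finite A" "A \<subseteq> carrier ?H" "\<forall>K. subgroup K ?H \<and> A \<subseteq> K \<longrightarrow> carrier ?H \<subseteq> K"
    using noetherian_groupD[OF assms group.subgroup_self[OF H]] by (elim exE conjE)
  obtain B where B: "B \<subseteq> singular_relcycle_set k T {}" "finite B" "A = ?cl ` B"
    using finite_subset_image[OF A(1)] A(2) unfolding carrier_relative_homology_group by blast
  have "chain_eval \<phi> z = 0"
    if \<phi>: "\<phi> \<in> cocycles k T" and zero: "\<forall>b\<in>B. chain_eval \<phi> b = 0" and z: "singular_relcycle k T {} z" for \<phi> z
  proof -
    have bd: "chain_eval \<phi> b = 0" if "singular_relboundary k T {} b" for b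
      using that cocycle_boundary[OF \<phi>] by (auto simp: singular_boundary)
    let ?K = "{y. singular_relcycle k T {} y \<and> chain_eval \<phi> y = 0}"
    have "subgroup ?K ?C"
    proof (rule group.subgroupI)
      show "?K \<noteq> {}" by (auto intro!: exI[of _ 0])
      show "inv\<^bsub>?C\<^esub> a \<in> ?K" if "a \<in> ?K" for a
      proof -
        have "inv\<^bsub>?C\<^esub> a = - a"
          using that by (intro group.inv_equality) (auto simp: singular_relcycle_minus)
        then show ?thesis using that chain_eval_diff[of \<phi> 0 a] by (simp add: singular_relcycle_minus)
      qed
      show "a \<otimes>\<^bsub>?C\<^esub> b \<in> ?K" if "a \<in> ?K" "b \<in> ?K" for a b
        using that by (simp add: singular_relcycle_add chain_eval_add)
    qed auto
    moreover have "group_hom ?C ?H ?cl"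
    proof (intro group_hom.intro group_hom_axioms.intro)
      show "?cl \<in> hom ?C ?H"
        using normal.r_coset_hom_Mod[OF normal_subgroup_singular_relboundary_relcycle[of k T "{}"]]
        by (simp add: right_coset_singular_relboundary nontrivial_relative_homology_group)
    qed auto
    ultimately have "subgroup (?cl ` ?K) ?H"
      by (rule group_hom.subgroup_img_is_subgroup[rotated])
    moreover have "A \<subseteq> ?cl ` ?K" using B zero by auto
    ultimately have "carrier ?H \<subseteq> ?cl ` ?K" using A(3) by simp
    then have "?cl z \<in> ?cl ` ?K" using z by (auto simp: carrier_relative_homology_group)
    then obtain y where y: "chain_eval \<phi> y = 0" "homologous_rel k T {} z y"
      by (auto simp: homologous_rel_set_eq)
    then have "chain_eval \<phi> (z - y) = 0" by (intro bd) (simp add: homologous_rel_def)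
    then show ?thesis using y by (simp add: chain_eval_diff)
  qed
  then show ?thesis using that B(1,2) by blast
qed

text \<open>Evaluation at cycles representing the generators of the homology.\<close>

lemma finitely_separated_cohomology:
  assumes "noetherian_group (homology_group (int k) T)"
  shows "finitely_separated (cohomology k T)"
proof -
  obtain B where B: "finite B" "\<And>z. z \<in> B \<Longrightarrow> singular_relcycle k T {} z"
    "\<And>\<phi> z. \<phi> \<in> cocycles k T \<Longrightarrow> \<forall>b\<in>B. chain_eval \<phi> b = 0 \<Longrightarrow> singular_relcycle k T {} z \<Longrightarrow> chain_eval \<phi> z = 0"
    using cocycle_vanishing_on_generators[OF assms] by metis
  let ?Z = "cocycle_module k T" and ?N = "coboundaries k T"
  interpret Z: complex_vector_space ?Z by (rule cocycle_space)
  note q = Z.quotient_module_simps[OF submodule_coboundaries, folded cohomology_def]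
  define e where "e b A = chain_eval (SOME \<phi>. \<phi> \<in> A) b" for b and A :: "'a cochain set"
  have e: "e b (?N +>\<^bsub>?Z\<^esub> \<phi>) = chain_eval \<phi> b" if "b \<in> B" for b \<phi>
  proof -
    have "\<phi> \<in> ?N +>\<^bsub>?Z\<^esub> \<phi>"
      using submodule_coboundaries[of k T] unfolding Z.submodule_iff
      by (auto simp: a_r_coset_def' intro!: bexI[of _ "\<lambda>s. 0"])
    then have "(SOME \<psi>. \<psi> \<in> ?N +>\<^bsub>?Z\<^esub> \<phi>) \<in> ?N +>\<^bsub>?Z\<^esub> \<phi>"
      by (rule someI[where P = "\<lambda>\<psi>. \<psi> \<in> ?N +>\<^bsub>?Z\<^esub> \<phi>"])
    then obtain \<nu> where \<nu>: "\<nu> \<in> ?N" "(SOME \<psi>. \<psi> \<in> ?N +>\<^bsub>?Z\<^esub> \<phi>) = (\<lambda>s. \<nu> s + \<phi> s)"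
      by (auto simp: a_r_coset_def')
    show ?thesis
      unfolding e_def \<nu>(2) chain_eval_linear using coboundary_cycle[OF \<nu>(1) B(2)[OF that]] by simp
  qed
  have "linear_functional (cohomology k T) (e b)" if b: "b \<in> B" for b
    unfolding linear_functional_def q(1)
  proof (intro conjI ballI allI)
    fix A A' assume "A \<in> (\<lambda>\<phi>. ?N +>\<^bsub>?Z\<^esub> \<phi>) ` carrier ?Z" "A' \<in> (\<lambda>\<phi>. ?N +>\<^bsub>?Z\<^esub> \<phi>) ` carrier ?Z"
    then obtain \<phi> \<psi> where *: "\<phi> \<in> carrier ?Z" "\<psi> \<in> carrier ?Z" "A = ?N +>\<^bsub>?Z\<^esub> \<phi>" "A' = ?N +>\<^bsub>?Z\<^esub> \<psi>" by blast
    show "e b (A \<oplus>\<^bsub>cohomology k T\<^esub> A') = e b A + e b A'"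
      unfolding *(3,4) q(3)[OF *(1,2)] e[OF b] by (simp add: chain_eval_linear)
  next
    fix a A assume "A \<in> (\<lambda>\<phi>. ?N +>\<^bsub>?Z\<^esub> \<phi>) ` carrier ?Z"
    then obtain \<phi> where *: "\<phi> \<in> carrier ?Z" "A = ?N +>\<^bsub>?Z\<^esub> \<phi>" by blast
    show "e b (a \<odot>\<^bsub>cohomology k T\<^esub> A) = a * e b A"
      unfolding *(2) q(4)[OF *(1)] e[OF b] by (simp add: chain_eval_linear)
  qed
  moreover have "A = zero (cohomology k T)"
    if A: "A \<in> carrier (cohomology k T)" and zero: "\<forall>b\<in>B. e b A = 0" for A
  proof -
    obtain \<phi> where \<phi>: "\<phi> \<in> cocycles k T" "A = ?N +>\<^bsub>?Z\<^esub> \<phi>" using A unfolding q(1) by auto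
    have "\<forall>b\<in>B. chain_eval \<phi> b = 0" using zero e \<phi>(2) by auto
    then have "\<phi> \<in> ?N" using B(3)[OF \<phi>(1)] cocycle_vanishing_on_cycles[OF \<phi>(1)] by blast
    then have "?N +>\<^bsub>?Z\<^esub> \<phi> = ?N +>\<^bsub>?Z\<^esub> \<zero>\<^bsub>?Z\<^esub>"
      using Z.coset_eq_iff[OF submodule_coboundaries, of \<phi> "\<zero>\<^bsub>?Z\<^esub>"] \<phi>(1) Z.M.zero_closed by simp
    then show ?thesis by (simp only: \<phi>(2) q(2))
  qed
  ultimately show ?thesis
    unfolding finitely_separated_def using B(1) by (intro exI[of _ "e ` B"]) auto
qed

lemma trivial_cohomology:
  assumes "trivial_group (homology_group (int k) T)"
  shows "carrier (cohomology k T) = {zero (cohomology k T)}"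
proof -
  let ?Z = "cocycle_module k T" and ?N = "coboundaries k T"
  interpret Z: complex_vector_space ?Z by (rule cocycle_space)
  note q = Z.quotient_module_simps[OF submodule_coboundaries, folded cohomology_def]
  have "\<phi> \<in> ?N" if \<phi>: "\<phi> \<in> cocycles k T" for \<phi>
  proof (rule cocycle_vanishing_on_cycles[OF \<phi>])
    fix z assume z: "singular_relcycle k T {} z"
    then have "homologous_rel_set k T {} z \<in> carrier (homology_group (int k) T)"
      by (auto simp: carrier_relative_homology_group)
    then have "homologous_rel_set k T {} z = singular_relboundary_set k T {}"
      using assms by (simp add: trivial_group_def)
    then have "singular_relboundary k T {} z" by (simp only: homologous_rel_set_eq_relboundary)
    then show "chain_eval \<phi> z = 0" using cocycle_boundary[OF \<phi>] by (auto simp: singular_boundary)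
  qed
  then have "?N +>\<^bsub>?Z\<^esub> \<phi> = ?N +>\<^bsub>?Z\<^esub> \<zero>\<^bsub>?Z\<^esub>" if "\<phi> \<in> cocycles k T" for \<phi>
    using Z.coset_eq_iff[OF submodule_coboundaries, of \<phi> "\<zero>\<^bsub>?Z\<^esub>"] that Z.M.zero_closed by simp
  then have "(\<lambda>\<phi>. ?N +>\<^bsub>?Z\<^esub> \<phi>) ` cocycles k T = (\<lambda>\<phi>. ?N +>\<^bsub>?Z\<^esub> \<zero>\<^bsub>?Z\<^esub>) ` cocycles k T"
    by (intro image_cong refl)
  moreover have "cocycles k T \<noteq> {}" using Z.M.zero_closed by auto
  ultimately show ?thesis unfolding q(1,2) by (simp add: image_constant_conv)
qed

section \<open>Conjugations and real forms\<close>

context complex_vector_space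
begin

text \<open>Linear combinations of two vectors are computed coefficientwise by this lemma and the next. With a
  complex number \<open>1\<close> or \<open>0\<close> as coefficient they apply to single vectors, too.\<close>

lemma combination_add:
  "x \<in> carrier V \<Longrightarrow> y \<in> carrier V \<Longrightarrow>
    (a \<odot> x \<oplus> b \<odot> y) \<oplus> (a' \<odot> x \<oplus> b' \<odot> y) = (a + a') \<odot> x \<oplus> (b + b') \<odot> y"
  by (simp add: scale_add_left M.a_ac)

lemma combination_scale:
  "x \<in> carrier V \<Longrightarrow> y \<in> carrier V \<Longrightarrow> s \<odot> (a \<odot> x \<oplus> b \<odot> y) = (s * a) \<odot> x \<oplus> (s * b) \<odot> y"
  by (simp add: scale_add_right scale_scale)

lemma conjugationD:
  assumes "conjugation V c"
  shows "x \<in> carrier V \<Longrightarrow> c x \<in> carrier V" "x \<in> carrier V \<Longrightarrow> c (c x) = x"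
    "x \<in> carrier V \<Longrightarrow> y \<in> carrier V \<Longrightarrow> c (x \<oplus> y) = c x \<oplus> c y"
    "x \<in> carrier V \<Longrightarrow> c (a \<odot> x) = cnj a \<odot> c x"
  using assms by (auto simp: conjugation_def)

lemma conjugation_zero:
  assumes "conjugation V c" shows "c \<zero> = \<zero>"
  using conjugationD(4)[OF assms, of \<zero> 0] conjugationD(1)[OF assms, of \<zero>] by simp

lemma real_form_decomposition:
  assumes c: "conjugation V c" and v: "v \<in> carrier V"
  defines "x \<equiv> (1 / 2) \<odot> v \<oplus> (1 / 2) \<odot> c v" and "y \<equiv> (- \<i> / 2) \<odot> v \<oplus> (\<i> / 2) \<odot> c v"
  shows "x \<in> real_form V c" "y \<in> real_form V c" "v = x \<oplus> \<i> \<odot> y"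
proof -
  note cD = conjugationD[OF c]
  have cv: "c v \<in> carrier V" "c (c v) = v" using cD v by auto
  show "x \<in> real_form V c" "y \<in> real_form V c"
    using v cv cD by (simp_all add: real_form_def x_def y_def M.a_comm)
  have "x \<oplus> \<i> \<odot> y = 1 \<odot> v \<oplus> 0 \<odot> c v"
    unfolding x_def y_def using v cv by (simp only: combination_scale combination_add) simp
  then show "v = x \<oplus> \<i> \<odot> y" using v cv by simp
qed

lemma real_form_unique:
  assumes c: "conjugation V c" and x: "x \<in> real_form V c" and y: "y \<in> real_form V c"
    and v: "v = x \<oplus> \<i> \<odot> y"
  shows "x = (1 / 2) \<odot> v \<oplus> (1 / 2) \<odot> c v" "y = (- \<i> / 2) \<odot> v \<oplus> (\<i> / 2) \<odot> c v"
    "c v = x \<oplus> (- \<i>) \<odot> y"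
proof -
  note cD = conjugationD[OF c]
  have xy: "x \<in> carrier V" "y \<in> carrier V" "c x = x" "c y = y"
    using x y by (auto simp: real_form_def)
  show cv: "c v = x \<oplus> (- \<i>) \<odot> y" unfolding v using xy cD by simp
  have v': "v = 1 \<odot> x \<oplus> \<i> \<odot> y" and cv': "c v = 1 \<odot> x \<oplus> (- \<i>) \<odot> y" using v cv xy by simp_all
  have "(1 / 2) \<odot> v \<oplus> (1 / 2) \<odot> c v = 1 \<odot> x \<oplus> 0 \<odot> y"
    unfolding cv' unfolding v' using xy by (simp only: combination_scale combination_add) simp
  then show "x = (1 / 2) \<odot> v \<oplus> (1 / 2) \<odot> c v" using xy by simp
  have "(- \<i> / 2) \<odot> v \<oplus> (\<i> / 2) \<odot> c v = 0 \<odot> x \<oplus> 1 \<odot> y"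
    unfolding cv' unfolding v' using xy by (simp only: combination_scale combination_add) simp
  then show "y = (- \<i> / 2) \<odot> v \<oplus> (\<i> / 2) \<odot> c v" using xy by simp
qed

lemma is_real_form_real_form:
  assumes c: "conjugation V c"
  shows "is_real_form V (real_form V c)"
  unfolding is_real_form_def
proof (intro conjI ballI allI)
  note cD = conjugationD[OF c]
  let ?R = "real_form V c"
  show "?R \<subseteq> carrier V" "\<zero> \<in> ?R" using conjugation_zero[OF c] by (auto simp: real_form_def)
  show "x \<oplus> y \<in> ?R" if "x \<in> ?R" "y \<in> ?R" for x y using that cD by (auto simp: real_form_def)
  show "complex_of_real t \<odot> x \<in> ?R" if "x \<in> ?R" for t x using that cD by (auto simp: real_form_def)
  show "\<exists>!(x, y). x \<in> ?R \<and> y \<in> ?R \<and> v = x \<oplus> \<i> \<odot> y" if v: "v \<in> carrier V" for v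
  proof (rule ex1I[of _ "((1 / 2) \<odot> v \<oplus> (1 / 2) \<odot> c v, (- \<i> / 2) \<odot> v \<oplus> (\<i> / 2) \<odot> c v)"])
    show "case ((1 / 2) \<odot> v \<oplus> (1 / 2) \<odot> c v, (- \<i> / 2) \<odot> v \<oplus> (\<i> / 2) \<odot> c v) of
        (x, y) \<Rightarrow> x \<in> ?R \<and> y \<in> ?R \<and> v = x \<oplus> \<i> \<odot> y"
      using real_form_decomposition[OF c v] by simp
    show "z = ((1 / 2) \<odot> v \<oplus> (1 / 2) \<odot> c v, (- \<i> / 2) \<odot> v \<oplus> (\<i> / 2) \<odot> c v)"
      if "case z of (x, y) \<Rightarrow> x \<in> ?R \<and> y \<in> ?R \<and> v = x \<oplus> \<i> \<odot> y" for z
    proof -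
      obtain x y where z: "z = (x, y)" by (cases z)
      with that have "x \<in> ?R" "y \<in> ?R" "v = x \<oplus> \<i> \<odot> y" by auto
      from real_form_unique(1,2)[OF c this] z show ?thesis by simp
    qed
  qed
qed

lemma conjugate_wrt_real_form:
  assumes c: "conjugation V c" and v: "v \<in> carrier V"
  shows "conjugate_wrt V (real_form V c) v = c v"
  unfolding conjugate_wrt_def
proof (rule the_equality)
  let ?x = "(1 / 2) \<odot> v \<oplus> (1 / 2) \<odot> c v" and ?y = "(- \<i> / 2) \<odot> v \<oplus> (\<i> / 2) \<odot> c v"
  note d = real_form_decomposition[OF c v]
  show "\<exists>x\<in>real_form V c. \<exists>y\<in>real_form V c. v = x \<oplus> \<i> \<odot> y \<and> c v = x \<oplus> (- \<i>) \<odot> y"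
    using d real_form_unique(3)[OF c d] by blast
next
  fix w assume "\<exists>x\<in>real_form V c. \<exists>y\<in>real_form V c. v = x \<oplus> \<i> \<odot> y \<and> w = x \<oplus> (- \<i>) \<odot> y"
  then obtain x y where xy: "x \<in> real_form V c" "y \<in> real_form V c" "v = x \<oplus> \<i> \<odot> y" "w = x \<oplus> (- \<i>) \<odot> y"
    by blast
  then show "w = c v" using real_form_unique(3)[OF c xy(1,2,3)] by simp
qed

lemma defined_over_real_form_stable:
  assumes c: "conjugation V c" and U: "submodule U complex_field V" and cU: "c ` U \<subseteq> U"
  shows "defined_over_real_form V (real_form V c) U"
  unfolding defined_over_real_form_def
proof (intro equalityI subsetI)
  have Us: "U \<subseteq> carrier V" "\<And>x y. x \<in> U \<Longrightarrow> y \<in> U \<Longrightarrow> x \<oplus> y \<in> U" "\<And>a x. x \<in> U \<Longrightarrow> a \<odot> x \<in> U"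
    using U by (auto simp: submodule_iff)
  fix v
  show "v \<in> {x \<oplus> \<i> \<odot> y |x y. x \<in> U \<inter> real_form V c \<and> y \<in> U \<inter> real_form V c}" if v: "v \<in> U"
  proof -
    have vc: "v \<in> carrier V" "c v \<in> U" using v Us cU by auto
    have "(1 / 2) \<odot> v \<oplus> (1 / 2) \<odot> c v \<in> U" "(- \<i> / 2) \<odot> v \<oplus> (\<i> / 2) \<odot> c v \<in> U"
      using v vc Us by auto
    then show ?thesis using real_form_decomposition[OF c vc(1)] by blast
  qed
  show "v \<in> U" if "v \<in> {x \<oplus> \<i> \<odot> y |x y. x \<in> U \<inter> real_form V c \<and> y \<in> U \<inter> real_form V c}"
    using that Us by auto
qed

text \<open>The conjugation induced on a quotient maps a coset to its image. A real coset has a real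
  representative, namely the real part of any of its representatives.\<close>

lemma quotient_conjugation:
  assumes c: "conjugation V c" and N: "submodule N complex_field V" and cN: "c ` N \<subseteq> N"
  shows coset_conjugation: "\<And>x. x \<in> carrier V \<Longrightarrow> c ` (N +> x) = N +> c x"
    and conjugation_quotient: "conjugation (quotient_module V N) ((`) c)"
    and real_form_quotient: "real_form (quotient_module V N) ((`) c) = (\<lambda>x. N +> x) ` real_form V c"
proof -
  note cD = conjugationD[OF c]
  have Ns: "N \<subseteq> carrier V" "\<And>x y. x \<in> N \<Longrightarrow> y \<in> N \<Longrightarrow> x \<oplus> y \<in> N" "\<And>a x. x \<in> N \<Longrightarrow> a \<odot> x \<in> N"
    using N by (auto simp: submodule_iff)
  have cN_eq: "c ` N = N"
  proof (intro equalityI subsetI)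
    fix x assume "x \<in> N"
    then have "c x \<in> N" "x = c (c x)" using cN Ns cD by auto
    then show "x \<in> c ` N" by blast
  qed (use cN in blast)
  show coset: "c ` (N +> x) = N +> c x" if x: "x \<in> carrier V" for x
  proof -
    have "c ` (N +> x) = (\<lambda>h. c (h \<oplus> x)) ` N" by (auto simp: a_r_coset_def')
    also have "\<dots> = (\<lambda>h. c h \<oplus> c x) ` N" using Ns x cD by (intro image_cong) auto
    also have "\<dots> = (\<lambda>h. h \<oplus> c x) ` (c ` N)" by (simp only: image_image)
    also have "\<dots> = N +> c x" unfolding cN_eq by (auto simp: a_r_coset_def')
    finally show ?thesis .
  qed
  note simps = quotient_module_simps[OF N]
  show "conjugation (quotient_module V N) ((`) c)"
    unfolding conjugation_def simps(1)
    using cD by (auto simp: coset simps(3,4))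
  show "real_form (quotient_module V N) ((`) c) = (\<lambda>x. N +> x) ` real_form V c"
  proof (intro equalityI subsetI)
    fix A assume "A \<in> real_form (quotient_module V N) ((`) c)"
    then obtain x where x: "x \<in> carrier V" "A = N +> x" "c ` A = A"
      by (auto simp: real_form_def simps(1))
    have cx: "c x \<in> carrier V" using cD x by simp
    have "x \<oplus> (- 1) \<odot> c x \<in> N"
      using coset[OF x(1)] x coset_eq_iff[OF N x(1) cx] by simp
    then have "(1 / 2) \<odot> (x \<oplus> (- 1) \<odot> c x) \<in> N" using Ns by blast
    moreover have "x \<oplus> (- 1) \<odot> ((1 / 2) \<odot> x \<oplus> (1 / 2) \<odot> c x) = (1 / 2) \<odot> (x \<oplus> (- 1) \<odot> c x)"
    proof -
      have "(1 \<odot> x \<oplus> 0 \<odot> c x) \<oplus> (- 1) \<odot> ((1 / 2) \<odot> x \<oplus> (1 / 2) \<odot> c x) = (1 / 2) \<odot> (1 \<odot> x \<oplus> (- 1) \<odot> c x)"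
        using x cx by (simp only: combination_scale combination_add) simp
      then show ?thesis using x cx by simp
    qed
    ultimately have "N +> x = N +> ((1 / 2) \<odot> x \<oplus> (1 / 2) \<odot> c x)"
      using coset_eq_iff[OF N x(1), of "(1 / 2) \<odot> x \<oplus> (1 / 2) \<odot> c x"] x cx by simp
    then show "A \<in> (\<lambda>x. N +> x) ` real_form V c"
      using real_form_decomposition(1)[OF c x(1)] x(2) by blast
  next
    fix A assume "A \<in> (\<lambda>x. N +> x) ` real_form V c"
    then obtain x where "x \<in> carrier V" "c x = x" "A = N +> x" by (auto simp: real_form_def)
    then show "A \<in> real_form (quotient_module V N) ((`) c)"
      using coset[of x] by (simp add: real_form_def simps(1))
  qed
qed

lemma submodule_quotient_image:
  assumes N: "submodule N complex_field V" and U: "submodule U complex_field V"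
  shows "submodule ((\<lambda>x. N +> x) ` U) complex_field (quotient_module V N)"
proof -
  interpret Q: complex_vector_space "quotient_module V N" by (rule quotient_space[OF N])
  note simps = quotient_module_simps[OF N]
  have Us: "U \<subseteq> carrier V" "\<zero> \<in> U" "\<And>x y. x \<in> U \<Longrightarrow> y \<in> U \<Longrightarrow> x \<oplus> y \<in> U" "\<And>a x. x \<in> U \<Longrightarrow> a \<odot> x \<in> U"
    using U by (auto simp: submodule_iff)
  show ?thesis
    unfolding Q.submodule_iff simps(1,2)
  proof (intro conjI ballI allI)
    fix A B assume "A \<in> (\<lambda>x. N +> x) ` U" "B \<in> (\<lambda>x. N +> x) ` U"
    then obtain x y where "x \<in> U" "y \<in> U" "A = N +> x" "B = N +> y" by blast
    then show "A \<oplus>\<^bsub>quotient_module V N\<^esub> B \<in> (\<lambda>x. N +> x) ` U"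
      using Us simps(3)[of x y] by (intro image_eqI[of _ _ "x \<oplus> y"]) auto
  next
    fix a A assume "A \<in> (\<lambda>x. N +> x) ` U"
    then obtain x where "x \<in> U" "A = N +> x" by blast
    then show "a \<odot>\<^bsub>quotient_module V N\<^esub> A \<in> (\<lambda>x. N +> x) ` U"
      using Us simps(4)[of x a] by (intro image_eqI[of _ _ "a \<odot> x"]) auto
  qed (use Us in auto)
qed

end

definition support_part :: "'i set \<Rightarrow> ('i \<Rightarrow> (complex, 'v) module) \<Rightarrow> 'i set \<Rightarrow> ('i \<Rightarrow> 'v) set" where
  "support_part I M K = {x \<in> carrier (direct_sum_module I M). \<forall>i\<in>I - K. x i = \<zero>\<^bsub>direct_sum_module I M\<^esub> i}"

locale direct_sum =
  fixes I :: "'i set" and M :: "'i \<Rightarrow> (complex, 'v) module"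
  assumes summand: "i \<in> I \<Longrightarrow> complex_vector_space (M i)"
begin

abbreviation D :: "(complex, 'i \<Rightarrow> 'v) module" where "D \<equiv> direct_sum_module I M"

sublocale complex_vector_space D by (rule direct_sum_space[OF summand])

lemmas summand_laws = complex_vector_space.space_laws[OF summand]

lemma in_carrier: "x \<in> carrier D \<longleftrightarrow>
    x \<in> extensional I \<and> (\<forall>i\<in>I. x i \<in> carrier (M i)) \<and> finite {i \<in> I. x i \<noteq> \<zero>\<^bsub>M i\<^esub>}"
  by (auto simp: direct_sum_module_def PiE_def)

lemma component [simp]:
  "i \<in> I \<Longrightarrow> \<zero>\<^bsub>D\<^esub> i = \<zero>\<^bsub>M i\<^esub>" "i \<in> I \<Longrightarrow> (x \<oplus>\<^bsub>D\<^esub> y) i = x i \<oplus>\<^bsub>M i\<^esub> y i" "i \<in> I \<Longrightarrow> (a \<odot>\<^bsub>D\<^esub> x) i = a \<odot>\<^bsub>M i\<^esub> x i"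
  by (simp_all add: direct_sum_module_def)

lemma in_part: "x \<in> support_part I M K \<longleftrightarrow> x \<in> carrier D \<and> (\<forall>i\<in>I - K. x i = \<zero>\<^bsub>M i\<^esub>)"
  by (auto simp: support_part_def)

lemma part_mono: "K \<inter> I \<subseteq> L \<Longrightarrow> support_part I M K \<subseteq> support_part I M L"
  unfolding in_part subset_iff by blast

lemma part_empty: "support_part I M {} = {\<zero>\<^bsub>D\<^esub>}"
proof (intro equalityI subsetI)
  fix x assume "x \<in> support_part I M {}"
  then have "x \<in> extensional I" "\<forall>i\<in>I. x i = \<zero>\<^bsub>M i\<^esub>" by (simp_all add: in_part in_carrier)
  then show "x \<in> {\<zero>\<^bsub>D\<^esub>}" by (auto simp: direct_sum_module_def extensional_def fun_eq_iff)
qed (simp add: in_part)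

lemma submodule_part: "submodule (support_part I M K) complex_field D"
proof -
  have "x \<in> carrier D \<Longrightarrow> i \<in> I \<Longrightarrow> x i \<in> carrier (M i)" for x i by (simp add: in_carrier)
  then show ?thesis unfolding submodule_iff by (auto simp: in_part summand_laws)
qed

definition cut :: "'i set \<Rightarrow> ('i \<Rightarrow> 'v) \<Rightarrow> 'i \<Rightarrow> 'v" where
  "cut L x = (\<lambda>i\<in>I. if i \<in> L then x i else \<zero>\<^bsub>M i\<^esub>)"

lemma cut_part:
  assumes "x \<in> support_part I M K" shows "cut L x \<in> support_part I M (K \<inter> L)"
proof -
  have "{i \<in> I. cut L x i \<noteq> \<zero>\<^bsub>M i\<^esub>} \<subseteq> {i \<in> I. x i \<noteq> \<zero>\<^bsub>M i\<^esub>}" by (auto simp: cut_def)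
  then have "finite {i \<in> I. cut L x i \<noteq> \<zero>\<^bsub>M i\<^esub>}"
    using assms by (auto simp: in_part in_carrier elim: finite_subset)
  then show ?thesis using assms by (auto simp: in_part in_carrier cut_def summand_laws)
qed

lemma cut_add:
  assumes "x \<in> carrier D" shows "cut L x \<oplus>\<^bsub>D\<^esub> cut (- L) x = x"
proof (rule extensionalityI[of _ I])
  show "cut L x \<oplus>\<^bsub>D\<^esub> cut (- L) x \<in> extensional I" by (simp add: direct_sum_module_def)
  show "x \<in> extensional I" using assms by (simp add: in_carrier)
  show "(cut L x \<oplus>\<^bsub>D\<^esub> cut (- L) x) i = x i" if "i \<in> I" for i
    using that assms by (simp add: cut_def in_carrier summand_laws)
qed

text \<open>Elements of the direct sum have finite support, so they are sums of homogeneous ones.\<close>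

lemma part_subset_submodule:
  assumes N: "submodule N complex_field D" and single: "\<And>i. i \<in> K \<inter> I \<Longrightarrow> support_part I M {i} \<subseteq> N"
  shows "support_part I M K \<subseteq> N"
proof
  fix x assume x: "x \<in> support_part I M K"
  have "x \<in> N" if "finite S" "x \<in> support_part I M (K \<inter> S)" for S x
    using that
  proof (induction arbitrary: x)
    case empty
    then have "x \<in> support_part I M {}" by simp
    then have "x = \<zero>\<^bsub>D\<^esub>" by (simp add: part_empty)
    then show ?case using N by (simp add: submodule_iff)
  next
    case (insert s S)
    have x: "x \<in> carrier D" using insert.prems by (simp add: in_part)
    have "cut (- {s}) x \<in> support_part I M (K \<inter> S)"
      using cut_part[OF insert.prems, of "- {s}"] part_mono[of "K \<inter> insert s S \<inter> - {s}" "K \<inter> S"] by auto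
    then have 1: "cut (- {s}) x \<in> N" by (rule insert.IH)
    have 2: "cut {s} x \<in> N"
    proof (cases "s \<in> K \<inter> I")
      case True
      have "cut {s} x \<in> support_part I M {s}"
        using cut_part[OF insert.prems, of "{s}"] part_mono[of "K \<inter> insert s S \<inter> {s}" "{s}"] by auto
      then show ?thesis using single[OF True] by auto
    next
      case False
      have "cut {s} x \<in> support_part I M {}"
        using cut_part[OF insert.prems, of "{s}"] part_mono[of "K \<inter> insert s S \<inter> {s}" "{}"] False by auto
      then have "cut {s} x = \<zero>\<^bsub>D\<^esub>" by (simp add: part_empty)
      then show ?thesis using N by (simp add: submodule_iff)
    qed
    have "cut {s} x \<oplus>\<^bsub>D\<^esub> cut (- {s}) x \<in> N" using 1 2 N by (simp add: submodule_iff)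
    then show ?case using cut_add[OF x] by simp
  qed
  moreover have "finite {i \<in> I. x i \<noteq> \<zero>\<^bsub>M i\<^esub>}" using x by (simp add: in_part in_carrier)
  moreover have "x \<in> support_part I M (K \<inter> {i \<in> I. x i \<noteq> \<zero>\<^bsub>M i\<^esub>})"
    using x by (auto simp: in_part)
  ultimately show "x \<in> N" by blast
qed

end

section \<open>Bigraded mixed Hodge structures\<close>

lemma finite_decreasing_filtrationI:
  assumes "\<And>p. submodule (F p) complex_field V" "\<And>p. F (p + 1) \<subseteq> F p" "F a = carrier V" "F b = {\<zero>\<^bsub>V\<^esub>}"
  shows "finite_decreasing_filtration V F"
  unfolding finite_decreasing_filtration_def using assms by blast

text \<open>Each summand has a weight \<open>w\<close> and a Hodge degree \<open>h\<close>. Up to terms of smaller weight, the conjugation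
  exchanges the summands of type \<open>(h, w - h)\<close> with those of type \<open>(w - h, h)\<close>; the map \<open>\<iota>\<close> on indices records
  this symmetry.\<close>

locale hodge_bigraded = direct_sum I M
  for I :: "'i set" and M :: "'i \<Rightarrow> (complex, 'v) module" +
  fixes h w :: "'i \<Rightarrow> int" and \<iota> :: "'i \<Rightarrow> 'i" and c :: "('i \<Rightarrow> 'v) \<Rightarrow> 'i \<Rightarrow> 'v"
  assumes separated: "finitely_separated D"
    and finite_support: "finite {i \<in> I. carrier (M i) \<noteq> {\<zero>\<^bsub>M i\<^esub>}}"
    and weight_\<iota>: "i \<in> I \<Longrightarrow> w (\<iota> i) = w i"
    and hodge_\<iota>: "i \<in> I \<Longrightarrow> h (\<iota> i) = w i - h i"
    and conj: "conjugation D c"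
    and conj_part: "i \<in> I \<Longrightarrow> c ` support_part I M {i} \<subseteq> support_part I M ({\<iota> i} \<union> {j. w j < w i})"
begin

definition Fil :: "int \<Rightarrow> ('i \<Rightarrow> 'v) set" where "Fil p = support_part I M {i. h i \<ge> p}"
definition Wt :: "int \<Rightarrow> ('i \<Rightarrow> 'v) set" where "Wt m = support_part I M {i. w i \<le> m}"

text \<open>The filtrations see only the indices with nonzero summand. There are finitely many of these, whence the
  filtrations are finite.\<close>

lemma part_essential:
  "support_part I M K = support_part I M (K \<inter> {i \<in> I. carrier (M i) \<noteq> {\<zero>\<^bsub>M i\<^esub>}})"
proof -
  have "x i = \<zero>\<^bsub>M i\<^esub>" if "x \<in> carrier D" "i \<in> I" "carrier (M i) = {\<zero>\<^bsub>M i\<^esub>}" for x i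
  proof -
    have "x i \<in> carrier (M i)" using that(1,2) by (simp add: in_carrier)
    then show ?thesis using that(3) by simp
  qed
  then show ?thesis unfolding set_eq_iff in_part by blast
qed

lemma part_all:
  assumes "\<And>i. i \<in> I \<Longrightarrow> carrier (M i) \<noteq> {\<zero>\<^bsub>M i\<^esub>} \<Longrightarrow> i \<in> K"
  shows "support_part I M K = carrier D"
proof -
  let ?S = "{i \<in> I. carrier (M i) \<noteq> {\<zero>\<^bsub>M i\<^esub>}}"
  have "support_part I M K = support_part I M (K \<inter> ?S)" by (rule part_essential)
  also have "K \<inter> ?S = UNIV \<inter> ?S" using assms by blast
  also have "support_part I M (UNIV \<inter> ?S) = support_part I M UNIV" by (rule part_essential[symmetric])
  also have "support_part I M UNIV = carrier D" unfolding set_eq_iff in_part by simp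
  finally show ?thesis .
qed

lemma part_none:
  assumes "\<And>i. i \<in> I \<Longrightarrow> carrier (M i) \<noteq> {\<zero>\<^bsub>M i\<^esub>} \<Longrightarrow> i \<notin> K"
  shows "support_part I M K = {\<zero>\<^bsub>D\<^esub>}"
proof -
  have "K \<inter> {i \<in> I. carrier (M i) \<noteq> {\<zero>\<^bsub>M i\<^esub>}} = {}" using assms by blast
  then show ?thesis using part_essential[of K] by (simp only: part_empty)
qed

lemma degree_bounds:
  fixes d :: "'i \<Rightarrow> int"
  obtains a b where "\<And>i. i \<in> I \<Longrightarrow> carrier (M i) \<noteq> {\<zero>\<^bsub>M i\<^esub>} \<Longrightarrow> a \<le> d i \<and> d i < b"
proof -
  let ?S = "d ` {i \<in> I. carrier (M i) \<noteq> {\<zero>\<^bsub>M i\<^esub>}}"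
  have fin: "finite ?S" using finite_support by simp
  have "Min (insert 0 ?S) \<le> d i \<and> d i < Max (insert 0 ?S) + 1"
    if "i \<in> I" "carrier (M i) \<noteq> {\<zero>\<^bsub>M i\<^esub>}" for i
  proof -
    have "d i \<in> insert 0 ?S" using that by blast
    then show ?thesis using fin Min_le[of "insert 0 ?S" "d i"] Max_ge[of "insert 0 ?S" "d i"] by simp
  qed
  then show ?thesis by (rule that)
qed

lemma Fil_filtration: "finite_decreasing_filtration D Fil"
proof -
  obtain a b where ab: "\<And>i. i \<in> I \<Longrightarrow> carrier (M i) \<noteq> {\<zero>\<^bsub>M i\<^esub>} \<Longrightarrow> a \<le> h i \<and> h i < b"
    using degree_bounds[of h] by metis
  show ?thesis
  proof (rule finite_decreasing_filtrationI)
    show "submodule (Fil p) complex_field D" for p unfolding Fil_def by (rule submodule_part)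
    show "Fil (p + 1) \<subseteq> Fil p" for p unfolding Fil_def by (rule part_mono) auto
    show "Fil a = carrier D" unfolding Fil_def using ab by (intro part_all) auto
    show "Fil b = {\<zero>\<^bsub>D\<^esub>}" unfolding Fil_def using ab by (intro part_none) (auto simp: not_le)
  qed
qed

lemma Wt_filtration: "finite_increasing_filtration D Wt"
proof -
  obtain a b where ab: "\<And>i. i \<in> I \<Longrightarrow> carrier (M i) \<noteq> {\<zero>\<^bsub>M i\<^esub>} \<Longrightarrow> a \<le> w i \<and> w i < b"
    using degree_bounds[of w] by metis
  show ?thesis
    unfolding finite_increasing_filtration_def
  proof (rule finite_decreasing_filtrationI)
    show "submodule (Wt (- p)) complex_field D" for p unfolding Wt_def by (rule submodule_part)
    show "Wt (- (p + 1)) \<subseteq> Wt (- p)" for p unfolding Wt_def by (rule part_mono) auto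
    show "Wt (- (- b)) = carrier D" unfolding Wt_def using ab by (intro part_all) fastforce
    show "Wt (- (1 - a)) = {\<zero>\<^bsub>D\<^esub>}" unfolding Wt_def using ab by (intro part_none) force
  qed
qed

lemma conj_support:
  "c ` support_part I M K \<subseteq> support_part I M {j. \<exists>k\<in>K \<inter> I. j = \<iota> k \<or> w j < w k}"
proof -
  let ?L = "{j. \<exists>k\<in>K \<inter> I. j = \<iota> k \<or> w j < w k}"
  note cD = conjugationD[OF conj]
  have L: "support_part I M ?L \<subseteq> carrier D" "\<zero>\<^bsub>D\<^esub> \<in> support_part I M ?L"
    "\<And>x y. x \<in> support_part I M ?L \<Longrightarrow> y \<in> support_part I M ?L \<Longrightarrow> x \<oplus>\<^bsub>D\<^esub> y \<in> support_part I M ?L"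
    "\<And>a x. x \<in> support_part I M ?L \<Longrightarrow> a \<odot>\<^bsub>D\<^esub> x \<in> support_part I M ?L"
    using submodule_part[of ?L] by (auto simp only: submodule_iff)
  have "support_part I M K \<subseteq> {x \<in> carrier D. c x \<in> support_part I M ?L}"
  proof (rule part_subset_submodule)
    show "submodule {x \<in> carrier D. c x \<in> support_part I M ?L} complex_field D"
      unfolding submodule_iff using L cD conjugation_zero[OF conj] by auto
    fix i assume i: "i \<in> K \<inter> I"
    have "support_part I M ({\<iota> i} \<union> {j. w j < w i}) \<subseteq> support_part I M ?L"
      using i by (intro part_mono) auto
    then have "c ` support_part I M {i} \<subseteq> support_part I M ?L"
      using conj_part[of i] i by blast
    moreover have "support_part I M {i} \<subseteq> carrier D" by (auto simp: in_part)
    ultimately show "support_part I M {i} \<subseteq> {x \<in> carrier D. c x \<in> support_part I M ?L}"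
      by blast
  qed
  then show ?thesis by blast
qed

lemma conj_Wt: "c ` Wt m \<subseteq> Wt m"
proof -
  have "support_part I M {j. \<exists>k\<in>{i. w i \<le> m} \<inter> I. j = \<iota> k \<or> w j < w k} \<subseteq> Wt m"
    unfolding Wt_def by (rule part_mono) (auto simp: weight_\<iota>)
  then show ?thesis using conj_support[of "{i. w i \<le> m}"] unfolding Wt_def by blast
qed

text \<open>The two conditions for a Hodge structure of weight \<open>m\<close>, on representatives. Modulo smaller weight, \<open>c\<close>
  maps Hodge degrees at least \<open>m + 1 - p\<close> to degrees at most \<open>p - 1\<close>. So \<open>x\<close> and \<open>c y\<close> have disjoint
  supports in weight \<open>m\<close>, and together they reach everything since \<open>c\<close> is an involution.\<close>

lemma opposed:
  fixes m p :: int
  shows opposed_Int: "\<And>x y. x \<in> Fil p \<inter> Wt m \<Longrightarrow> y \<in> Fil (m + 1 - p) \<inter> Wt m \<Longrightarrow>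
      x \<oplus>\<^bsub>D\<^esub> (- 1) \<odot>\<^bsub>D\<^esub> c y \<in> Wt (m - 1) \<Longrightarrow> x \<in> Wt (m - 1)"
    and opposed_sum: "\<And>z. z \<in> Wt m \<Longrightarrow>
      \<exists>x\<in>Fil p \<inter> Wt m. \<exists>y\<in>Fil (m + 1 - p) \<inter> Wt m. \<exists>n\<in>Wt (m - 1). z = (x \<oplus>\<^bsub>D\<^esub> c y) \<oplus>\<^bsub>D\<^esub> n"
proof -
  note cD = conjugationD[OF conj]
  have Int_part: "Fil q \<inter> Wt m = support_part I M {i. h i \<ge> q \<and> w i \<le> m}" for q
    by (auto simp: Fil_def Wt_def in_part)
  {
    fix x y
    assume x: "x \<in> Fil p \<inter> Wt m" and y: "y \<in> Fil (m + 1 - p) \<inter> Wt m"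
      and diff: "x \<oplus>\<^bsub>D\<^esub> (- 1) \<odot>\<^bsub>D\<^esub> c y \<in> Wt (m - 1)"
    have cy: "c y \<in> support_part I M {j. \<exists>k\<in>{i. h i \<ge> m + 1 - p \<and> w i \<le> m} \<inter> I. j = \<iota> k \<or> w j < w k}"
      using conj_support y unfolding Int_part by blast
    have xc: "x \<in> carrier D" and cyc: "c y \<in> carrier D" using x cy by (auto simp: Int_part in_part)
    have "x i = \<zero>\<^bsub>M i\<^esub>" if i: "i \<in> I" "\<not> w i \<le> m - 1" for i
    proof (cases "h i \<ge> p \<and> w i \<le> m")
      case False
      then show ?thesis using x i by (auto simp: Int_part in_part)
    next
      case True
      have "(c y) i = \<zero>\<^bsub>M i\<^esub>"
      proof -
        have "\<not> (\<exists>k\<in>{i. h i \<ge> m + 1 - p \<and> w i \<le> m} \<inter> I. i = \<iota> k \<or> w i < w k)"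
        proof
          assume "\<exists>k\<in>{i. h i \<ge> m + 1 - p \<and> w i \<le> m} \<inter> I. i = \<iota> k \<or> w i < w k"
          then obtain k where k: "h k \<ge> m + 1 - p" "w k \<le> m" "k \<in> I" "i = \<iota> k \<or> w i < w k" by auto
          with i have "i = \<iota> k" by auto
          then show False using k True i weight_\<iota>[OF k(3)] hodge_\<iota>[OF k(3)] by simp
        qed
        then show ?thesis using cy i(1) by (auto simp: in_part)
      qed
      moreover have "x i \<oplus>\<^bsub>M i\<^esub> (- 1) \<odot>\<^bsub>M i\<^esub> (c y) i = \<zero>\<^bsub>M i\<^esub>"
        using diff i by (auto simp: Wt_def in_part)
      ultimately show ?thesis using xc i(1) by (simp add: in_carrier summand_laws)
    qed
    then show "x \<in> Wt (m - 1)" using xc by (auto simp: Wt_def in_part)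
  next
    fix z assume z: "z \<in> Wt m"
    define x where "x = cut {i. h i \<ge> p} z"
    define u where "u = cut (- {i. h i \<ge> p}) z"
    define y where "y = cut {i. w i = m} (c u)"
    define n where "n = cut (- {i. w i = m}) (c u)"
    have zc: "z \<in> carrier D" using z by (simp add: Wt_def in_part)
    have x: "x \<in> Fil p \<inter> Wt m"
      unfolding x_def Int_part
      using cut_part[OF z[unfolded Wt_def], of "{i. h i \<ge> p}"]
        part_mono[of "{i. w i \<le> m} \<inter> {i. h i \<ge> p}" "{i. h i \<ge> p \<and> w i \<le> m}"] by auto
    have u: "u \<in> support_part I M ({i. w i \<le> m} \<inter> - {i. h i \<ge> p})"
      using cut_part[of z "{i. w i \<le> m}"] z unfolding u_def Wt_def by blast
    have zxu: "z = x \<oplus>\<^bsub>D\<^esub> u" using cut_add[OF zc] by (simp add: x_def u_def)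
    have cu: "c u \<in> support_part I M {j. \<exists>k\<in>({i. w i \<le> m} \<inter> - {i. h i \<ge> p}) \<inter> I. j = \<iota> k \<or> w j < w k}"
      using conj_support u by blast
    have carr: "u \<in> carrier D" "c u \<in> carrier D" "x \<in> carrier D" using u cu x by (auto simp: Int_part in_part)
    have "y \<in> support_part I M ({j. \<exists>k\<in>({i. w i \<le> m} \<inter> - {i. h i \<ge> p}) \<inter> I. j = \<iota> k \<or> w j < w k} \<inter> {i. w i = m})"
      unfolding y_def by (rule cut_part[OF cu])
    moreover have "support_part I M ({j. \<exists>k\<in>({i. w i \<le> m} \<inter> - {i. h i \<ge> p}) \<inter> I. j = \<iota> k \<or> w j < w k} \<inter> {i. w i = m})
        \<subseteq> support_part I M {i. h i \<ge> m + 1 - p \<and> w i \<le> m}"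
      by (rule part_mono) (auto simp: weight_\<iota> hodge_\<iota>)
    ultimately have y: "y \<in> Fil (m + 1 - p) \<inter> Wt m" unfolding Int_part by blast
    have "n \<in> support_part I M ({j. \<exists>k\<in>({i. w i \<le> m} \<inter> - {i. h i \<ge> p}) \<inter> I. j = \<iota> k \<or> w j < w k} \<inter> - {i. w i = m})"
      unfolding n_def by (rule cut_part[OF cu])
    moreover have "support_part I M ({j. \<exists>k\<in>({i. w i \<le> m} \<inter> - {i. h i \<ge> p}) \<inter> I. j = \<iota> k \<or> w j < w k} \<inter> - {i. w i = m})
        \<subseteq> Wt (m - 1)"
      unfolding Wt_def by (rule part_mono) (auto simp: weight_\<iota>)
    ultimately have n: "n \<in> Wt (m - 1)" by blast
    have yn: "y \<in> carrier D" "n \<in> carrier D" using y n by (auto simp: Int_part Wt_def in_part)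
    have "c u = y \<oplus>\<^bsub>D\<^esub> n" using cut_add[OF carr(2)] by (simp add: y_def n_def)
    then have "u = c (y \<oplus>\<^bsub>D\<^esub> n)" using cD(2)[OF carr(1)] by simp
    then have "u = c y \<oplus>\<^bsub>D\<^esub> c n" using cD(3)[OF yn] by simp
    then have "z = (x \<oplus>\<^bsub>D\<^esub> c y) \<oplus>\<^bsub>D\<^esub> c n"
      using zxu carr yn cD by (simp add: M.a_assoc)
    moreover have "c n \<in> Wt (m - 1)" using conj_Wt n by blast
    ultimately show "\<exists>x\<in>Fil p \<inter> Wt m. \<exists>y\<in>Fil (m + 1 - p) \<inter> Wt m. \<exists>n\<in>Wt (m - 1). z = (x \<oplus>\<^bsub>D\<^esub> c y) \<oplus>\<^bsub>D\<^esub> n"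
      using x y by blast
  }
qed

text \<open>The graded piece is a quotient of \<open>Wt m\<close>, with the conjugation and the filtration induced by \<open>c\<close> and
  \<open>Fil\<close>, so that the opposedness of representatives carries over to cosets.\<close>

lemma pure_graded_piece:
  "pure_hodge_structure m (weight_graded D Wt m) (weight_graded_image D Wt m (real_form D c))
     (\<lambda>p. weight_graded_image D Wt m (Fil p))"
proof -
  let ?U = "D\<lparr>carrier := Wt m\<rparr>" and ?N = "Wt (m - 1)"
  let ?G = "quotient_module ?U ?N" and ?F = "\<lambda>p. weight_graded_image D Wt m (Fil p)"
  note cD = conjugationD[OF conj]
  have sub: "submodule (Wt k) complex_field D" for k unfolding Wt_def by (rule submodule_part)
  have UD: "Wt k \<subseteq> carrier D" for k unfolding Wt_def by (auto simp: in_part)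
  have NU: "?N \<subseteq> Wt m" unfolding Wt_def by (rule part_mono) auto
  interpret U: complex_vector_space ?U by (rule submodule_space[OF sub])
  have ops: "carrier ?U = Wt m" "add ?U = add D" "zero ?U = zero D" "module.smult ?U = module.smult D"
    by simp_all
  have cosets: "A +>\<^bsub>?U\<^esub> x = A +>\<^bsub>D\<^esub> x" for A x by (simp add: a_r_coset_def')
  have N: "submodule ?N complex_field ?U"
    using sub[of "m - 1"] NU unfolding U.submodule_iff submodule_iff by simp
  interpret G: complex_vector_space ?G by (rule U.quotient_space[OF N])
  note q = U.quotient_module_simps[OF N, unfolded ops cosets]
  have cU: "conjugation ?U c"
    using cD conj_Wt[of m] UD[of m] unfolding conjugation_def by (auto simp: subset_iff)
  have cN: "c ` ?N \<subseteq> ?N" by (rule conj_Wt)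
  note qc = U.coset_conjugation[OF cU N cN, unfolded ops cosets] U.conjugation_quotient[OF cU N cN]
    U.real_form_quotient[OF cU N cN, unfolded cosets]
  have R: "weight_graded_image D Wt m (real_form D c) = real_form ?G ((`) c)"
  proof -
    have "real_form ?U c = real_form D c \<inter> Wt m" using UD[of m] by (auto simp: real_form_def)
    then show ?thesis unfolding weight_graded_image_def qc(3) by simp
  qed
  have F_image: "?F p = (\<lambda>x. ?N +>\<^bsub>D\<^esub> x) ` (Fil p \<inter> Wt m)" for p
    by (simp add: weight_graded_image_def)
  have Fil_sub: "submodule (Fil p \<inter> Wt m) complex_field ?U" for p
  proof -
    have "submodule (Fil p) complex_field D" unfolding Fil_def by (rule submodule_part)
    then show ?thesis using sub[of m] unfolding U.submodule_iff submodule_iff by auto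
  qed
  have F_sub: "submodule (?F p) complex_field ?G" for p
    using U.submodule_quotient_image[OF N Fil_sub[of p]] unfolding cosets F_image .
  have F_carrier: "?F p \<subseteq> carrier ?G" for p using F_sub by (simp add: G.submodule_iff)
  have filtration: "finite_decreasing_filtration ?G ?F"
  proof -
    obtain a b where ab: "Fil a = carrier D" "Fil b = {\<zero>\<^bsub>D\<^esub>}"
      using Fil_filtration unfolding finite_decreasing_filtration_def by blast
    show ?thesis
    proof (rule finite_decreasing_filtrationI)
      show "submodule (?F p) complex_field ?G" for p by (rule F_sub)
      show "?F (p + 1) \<subseteq> ?F p" for p
        using Fil_filtration unfolding F_image finite_decreasing_filtration_def by blast
      show "?F a = carrier ?G" unfolding F_image unfolding q(1) ab using UD[of m] by (simp add: Int_absorb1)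
      have "\<zero>\<^bsub>D\<^esub> \<in> Wt m" using sub[of m] by (simp add: submodule_iff)
      then show "?F b = {\<zero>\<^bsub>?G\<^esub>}" unfolding F_image unfolding q(2) ab by simp
    qed
  qed
  have opp: "?F p \<inter> (`) c ` ?F (m + 1 - p) = {\<zero>\<^bsub>?G\<^esub>}"
    "?F p <+>\<^bsub>?G\<^esub> ((`) c ` ?F (m + 1 - p)) = carrier ?G" for p
  proof -
    have zero: "\<zero>\<^bsub>?G\<^esub> \<in> ?F p'" for p' using F_sub[of p'] by (simp add: G.submodule_iff)
    have "c ` \<zero>\<^bsub>?G\<^esub> = \<zero>\<^bsub>?G\<^esub>" by (rule G.conjugation_zero[OF qc(2)])
    then have "\<zero>\<^bsub>?G\<^esub> \<in> (`) c ` ?F (m + 1 - p)" using zero by (metis image_eqI)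
    moreover have "A = \<zero>\<^bsub>?G\<^esub>" if "A \<in> ?F p" "A \<in> (`) c ` ?F (m + 1 - p)" for A
    proof -
      obtain x y where x: "x \<in> Fil p \<inter> Wt m" "A = ?N +>\<^bsub>D\<^esub> x"
        and y: "y \<in> Fil (m + 1 - p) \<inter> Wt m" "A = c ` (?N +>\<^bsub>D\<^esub> y)"
        using \<open>A \<in> ?F p\<close> \<open>A \<in> (`) c ` ?F (m + 1 - p)\<close> unfolding F_image by blast
      have cy: "c y \<in> Wt m" using conj_Wt y(1) by blast
      have "?N +>\<^bsub>D\<^esub> x = ?N +>\<^bsub>D\<^esub> c y" using x y qc(1)[of y] by simp
      then have "x \<oplus>\<^bsub>D\<^esub> (- 1) \<odot>\<^bsub>D\<^esub> c y \<in> ?N"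
        using U.coset_eq_iff[OF N, unfolded ops cosets] x(1) cy by blast
      then have "x \<in> ?N" using opposed_Int x(1) y(1) by blast
      then have "?N +>\<^bsub>D\<^esub> x = ?N +>\<^bsub>D\<^esub> \<zero>\<^bsub>D\<^esub>"
        using U.coset_eq_iff[OF N, unfolded ops cosets, of x "\<zero>\<^bsub>D\<^esub>"] x(1) UD[of m] sub[of m]
        by (auto simp: submodule_iff)
      then show ?thesis by (simp add: x(2) q(2))
    qed
    ultimately show "?F p \<inter> (`) c ` ?F (m + 1 - p) = {\<zero>\<^bsub>?G\<^esub>}" using zero by blast
    show "?F p <+>\<^bsub>?G\<^esub> ((`) c ` ?F (m + 1 - p)) = carrier ?G"
    proof (intro equalityI subsetI)
      fix A assume "A \<in> ?F p <+>\<^bsub>?G\<^esub> ((`) c ` ?F (m + 1 - p))"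
      then obtain B B' where "B \<in> ?F p" "B' \<in> ?F (m + 1 - p)" "A = B \<oplus>\<^bsub>?G\<^esub> c ` B'"
        by (auto simp: set_add_def')
      then show "A \<in> carrier ?G"
        using F_carrier G.conjugationD(1)[OF qc(2)] by blast
    next
      fix A assume "A \<in> carrier ?G"
      then obtain z where z: "z \<in> Wt m" "A = ?N +>\<^bsub>D\<^esub> z" unfolding q(1) by blast
      obtain x y n where xyn: "x \<in> Fil p \<inter> Wt m" "y \<in> Fil (m + 1 - p) \<inter> Wt m" "n \<in> ?N"
        "z = (x \<oplus>\<^bsub>D\<^esub> c y) \<oplus>\<^bsub>D\<^esub> n"
        using opposed_sum[OF z(1)] by blast
      have cy: "c y \<in> Wt m" using conj_Wt xyn(2) by blast
      have xcy: "x \<oplus>\<^bsub>D\<^esub> c y \<in> Wt m" using xyn(1) cy sub[of m] by (simp add: submodule_iff)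
      have carr: "x \<oplus>\<^bsub>D\<^esub> c y \<in> carrier D" "n \<in> carrier D" using xcy xyn(3) UD by blast+
      have "z \<oplus>\<^bsub>D\<^esub> (- 1) \<odot>\<^bsub>D\<^esub> (x \<oplus>\<^bsub>D\<^esub> c y) = n"
        using carr unfolding xyn(4) M.a_comm[OF carr]
        by (simp add: scale_minus_1 M.a_assoc M.r_neg)
      then have "A = ?N +>\<^bsub>D\<^esub> (x \<oplus>\<^bsub>D\<^esub> c y)"
        using U.coset_eq_iff[OF N, unfolded ops cosets, of z "x \<oplus>\<^bsub>D\<^esub> c y"] z xcy xyn(3) by simp
      also have "\<dots> = (?N +>\<^bsub>D\<^esub> x) \<oplus>\<^bsub>?G\<^esub> (c ` (?N +>\<^bsub>D\<^esub> y))"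
        using q(3)[of x "c y"] xyn cy qc(1)[of y] by simp
      finally show "A \<in> ?F p <+>\<^bsub>?G\<^esub> ((`) c ` ?F (m + 1 - p))"
        using xyn(1,2) unfolding F_image set_add_def' by blast
    qed
  qed
  have conj_image: "conjugate_wrt ?G (real_form ?G ((`) c)) ` ?F p = (`) c ` ?F p" for p
    using G.conjugate_wrt_real_form[OF qc(2)] F_carrier[of p] by (intro image_cong) auto
  have "finite_dimensional ?G"
    by (rule U.finite_dimensional_quotient[OF N U.finitely_separated_imp_finite_dimensional])
      (rule finitely_separated_submodule[OF separated UD])
  then show ?thesis
    unfolding pure_hodge_structure_def weight_graded_def R Let_def conj_image
    by (intro conjI allI G.module_axioms G.is_real_form_real_form[OF qc(2)] filtration opp)
qed

theorem mixed_hodge_structure_bigraded: "mixed_hodge_structure D (real_form D c) Fil Wt"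
proof -
  have "defined_over_real_form D (real_form D c) (Wt m)" for m
    by (rule defined_over_real_form_stable[OF conj _ conj_Wt]) (simp add: Wt_def submodule_part)
  then show ?thesis
    unfolding mixed_hodge_structure_def
    using module_axioms finitely_separated_imp_finite_dimensional[OF separated]
      is_real_form_real_form[OF conj] Fil_filtration Wt_filtration pure_graded_piece
    by blast
qed

end

section \<open>Faces and sectors of a simplicial polytope\<close>

locale simplicial_polytope =
  fixes P :: "(real ^ 'n) set"
  assumes simplicial: "simplicial_lattice_polytope P" and zero_interior: "0 \<in> interior P"
begin

abbreviation proper_face :: "(real ^ 'n) set \<Rightarrow> bool" where
  "proper_face S \<equiv> S face_of P \<and> S \<noteq> P"

text \<open>The generators of the rays of the cone over \<open>S\<close>.\<close>

definition gens :: "(real ^ 'n) set \<Rightarrow> (real ^ 'n) set" where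
  "gens S = vertices P \<inter> S"

lemma polytope_P: "polytope P" and integral_vertices: "vertices P \<subseteq> integral_points"
  and facet_simplex: "S facet_of P \<Longrightarrow> \<exists>k. k simplex S"
  using simplicial by (auto simp: simplicial_lattice_polytope_def)

lemma convex_P: "convex P" using polytope_P by (rule polytope_imp_convex)

lemma finite_vertices: "finite (vertices P)"
proof -
  obtain C where "finite C" "P = convex hull C" using polytope_P by (auto simp: polytope_def)
  then show ?thesis
    using extreme_point_of_convex_hull by (auto simp: vertices_def intro: finite_subset)
qed

lemma gens_facts: "finite (gens S)" "gens S \<subseteq> integral_points" "gens S \<subseteq> S" "gens S \<subseteq> vertices P"
  "gens (S \<inter> T) = gens S \<inter> gens T" "S \<subseteq> T \<Longrightarrow> gens S \<subseteq> gens T"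
  using finite_vertices integral_vertices by (auto simp: gens_def)

lemma gens_extreme: "S face_of P \<Longrightarrow> gens S = {v. v extreme_point_of S}"
  using extreme_point_of_face by (auto simp: gens_def vertices_def)

lemma face_hull:
  assumes "S face_of P" shows "S = convex hull (gens S)"
proof -
  have "polytope S" using face_of_polytope_polytope[OF polytope_P assms] .
  then show ?thesis
    unfolding gens_extreme[OF assms]
    by (intro Krein_Milman_Minkowski polytope_imp_compact polytope_imp_convex)
qed

lemma face_interior: "proper_face S \<Longrightarrow> x \<in> S \<Longrightarrow> x \<notin> interior P"
  using face_of_disjoint_interior by blast

lemma zero_not_in_face: "proper_face S \<Longrightarrow> 0 \<notin> S"
  using face_interior zero_interior by blast

text \<open>A face is contained in a facet, which is a simplex, so its vertices are affinely independent. The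
  origin is an interior point of the polytope and therefore not in the affine hull of the facet. This makes them linearly
  independent.\<close>

lemma independent_gens:
  assumes S: "proper_face S" shows "independent (gens S)"
proof (cases "S = {}")
  case True
  then show ?thesis by (simp add: gens_def independent_empty)
next
  case False
  obtain T where T: "T facet_of P" "S \<subseteq> T"
    using face_of_polyhedron_subset_facet[OF polytope_imp_polyhedron[OF polytope_P]] S False by metis
  have T': "T face_of P" "T \<noteq> P" using T by (auto simp: facet_of_def)
  obtain C where C: "\<not> affine_dependent C" "T = convex hull C"
    using facet_simplex[OF T(1)] by (auto simp: simplex_def)
  have "gens T = C"
    unfolding gens_extreme[OF T'(1)] unfolding C(2)
    using extreme_point_of_convex_hull_affine_independent[OF C(1)] by blast
  have "affine hull T \<inter> rel_interior P = {}"
    by (rule affine_hull_face_of_disjoint_rel_interior[OF convex_P T'])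
  then have "0 \<notin> affine hull T" using zero_interior interior_subset_rel_interior by blast
  then have "0 \<notin> affine hull C" by (simp add: C(2))
  then have "\<not> affine_dependent (insert 0 C)" by (rule affine_independent_insert[OF C(1)])
  moreover have "0 \<notin> C" using \<open>0 \<notin> affine hull C\<close> hull_subset[of C affine] by auto
  ultimately have "independent C" using dependent_imp_affine_dependent[where a = 0 and S = C] by auto
  then show ?thesis
    using gens_facts(6)[OF T(2)] \<open>gens T = C\<close> by (metis independent_mono)
qed

lemma cone_face: assumes "S face_of P" shows "convex_cone hull S = nonneg_span (gens S)"
proof -
  have "convex_cone hull (convex hull gens S) = convex_cone hull (gens S)"
    by (intro subset_antisym hull_minimal hull_mono convex_hull_subset_convex_cone_hull
        convex_cone_convex_cone_hull hull_subset)
  then show ?thesis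
    using face_hull[OF assms] convex_cone_hull_finite[OF gens_facts(1)] by metis
qed

lemma scaled_point:
  assumes S: "S face_of P" and x: "x \<in> nonneg_span (gens S)" "x \<noteq> 0"
  obtains r s where "r > 0" "s \<in> S" "x = r *\<^sub>R s"
proof -
  obtain a where a: "\<forall>b\<in>gens S. 0 \<le> a b" "x = (\<Sum>b\<in>gens S. a b *\<^sub>R b)"
    using x(1) by (rule nonneg_spanE)
  define r where "r = (\<Sum>b\<in>gens S. a b)"
  have "r \<noteq> 0"
  proof
    assume "r = 0"
    then have "\<forall>b\<in>gens S. a b = 0"
      unfolding r_def using sum_nonneg_eq_0_iff[OF gens_facts(1), of S a] a(1) by blast
    then show False using a(2) x(2) by simp
  qed
  then have r: "r > 0" using sum_nonneg[of "gens S" a] a(1) by (simp add: r_def order_less_le)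
  have "(1 / r) *\<^sub>R x = (\<Sum>b\<in>gens S. (a b / r) *\<^sub>R b)" by (simp add: a(2) scaleR_sum_right)
  also have "\<dots> \<in> convex hull (gens S)"
    by (rule convex_sum[OF gens_facts(1) convex_convex_hull])
      (use r a(1) in \<open>auto simp: r_def hull_inc simp flip: sum_divide_distrib\<close>)
  finally have "(1 / r) *\<^sub>R x \<in> S" using face_hull[OF S] by simp
  then show ?thesis using r that[of r "(1 / r) *\<^sub>R x"] by simp
qed

text \<open>A ray from the interior point \<open>0\<close> meets the boundary of the polytope only once.\<close>

lemma face_points_on_ray:
  assumes S: "proper_face S" "s \<in> S" and T: "proper_face T" "t \<in> T"
    and eq: "r *\<^sub>R s = r' *\<^sub>R t" "r > 0" "r' > 0"
  shows "s = t"
proof -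
  have less: "\<not> p < q" if pq: "p *\<^sub>R u = q *\<^sub>R v" "p > 0" "q > 0" and u: "u \<in> P" "v \<in> P" "v \<notin> interior P" for p q u v
  proof
    assume "p < q"
    have "v = (p / q) *\<^sub>R u"
    proof -
      have "(1 / q) *\<^sub>R (p *\<^sub>R u) = (1 / q) *\<^sub>R (q *\<^sub>R v)" using pq(1) by simp
      then show ?thesis using pq(3) by simp
    qed
    also have "\<dots> = u - (1 - p / q) *\<^sub>R (u - 0)" by (simp add: scaleR_left_diff_distrib)
    also have "\<dots> \<in> interior P"
    proof (rule mem_interior_closure_convex_shrink[OF convex_P zero_interior])
      show "u \<in> closure P" using u(1) closure_subset by blast
      show "0 < 1 - p / q" "1 - p / q \<le> 1" using pq(2,3) \<open>p < q\<close> by (simp_all add: field_simps)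
    qed
    finally show False using u by blast
  qed
  have P: "s \<in> P" "t \<in> P" using S T face_of_imp_subset by blast+
  have "\<not> r < r'" by (rule less[OF eq P face_interior[OF T]])
  moreover have "\<not> r' < r" by (rule less[OF eq(1)[symmetric] eq(3,2) P(2,1) face_interior[OF S]])
  ultimately have "r = r'" by simp
  then show ?thesis using eq by simp
qed

lemma face_in_cone:
  assumes S: "proper_face S" "s \<in> S" and T: "proper_face T" "s \<in> nonneg_span (gens T)"
  shows "s \<in> T"
proof -
  have "s \<noteq> 0" using zero_not_in_face S by blast
  then obtain r t where rt: "r > 0" "t \<in> T" "s = r *\<^sub>R t"
    using scaled_point T by metis
  then have "s = t" using face_points_on_ray[OF S T(1) rt(2), of 1 r] by simp
  then show ?thesis using rt by simp
qed

lemma proper_face_Int: "proper_face S \<Longrightarrow> proper_face T \<Longrightarrow> proper_face (S \<inter> T)"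
  using face_of_Int[of S P T] face_of_imp_subset[of S P] by blast

text \<open>By the preceding lemmas, a nonzero common point lies on the ray through a single point of both faces.\<close>

lemma cone_Int_gens:
  assumes S: "proper_face S" and T: "proper_face T"
  shows "nonneg_span (gens S) \<inter> nonneg_span (gens T) = nonneg_span (gens S \<inter> gens T)"
proof (intro equalityI subsetI)
  fix x assume x: "x \<in> nonneg_span (gens S) \<inter> nonneg_span (gens T)"
  show "x \<in> nonneg_span (gens S \<inter> gens T)"
  proof (cases "x = 0")
    case True
    then show ?thesis
      using convex_cone_nonneg_span[of "gens S \<inter> gens T"] gens_facts(1) by (simp add: convex_cone_iff)
  next
    case False
    obtain r s where rs: "r > 0" "s \<in> S" "x = r *\<^sub>R s" using scaled_point S x False by (metis IntD1)
    obtain r' t where rt: "r' > 0" "t \<in> T" "x = r' *\<^sub>R t" using scaled_point T x False by (metis IntD2)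
    have "s = t" using face_points_on_ray[OF S rs(2) T rt(2), of r r'] rs rt by simp
    then have "s \<in> S \<inter> T" using rs rt by simp
    then have "s \<in> convex_cone hull (S \<inter> T)" by (rule hull_inc)
    then have "x \<in> convex_cone hull (S \<inter> T)" unfolding rs(3) using rs(1) by (intro convex_cone_hull_mul) auto
    then show ?thesis using cone_face proper_face_Int[OF S T] gens_facts(5) by metis
  qed
next
  fix x assume "x \<in> nonneg_span (gens S \<inter> gens T)"
  then show "x \<in> nonneg_span (gens S) \<inter> nonneg_span (gens T)"
    using nonneg_span_mono[of "gens S" "gens S \<inter> gens T"] nonneg_span_mono[of "gens T" "gens S \<inter> gens T"]
      gens_facts(1) by blast
qed

lemma face_fan_eq: "face_fan P = {nonneg_span (gens S) | S. proper_face S}"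
  using cone_face by (auto simp: face_fan_def)

lemma finite_faces: "finite {S. S face_of P}" by (rule finite_polytope_faces[OF polytope_P])

lemma gens_subset_of_cone_subset:
  assumes S: "proper_face S" and T: "proper_face T" and sub: "nonneg_span (gens S) \<subseteq> nonneg_span (gens T)"
  shows "gens S \<subseteq> gens T"
proof
  fix b assume b: "b \<in> gens S"
  then have "b \<in> nonneg_span (gens T)" using sub generator_in_nonneg_span gens_facts(1) by blast
  then have "b \<in> T" using face_in_cone[OF S _ T] b gens_facts(3) by blast
  then show "b \<in> gens T" using b by (simp add: gens_def)
qed

lemma toric_fan_quotient:
  assumes S: "proper_face S"
  shows "toric_fan (quotient_fan (face_fan P) (nonneg_span (gens S)))"
proof -
  let ?\<sigma> = "nonneg_span (gens S)"
  define \<T> where "\<T> = {gens T | T. proper_face T \<and> ?\<sigma> face_of nonneg_span (gens T)}"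
  interpret simplicial_star \<T> "gens S"
  proof
    have "\<T> \<subseteq> gens ` {T. T face_of P}" by (auto simp: \<T>_def)
    then show "finite \<T>" using finite_faces by (auto intro: finite_subset)
    fix T assume "T \<in> \<T>"
    then obtain F where F: "T = gens F" "proper_face F" "?\<sigma> face_of nonneg_span (gens F)"
      by (auto simp: \<T>_def)
    show "gens S \<subseteq> T" unfolding F(1)
      by (rule gens_subset_of_cone_subset[OF S F(2) face_of_imp_subset[OF F(3)]])
    show "independent T" using independent_gens[OF F(2)] by (simp add: F(1))
    show "T \<subseteq> integral_points" using gens_facts by (simp add: F(1))
    fix T' assume "T' \<in> \<T>"
    then obtain F' where F': "T' = gens F'" "proper_face F'" "?\<sigma> face_of nonneg_span (gens F')"
      by (auto simp: \<T>_def)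
    show cone: "nonneg_span T \<inter> nonneg_span T' = nonneg_span (T \<inter> T')"
      using cone_Int_gens[OF F(2) F'(2)] by (simp add: F F')
    have "?\<sigma> \<subseteq> nonneg_span (T \<inter> T')"
      using cone face_of_imp_subset[OF F(3)] face_of_imp_subset[OF F'(3)] by (auto simp: F F')
    then have "?\<sigma> face_of nonneg_span (T \<inter> T')"
      using face_of_subset[OF F(3)] cone by (auto simp: F F')
    then show "T \<inter> T' \<in> \<T>"
      unfolding \<T>_def using proper_face_Int[OF F(2) F'(2)] gens_facts(5)
      by (intro CollectI exI[of _ "F \<inter> F'"]) (simp add: F F')
  qed
  have "quotient_fan (face_fan P) ?\<sigma> = star_cone ` \<T>"
    unfolding quotient_fan_def star_cone_def \<T>_def face_fan_eq span_nonneg_span[OF gens_facts(1)]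
    by blast
  then show ?thesis using toric_fan_star by simp
qed

text \<open>A vertex \<open>b\<close> of the face spans a ray of its cone, because some linear form vanishes on \<open>b\<close> and is
  positive on the other vertices. Conversely, a vertex of the polytope that lies in the cone already lies in the face.\<close>

lemma ray_generators_cone:
  assumes S: "proper_face S"
  shows "ray_generators P (nonneg_span (gens S)) = gens S"
proof (intro equalityI subsetI)
  fix b assume "b \<in> ray_generators P (nonneg_span (gens S))"
  then have b: "b \<in> vertices P" "(convex_cone hull {b}) face_of nonneg_span (gens S)"
    by (auto simp: ray_generators_def)
  have "b \<in> nonneg_span (gens S)" using face_of_imp_subset[OF b(2)] by (meson hull_inc insertI1 subsetD)
  moreover have "{b} face_of P" using b(1) by (simp add: vertices_def face_of_singleton)
  moreover have "{b} \<noteq> P"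
  proof
    assume "{b} = P"
    then have "interior P = {}" using interior_singleton by metis
    then show False using zero_interior by simp
  qed
  ultimately have "b \<in> S" using face_in_cone[of "{b}" b S] S by simp
  then show "b \<in> gens S" using b(1) by (simp add: gens_def)
next
  fix b assume b: "b \<in> gens S"
  let ?C = "nonneg_span (gens S)"
  obtain m where m: "\<And>c. c \<in> gens S - {b} \<Longrightarrow> m \<bullet> c > 0" "\<And>c. c \<in> gens S - (gens S - {b}) \<Longrightarrow> m \<bullet> c = 0"
    using integral_separating_vector[OF independent_gens[OF S] gens_facts(2), of "gens S - {b}"]
    by (metis Diff_subset)
  have mb: "m \<bullet> b = 0" using m(2) b by blast
  have m0: "m \<bullet> c \<ge> 0" if "c \<in> gens S" for c using m(1)[of c] mb that by (cases "c = b") auto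
  have pos: "m \<bullet> x \<ge> 0" if x: "x \<in> ?C" for x
  proof -
    obtain a where "\<forall>c\<in>gens S. 0 \<le> a c" "x = (\<Sum>c\<in>gens S. a c *\<^sub>R c)" using x by (rule nonneg_spanE)
    then show ?thesis using m0 by (auto simp: inner_sum_right intro!: sum_nonneg)
  qed
  have "convex ?C" using convex_cone_nonneg_span[OF gens_facts(1)] by (simp add: convex_cone_def)
  then have "(?C \<inter> {x. m \<bullet> x = 0}) face_of ?C"
    by (intro face_of_Int_supporting_hyperplane_ge pos)
  moreover have "?C \<inter> {x. m \<bullet> x = 0} = convex_cone hull {b}"
  proof (intro equalityI subsetI)
    fix x assume x: "x \<in> ?C \<inter> {x. m \<bullet> x = 0}"
    then obtain a where a: "\<forall>c\<in>gens S. 0 \<le> a c" "x = (\<Sum>c\<in>gens S. a c *\<^sub>R c)" using nonneg_spanE by blast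
    have "(\<Sum>c\<in>gens S. a c * (m \<bullet> c)) = 0" using x a(2) by (simp add: inner_sum_right)
    then have "\<forall>c\<in>gens S. a c * (m \<bullet> c) = 0"
      using sum_nonneg_eq_0_iff[OF gens_facts(1), of S "\<lambda>c. a c * (m \<bullet> c)"] a(1) m0 by simp
    then have "a c = 0" if "c \<in> gens S" "c \<noteq> b" for c using m(1)[of c] that by force
    then have "x = (\<Sum>c\<in>gens S. if c = b then a b *\<^sub>R b else 0)"
      unfolding a(2) by (intro sum.cong) auto
    then have "x = a b *\<^sub>R b" using b gens_facts(1) by simp
    then show "x \<in> convex_cone hull {b}" using a(1) b by (simp add: convex_cone_hull_mul hull_inc)
  next
    fix x assume "x \<in> convex_cone hull {b}"
    then obtain t where "t \<ge> 0" "x = t *\<^sub>R b"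
      unfolding convex_cone_hull_finite[OF finite.insertI[OF finite.emptyI]] by (auto elim!: nonneg_spanE)
    moreover have "b \<in> ?C" using generator_in_nonneg_span[OF gens_facts(1) b] .
    ultimately show "x \<in> ?C \<inter> {x. m \<bullet> x = 0}"
      using convex_cone_nonneg_span[OF gens_facts(1), of S] mb by (simp add: convex_cone_iff)
  qed
  ultimately show "b \<in> ray_generators P ?C"
    using b gens_facts(4) by (auto simp: ray_generators_def)
qed

definition box_rep :: "real ^ 'n \<Rightarrow> (real ^ 'n) set \<Rightarrow> (real ^ 'n \<Rightarrow> real) \<Rightarrow> bool" where
  "box_rep l S q \<longleftrightarrow> proper_face S \<and> l \<in> integral_points \<and> (\<forall>b\<in>gens S. 0 < q b \<and> q b < 1) \<and>
     (\<forall>b. b \<notin> gens S \<longrightarrow> q b = 0) \<and> l = (\<Sum>b\<in>gens S. q b *\<^sub>R b)"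

lemma sectors_iff: "l \<in> sectors P \<longleftrightarrow> (\<exists>S q. box_rep l S q)"
proof -
  have "l \<in> sectors P \<longleftrightarrow> (\<exists>S. proper_face S \<and> l \<in> Box P (nonneg_span (gens S)))"
    unfolding sectors_def face_fan_eq by auto
  moreover have "proper_face S \<and> l \<in> Box P (nonneg_span (gens S)) \<longleftrightarrow> (\<exists>q. box_rep l S q)" for S
  proof (cases "proper_face S")
    case True
    then show ?thesis
      unfolding Box_def is_box_coefficients_def ray_generators_cone[OF True] box_rep_def by simp
  next
    case False
    then show ?thesis unfolding box_rep_def by blast
  qed
  ultimately show ?thesis by simp
qed

text \<open>The coefficients of \<open>l\<close> are positive, so a cone containing \<open>l\<close> has all vertices of \<open>S\<close> among its generators: the cone
  over \<open>S\<close> is the smallest one. By linear independence, the coefficients are unique and the dimension is the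
  number of vertices.\<close>

lemma sector_data:
  assumes rep: "box_rep l S q"
  shows "sector_cone P l = nonneg_span (gens S)" "box_coefficients P l = q"
    "age P l = (\<Sum>b\<in>gens S. q b)" "inverse_sector P l = (\<Sum>b\<in>gens S. (1 - q b) *\<^sub>R b)"
    "sector_dim P l = int CARD('n) - int (card (gens S))"
proof -
  have S: "proper_face S" and q: "\<forall>b\<in>gens S. 0 < q b \<and> q b < 1" "\<forall>b. b \<notin> gens S \<longrightarrow> q b = 0"
    and l: "l = (\<Sum>b\<in>gens S. q b *\<^sub>R b)" using rep by (auto simp: box_rep_def)
  have l_in: "l \<in> nonneg_span (gens S)" unfolding l using q by (intro nonneg_spanI) auto
  show cone: "sector_cone P l = nonneg_span (gens S)"
    unfolding sector_cone_def
  proof (rule Least_equality)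
    show "nonneg_span (gens S) \<in> face_fan P \<and> l \<in> nonneg_span (gens S)"
      using S l_in by (auto simp: face_fan_eq)
    fix \<tau> assume "\<tau> \<in> face_fan P \<and> l \<in> \<tau>"
    then obtain T where T: "proper_face T" "\<tau> = nonneg_span (gens T)" "l \<in> nonneg_span (gens T)"
      by (auto simp: face_fan_eq)
    have "l \<in> nonneg_span (gens S \<inter> gens T)" using l_in T cone_Int_gens[OF S T(1)] by blast
    then obtain a where a: "l = (\<Sum>b\<in>gens S \<inter> gens T. a b *\<^sub>R b)" by (rule nonneg_spanE)
    also have "\<dots> = (\<Sum>b\<in>gens S. (if b \<in> gens T then a b else 0) *\<^sub>R b)"
      using gens_facts(1) by (intro sum.mono_neutral_cong_left) auto
    finally have eq: "(\<Sum>b\<in>gens S. q b *\<^sub>R b) = (\<Sum>b\<in>gens S. (if b \<in> gens T then a b else 0) *\<^sub>R b)"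
      using l by simp
    have "gens S \<subseteq> gens T"
    proof
      fix b assume b: "b \<in> gens S"
      then have "q b = (if b \<in> gens T then a b else 0)"
        using independent_coefficients_unique[OF independent_gens[OF S] eq] by blast
      then show "b \<in> gens T" using q b by (auto split: if_splits)
    qed
    then show "nonneg_span (gens S) \<le> \<tau>" unfolding T(2) by (rule nonneg_span_mono[OF gens_facts(1)])
  qed
  note ray = ray_generators_cone[OF S]
  show coeff: "box_coefficients P l = q"
    unfolding box_coefficients_def cone
  proof (rule the_equality)
    show "is_box_coefficients P (nonneg_span (gens S)) l q"
      using q l by (simp add: is_box_coefficients_def ray)
    fix q' assume "is_box_coefficients P (nonneg_span (gens S)) l q'"
    then have q': "\<forall>b. b \<notin> gens S \<longrightarrow> q' b = 0" "(\<Sum>b\<in>gens S. q' b *\<^sub>R b) = (\<Sum>b\<in>gens S. q b *\<^sub>R b)"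
      using l by (auto simp: is_box_coefficients_def ray)
    show "q' = q"
    proof
      fix b show "q' b = q b"
        using independent_coefficients_unique[OF independent_gens[OF S] q'(2), of b] q'(1) q(2)
        by (cases "b \<in> gens S") auto
    qed
  qed
  show "age P l = (\<Sum>b\<in>gens S. q b)" by (simp add: age_def cone ray coeff)
  show "inverse_sector P l = (\<Sum>b\<in>gens S. (1 - q b) *\<^sub>R b)" by (simp add: inverse_sector_def cone ray coeff)
  have "dim (nonneg_span (gens S)) = card (gens S)"
    using dim_span[of "nonneg_span (gens S)"] span_nonneg_span[OF gens_facts(1), of S]
      dim_span[of "gens S"] dim_eq_card_independent[OF independent_gens[OF S]] by simp
  then show "sector_dim P l = int CARD('n) - int (card (gens S))" by (simp add: sector_dim_def cone)
qed

lemma inverse_sector_rep: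
  assumes rep: "box_rep l S q"
  shows "box_rep (inverse_sector P l) S (\<lambda>b. if b \<in> gens S then 1 - q b else 0)"
proof -
  have inv: "inverse_sector P l = (\<Sum>b\<in>gens S. (1 - q b) *\<^sub>R b)" by (rule sector_data[OF rep])
  also have "\<dots> = (\<Sum>b\<in>gens S. b) - l"
  proof -
    have "l = (\<Sum>b\<in>gens S. q b *\<^sub>R b)" using rep unfolding box_rep_def by blast
    then show ?thesis by (simp add: scaleR_left_diff_distrib sum_subtractf)
  qed
  finally have "inverse_sector P l = (\<Sum>b\<in>gens S. b) - l" .
  moreover have "(\<Sum>b\<in>gens S. b) \<in> integral_points" using gens_facts(2) by (intro integral_points_sum) auto
  moreover have "l \<in> integral_points" using rep unfolding box_rep_def by blast
  ultimately have "inverse_sector P l \<in> integral_points"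
    using integral_points_closed(3) by simp
  then show ?thesis using rep unfolding box_rep_def inv by auto
qed

lemma inverse_sector_facts:
  assumes "l \<in> sectors P"
  shows "inverse_sector P l \<in> sectors P" "sector_dim P (inverse_sector P l) = sector_dim P l"
    "age P (inverse_sector P l) = real CARD('n) - of_int (sector_dim P l) - age P l"
proof -
  obtain S q where rep: "box_rep l S q" using assms sectors_iff by blast
  note inv = inverse_sector_rep[OF rep]
  show "inverse_sector P l \<in> sectors P" using inv sectors_iff by blast
  show "sector_dim P (inverse_sector P l) = sector_dim P l"
    unfolding sector_data(5)[OF rep] sector_data(5)[OF inv] ..
  show "age P (inverse_sector P l) = real CARD('n) - of_int (sector_dim P l) - age P l"
    unfolding sector_data(3)[OF rep] sector_data(3)[OF inv] sector_data(5)[OF rep]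
    by (simp add: sum_subtractf)
qed

lemma finite_bounded_integral_points: "finite {v :: real ^ 'n. v \<in> integral_points \<and> norm v \<le> R}"
proof -
  have "{v :: real ^ 'n. v \<in> integral_points \<and> norm v \<le> R} \<subseteq>
      (\<lambda>f. \<chi> i. f i) ` (\<Pi>\<^sub>E i\<in>UNIV. {k \<in> \<int>. \<bar>k\<bar> \<le> R})"
  proof
    fix v :: "real ^ 'n" assume v: "v \<in> {v. v \<in> integral_points \<and> norm v \<le> R}"
    have "\<bar>v $ i\<bar> \<le> R" for i using component_le_norm_cart[of v i] v by simp
    then have "(\<lambda>i. v $ i) \<in> (\<Pi>\<^sub>E i\<in>UNIV. {k \<in> \<int>. \<bar>k\<bar> \<le> R})" using v by (auto simp: integral_points_def)
    moreover have "v = (\<chi> i. v $ i)" by (simp add: vec_eq_iff)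
    ultimately show "v \<in> (\<lambda>f. \<chi> i. f i) ` (\<Pi>\<^sub>E i\<in>UNIV. {k \<in> \<int>. \<bar>k\<bar> \<le> R})"
      by (intro image_eqI[of _ _ "\<lambda>i. v $ i"])
  qed
  moreover have "finite (\<Pi>\<^sub>E i\<in>(UNIV :: 'n set). {k :: real. k \<in> \<int> \<and> \<bar>k\<bar> \<le> R})"
    by (intro finite_PiE finite_abs_int_segment) simp
  then have "finite ((\<lambda>f. \<chi> i. f i) ` (\<Pi>\<^sub>E i\<in>(UNIV :: 'n set). {k :: real. k \<in> \<int> \<and> \<bar>k\<bar> \<le> R}))" by (rule finite_imageI)
  ultimately show ?thesis by (rule finite_subset)
qed

text \<open>The sectors are integral points of bounded norm.\<close>

lemma finite_sectors: "finite (sectors P)"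
proof -
  have "norm l \<le> (\<Sum>b\<in>vertices P. norm b)" if l: "l \<in> sectors P" for l
  proof -
    obtain S q where rep: "box_rep l S q" using l sectors_iff by blast
    have "norm l \<le> (\<Sum>b\<in>gens S. norm (q b *\<^sub>R b))"
    proof -
      have "l = (\<Sum>b\<in>gens S. q b *\<^sub>R b)" using rep unfolding box_rep_def by blast
      then show ?thesis using norm_sum by metis
    qed
    also have "\<dots> \<le> (\<Sum>b\<in>gens S. norm b)"
      using rep by (intro sum_mono) (auto simp: box_rep_def mult_left_le_one_le)
    also have "\<dots> \<le> (\<Sum>b\<in>vertices P. norm b)"
      using gens_facts(4) finite_vertices by (intro sum_mono2) auto
    finally show ?thesis .
  qed
  moreover have "l \<in> integral_points" if "l \<in> sectors P" for l
    using that sectors_iff by (auto simp: box_rep_def)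
  ultimately have "sectors P \<subseteq> {v. v \<in> integral_points \<and> norm v \<le> (\<Sum>b\<in>vertices P. norm b)}" by blast
  then show ?thesis using finite_bounded_integral_points by (auto intro: finite_subset)
qed

lemma finite_homology_sector:
  assumes "l \<in> sectors P" shows "finite_homology (sector_space P l) {}"
proof -
  obtain S q where rep: "box_rep l S q" using assms sectors_iff by blast
  then have "proper_face S" by (simp add: box_rep_def)
  then show ?thesis
    unfolding sector_space_def sector_data(1)[OF rep]
    by (intro toric_fan.finite_homology_toric_variety toric_fan_quotient)
qed

end

section \<open>Orbifold cohomology\<close>

theorem theorem3p9:
  fixes P :: "(real ^ 'n) set"
    and c :: "'n orb_class \<Rightarrow> 'n orb_class"
  assumes "simplicial_lattice_polytope P"
    and "0 \<in> interior P"
    and "poincare_lefschetz_conjugation P c"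
  shows "mixed_hodge_structure (orb_cohomology P) (real_form (orb_cohomology P) c)
           (hodge_filtration P) (weight_filtration P)"
proof -
  interpret simplicial_polytope P by unfold_locales (fact assms)+
  let ?I = "sectors P \<times> (UNIV :: nat set)"
  define M where "M = (\<lambda>(l, j). cohomology (2 * j) (sector_space P l))"
  \<comment> \<open>The summand with index \<open>(l, j)\<close> occurs in step \<open>p\<close> of the Hodge filtration iff \<open>h (l, j) \<ge> p\<close>, and in step \<open>m\<close> of the weight filtration iff \<open>w (l, j) \<le> m\<close>.\<close>
  define h where "h = (\<lambda>(l, j). if age P l \<in> \<int> then int CARD('n) - int j - \<lfloor>age P l\<rfloor>
    else int CARD('n) - 1 - int j - \<lfloor>age P l\<rfloor>)"
  define w where "w = (\<lambda>(l, j). if age P l \<in> \<int> then int CARD('n) + sector_dim P l - 2 * int j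
    else int CARD('n) - 1 + sector_dim P l - 2 * int j)"
  define \<iota> where "\<iota> = (\<lambda>(l, j :: nat). (inverse_sector P l, j))"
  have D: "orb_cohomology P = direct_sum_module ?I M"
    by (simp add: orb_cohomology_def M_def)
  have part: "orb_part P K = support_part ?I M K" for K
    by (simp add: orb_part_def support_part_def D)
  have space: "complex_vector_space (M k)" for k
    by (cases k) (simp add: M_def cohomology_space)
  have sep: "finitely_separated (M k)" if k: "k \<in> ?I" for k
  proof -
    obtain l j where lj: "k = (l, j)" "l \<in> sectors P" using k by auto
    then show ?thesis
      using finitely_separated_cohomology[OF finite_homologyD(1)[OF finite_homology_sector[OF lj(2)]]]
      by (simp add: M_def)
  qed
  have support: "finite {k \<in> ?I. carrier (M k) \<noteq> {\<zero>\<^bsub>M k\<^esub>}}"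
  proof -
    have "\<forall>l\<in>sectors P. \<exists>N. \<forall>p>N. trivial_group (homology_group p (sector_space P l))"
      using finite_homologyD(2)[OF finite_homology_sector] by blast
    then obtain N where N: "\<forall>l\<in>sectors P. \<forall>p>N l. trivial_group (homology_group p (sector_space P l))"
      by (rule bchoice[THEN exE])
    have "{k \<in> ?I. carrier (M k) \<noteq> {\<zero>\<^bsub>M k\<^esub>}} \<subseteq> (SIGMA l:sectors P. {..nat (N l)})"
    proof
      fix k assume k: "k \<in> {k \<in> ?I. carrier (M k) \<noteq> {\<zero>\<^bsub>M k\<^esub>}}"
      obtain l j where lj: "k = (l, j)" by (cases k)
      have "\<not> trivial_group (homology_group (int (2 * j)) (sector_space P l))"
        using trivial_cohomology[of "2 * j" "sector_space P l"] k by (auto simp: lj M_def)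
      then have "\<not> int (2 * j) > N l" using N k by (auto simp: lj)
      then have "j \<le> nat (N l)" by linarith
      then show "k \<in> (SIGMA l:sectors P. {..nat (N l)})" using k by (simp add: lj)
    qed
    moreover have "finite (SIGMA l:sectors P. {..nat (N l)})" using finite_sectors by simp
    ultimately show ?thesis by (rule finite_subset)
  qed
  have age_inv: "age P (inverse_sector P l) \<in> \<int> \<longleftrightarrow> age P l \<in> \<int>" if "l \<in> sectors P" for l
  proof -
    have "age P l = of_int (int CARD('n) - sector_dim P l) - age P (inverse_sector P l)"
      using inverse_sector_facts(3)[OF that] by simp
    then show ?thesis using inverse_sector_facts(3)[OF that] by (metis Ints_diff Ints_of_int Ints_of_nat)
  qed
  \<comment> \<open>The ages of \<open>l\<close> and of its inverse add up to an integer. So both are integral or neither is, and in the latter case their integer parts add up to one less.\<close>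
  have floor_inv: "\<lfloor>age P (inverse_sector P l)\<rfloor> =
      int CARD('n) - sector_dim P l - \<lfloor>age P l\<rfloor> - (if age P l \<in> \<int> then 0 else 1)"
    if "l \<in> sectors P" for l
  proof (cases "age P l \<in> \<int>")
    case True
    then obtain a where "age P l = of_int a" by (auto elim: Ints_cases)
    then show ?thesis using inverse_sector_facts(3)[OF that] True by (simp add: floor_eq_iff)
  next
    case False
    then have "of_int \<lfloor>age P l\<rfloor> \<noteq> age P l" by (metis Ints_of_int)
    moreover define f where "f = \<lfloor>age P l\<rfloor>"
    ultimately have "of_int f < age P l" "age P l < of_int f + 1"
      using of_int_floor_le[of "age P l"] by linarith+
    then show ?thesis using inverse_sector_facts(3)[OF that] False by (simp add: floor_eq_iff flip: f_def)
  qed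
  interpret hodge_bigraded ?I M h w \<iota> c
  proof (intro hodge_bigraded.intro direct_sum.intro hodge_bigraded_axioms.intro)
    show "complex_vector_space (M k)" for k by (rule space)
    show "finite {k \<in> ?I. carrier (M k) \<noteq> {\<zero>\<^bsub>M k\<^esub>}}" by (rule support)
    show "finitely_separated (direct_sum_module ?I M)"
      by (rule finitely_separated_direct_sum[OF space sep support]) auto
    show "conjugation (direct_sum_module ?I M) c"
      using assms(3) by (simp add: poincare_lefschetz_conjugation_def D)
    fix k assume "k \<in> ?I"
    then obtain l j where k: "k = (l, j)" "l \<in> sectors P" by auto
    show "w (\<iota> k) = w k"
      using age_inv[OF k(2)] inverse_sector_facts(2)[OF k(2)] by (simp add: k w_def \<iota>_def)
    show "h (\<iota> k) = w k - h k"
      using age_inv[OF k(2)] floor_inv[OF k(2)] by (simp add: k h_def w_def \<iota>_def)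
    have "c ` support_part ?I M {k} \<subseteq> support_part ?I M ({inverse_sector P l} \<times> {j..})"
      using assms(3) k(2) by (simp add: poincare_lefschetz_conjugation_def part k(1))
    also have "\<dots> \<subseteq> support_part ?I M ({\<iota> k} \<union> {i. w i < w k})"
    proof -
      have "i \<in> {\<iota> k} \<union> {i. w i < w k}" if "i \<in> {inverse_sector P l} \<times> {j..}" for i
        using that age_inv[OF k(2)] inverse_sector_facts(2)[OF k(2)]
        by (cases i) (auto simp: k(1) \<iota>_def w_def)
      then show ?thesis unfolding support_part_def by blast
    qed
    finally show "c ` support_part ?I M {k} \<subseteq> support_part ?I M ({\<iota> k} \<union> {i. w i < w k})" .
  qed
  have "hodge_filtration P p = Fil p" for p
  proof -
    have "(\<exists>i\<ge>p. real j = (if age P l \<in> \<int> then real CARD('n) - of_int i - age P l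
        else real CARD('n) - 1 - of_int i - of_int \<lfloor>age P l\<rfloor>)) \<longleftrightarrow> h (l, j) \<ge> p" for l j
    proof (cases "age P l \<in> \<int>")
      case True
      then obtain a where a: "age P l = of_int a" by (auto elim: Ints_cases)
      have "real j = real CARD('n) - of_int i - age P l \<longleftrightarrow> i = h (l, j)" for i
        unfolding h_def using True a by auto
      then show ?thesis using True by auto
    next
      case False
      have "real j = real CARD('n) - 1 - of_int i - of_int \<lfloor>age P l\<rfloor> \<longleftrightarrow> i = h (l, j)" for i
        unfolding h_def using False by auto
      then show ?thesis using False by auto
    qed
    then show ?thesis unfolding hodge_filtration_def Fil_def part by (auto intro!: arg_cong[of _ _ "support_part ?I M"])
  qed
  moreover have "weight_filtration P m = Wt m" for m
  proof -
    have "{(l, j). (if age P l \<in> \<int> then int CARD('n) + sector_dim P l - m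
        else int CARD('n) - 1 + sector_dim P l - m) \<le> 2 * int j} = {k. w k \<le> m}"
      by (auto simp: w_def split: if_splits)
    then show ?thesis unfolding weight_filtration_def Wt_def part by simp
  qed
  ultimately have "hodge_filtration P = Fil" "weight_filtration P = Wt" by auto
  then show ?thesis using mixed_hodge_structure_bigraded unfolding D by simp
qed

end
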